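(* A subcategory $\mathcal{A}\subseteq\mathcal{C}_2$ is maximal almost rigid if and only if the set of arcs corresponding to its indecomposable objects is a triangulation of the completed $\infty$-gon.
   Context: Let $R=\mathbb{C}[x,y]/(x^2)$, graded with $\deg x=1$, $\deg y=-1$; $M(j)$ denotes the graded module with $M(j)_n=M_{j+n}$. Let $\mathcal{C}_2$ be the exact (Frobenius) category of finitely generated $\mathbb{Z}$-graded maximal Cohen–Macaulay $R$-modules with degree-preserving morphisms. Every indecomposable object of $\mathcal{C}_2$ is isomorphic to exactly one of $(x,y^k)(j)$ ($k\in\mathbb{Z}_{\ge0}$, $j\in\mathbb{Z}$, with $(x,y^0)=R$) or $\mathbb{C}[y](j)=(R/(x))(j)$ ($j\in\mathbb{Z}$). An arc of the completed $\infty$-gon is a pair $(a,b)$ with $a\in\mathbb{Z}\cup\{-\infty\}$, $b\in\mathbb{Z}$, $a<b$; it is finite if $a\in\mathbb{Z}$ and infinite if $a=-\infty$. Indecomposables are identified with arcs via $(x,y^k)(j)\leftrightarrow(-j-k,1-j)$ and $\mathbb{C}[y](j)\leftrightarrow(-\infty,-j)$. Two arcs $(a,b),(c,d)$ cross if $a<c<b<d$ or $c<a<d<b$. A triangulation of the completed $\infty$-gon is a maximal set of pairwise non-crossing arcs. Subcategories are full, additive and closed under isomorphisms and direct summands. Two indecomposables $M,N$ are almost compatible if there are no non-split extensions between them (in either direction), or all non-split extensions between them have indecomposable middle terms. A subcategory $\mathcal{A}$ is almost rigid if any two indecomposables in $\mathcal{A}$ are almost compatible, and maximal almost rigid if it is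 almost rigid and for every module $M\notin\mathcal{A}$, $\mathrm{add}(\mathcal{A}\cup M)$ is not almost rigid. *)

theory Defs
  imports Complex_Main
begin

section \<open>Graded modules over R = C[x,y]/(x^2), deg x = 1, deg y = -1\<close>

text \<open>A Z-graded R-module is a family of complex vector spaces M_n (n in Z) together
with linear maps x : M_n -> M_(n+1) and y : M_n -> M_(n-1) such that xy = yx and x^2 = 0.
All graded pieces are realised as complex subspaces of the ambient space nat => complex
(every finitely generated graded R-module has finite-dimensional graded pieces, so every
object of C_2 has an isomorphic copy of this form).\<close>

type_synonym vec = "nat \<Rightarrow> complex"

definition vzero :: vec where "vzero = (\<lambda>_. 0)"
definition vadd :: "vec \<Rightarrow> vec \<Rightarrow> vec" where "vadd u v = (\<lambda>i. u i + v i)"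
definition vsc :: "complex \<Rightarrow> vec \<Rightarrow> vec" where "vsc c v = (\<lambda>i. c * v i)"

definition subspace :: "vec set \<Rightarrow> bool" where
  "subspace S \<longleftrightarrow> vzero \<in> S \<and> (\<forall>u\<in>S. \<forall>v\<in>S. vadd u v \<in> S) \<and> (\<forall>c. \<forall>u\<in>S. vsc c u \<in> S)"

definition lin_on :: "vec set \<Rightarrow> (vec \<Rightarrow> vec) \<Rightarrow> bool" where
  "lin_on S f \<longleftrightarrow> (\<forall>u\<in>S. \<forall>v\<in>S. f (vadd u v) = vadd (f u) (f v)) \<and> (\<forall>c. \<forall>u\<in>S. f (vsc c u) = vsc c (f u))"

record gmod =
  pc :: "int \<Rightarrow> vec set"
  xa :: "int \<Rightarrow> vec \<Rightarrow> vec"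
  ya :: "int \<Rightarrow> vec \<Rightarrow> vec"

definition is_gmod :: "gmod \<Rightarrow> bool" where
  "is_gmod M \<longleftrightarrow> (\<forall>n.
     subspace (pc M n) \<and>
     xa M n ` pc M n \<subseteq> pc M (n + 1) \<and> lin_on (pc M n) (xa M n) \<and>
     ya M n ` pc M n \<subseteq> pc M (n - 1) \<and> lin_on (pc M n) (ya M n) \<and>
     (\<forall>v\<in>pc M n. xa M (n - 1) (ya M n v) = ya M (n + 1) (xa M n v)) \<and>
     (\<forall>v\<in>pc M n. xa M (n + 1) (xa M n v) = vzero))"

definition gsub :: "gmod \<Rightarrow> (int \<Rightarrow> vec set) \<Rightarrow> bool" where
  "gsub M U \<longleftrightarrow> (\<forall>n. U n \<subseteq> pc M n \<and> subspace (U n) \<and>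
     xa M n ` U n \<subseteq> U (n + 1) \<and> ya M n ` U n \<subseteq> U (n - 1))"

definition gen :: "gmod \<Rightarrow> (int \<times> vec) set \<Rightarrow> int \<Rightarrow> vec set" where
  "gen M G = (\<lambda>n. \<Inter>{U n | U. gsub M U \<and> (\<forall>(d, g)\<in>G. g \<in> U d)})"

definition fin_gen :: "gmod \<Rightarrow> bool" where
  "fin_gen M \<longleftrightarrow> (\<exists>G. finite G \<and> (\<forall>(d, g)\<in>G. g \<in> pc M d) \<and> gen M G = pc M)"

text \<open>Maximal Cohen-Macaulay: y (a homogeneous parameter of the one-dimensional ring R)
is a non-zerodivisor on M, i.e. depth M >= 1 = dim R.\<close>

definition mcm :: "gmod \<Rightarrow> bool" where
  "mcm M \<longleftrightarrow> (\<forall>n. inj_on (ya M n) (pc M n))"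

definition C2 :: "gmod \<Rightarrow> bool" where
  "C2 M \<longleftrightarrow> is_gmod M \<and> fin_gen M \<and> mcm M"

definition hom :: "gmod \<Rightarrow> gmod \<Rightarrow> (int \<Rightarrow> vec \<Rightarrow> vec) \<Rightarrow> bool" where
  "hom M N f \<longleftrightarrow> (\<forall>n. f n ` pc M n \<subseteq> pc N n \<and> lin_on (pc M n) (f n) \<and>
     (\<forall>v\<in>pc M n. f (n + 1) (xa M n v) = xa N n (f n v)) \<and>
     (\<forall>v\<in>pc M n. f (n - 1) (ya M n v) = ya N n (f n v)))"

definition gm_iso :: "gmod \<Rightarrow> gmod \<Rightarrow> bool" where
  "gm_iso M N \<longleftrightarrow> (\<exists>f g. hom M N f \<and> hom N M g \<and>
     (\<forall>n. \<forall>v\<in>pc M n. g n (f n v) = v) \<and> (\<forall>n. \<forall>v\<in>pc N n. f n (g n v) = v))"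

definition is_zero :: "gmod \<Rightarrow> bool" where
  "is_zero M \<longleftrightarrow> (\<forall>n. pc M n = {vzero})"

definition indec :: "gmod \<Rightarrow> bool" where
  "indec M \<longleftrightarrow> \<not> is_zero M \<and>
     \<not> (\<exists>U W. gsub M U \<and> gsub M W \<and> (\<exists>n. U n \<noteq> {vzero}) \<and> (\<exists>n. W n \<noteq> {vzero}) \<and>
          (\<forall>n. U n \<inter> W n = {vzero} \<and> {vadd u w | u w. u \<in> U n \<and> w \<in> W n} = pc M n))"

definition is_biprod :: "gmod \<Rightarrow> gmod \<Rightarrow> gmod \<Rightarrow> bool" where
  "is_biprod E M N \<longleftrightarrow> (\<exists>i1 i2 p1 p2. hom M E i1 \<and> hom N E i2 \<and> hom E M p1 \<and> hom E N p2 \<and>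
     (\<forall>n. \<forall>v\<in>pc M n. p1 n (i1 n v) = v \<and> p2 n (i1 n v) = vzero) \<and>
     (\<forall>n. \<forall>v\<in>pc N n. p2 n (i2 n v) = v \<and> p1 n (i2 n v) = vzero) \<and>
     (\<forall>n. \<forall>v\<in>pc E n. vadd (i1 n (p1 n v)) (i2 n (p2 n v)) = v))"

definition ses :: "gmod \<Rightarrow> gmod \<Rightarrow> gmod \<Rightarrow> (int \<Rightarrow> vec \<Rightarrow> vec) \<Rightarrow> (int \<Rightarrow> vec \<Rightarrow> vec) \<Rightarrow> bool" where
  "ses N E M f g \<longleftrightarrow> hom N E f \<and> hom E M g \<and>
     (\<forall>n. inj_on (f n) (pc N n) \<and> g n ` pc E n = pc M n \<and>
          f n ` pc N n = {v \<in> pc E n. g n v = vzero})"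

definition splits :: "gmod \<Rightarrow> gmod \<Rightarrow> (int \<Rightarrow> vec \<Rightarrow> vec) \<Rightarrow> bool" where
  "splits E M g \<longleftrightarrow> (\<exists>s. hom M E s \<and> (\<forall>n. \<forall>v\<in>pc M n. g n (s n v) = v))"

definition nonsplit_ext :: "gmod \<Rightarrow> gmod \<Rightarrow> gmod \<Rightarrow> bool" where
  "nonsplit_ext N E M \<longleftrightarrow> C2 N \<and> C2 E \<and> C2 M \<and> (\<exists>f g. ses N E M f g \<and> \<not> splits E M g)"

definition almost_compatible :: "gmod \<Rightarrow> gmod \<Rightarrow> bool" where
  "almost_compatible M N \<longleftrightarrow>
     (\<not> (\<exists>E. nonsplit_ext M E N) \<and> \<not> (\<exists>E. nonsplit_ext N E M)) \<or>
     ((\<forall>E. nonsplit_ext M E N \<longrightarrow> indec E) \<and> (\<forall>E. nonsplit_ext N E M \<longrightarrow> indec E))"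

text \<open>Subcategories of C_2: full, additive, closed under isomorphisms and direct summands.\<close>

definition subcat :: "gmod set \<Rightarrow> bool" where
  "subcat A \<longleftrightarrow> A \<subseteq> {M. C2 M} \<and>
     (\<forall>M\<in>A. \<forall>N. C2 N \<and> gm_iso M N \<longrightarrow> N \<in> A) \<and>
     (\<exists>Z\<in>A. is_zero Z) \<and>
     (\<forall>E M N. M \<in> A \<and> N \<in> A \<and> C2 E \<and> is_biprod E M N \<longrightarrow> E \<in> A) \<and>
     (\<forall>E M N. E \<in> A \<and> C2 M \<and> C2 N \<and> is_biprod E M N \<longrightarrow> M \<in> A \<and> N \<in> A)"

definition add_closure :: "gmod set \<Rightarrow> gmod set" where
  "add_closure S = \<Inter>{B. subcat B \<and> S \<subseteq> B}"

definition almost_rigid :: "gmod set \<Rightarrow> bool" where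
  "almost_rigid A \<longleftrightarrow> (\<forall>M\<in>A. \<forall>N\<in>A. indec M \<and> indec N \<longrightarrow> almost_compatible M N)"

definition max_almost_rigid :: "gmod set \<Rightarrow> bool" where
  "max_almost_rigid A \<longleftrightarrow> almost_rigid A \<and>
     (\<forall>M. C2 M \<and> M \<notin> A \<longrightarrow> \<not> almost_rigid (add_closure (insert M A)))"

text \<open>R itself: in degree n, coordinate 0 is the coefficient of y^(-n) (present iff n <= 0)
and coordinate 1 the coefficient of x y^(1-n) (present iff n <= 1). Multiplication by x
sends y^a to x y^a and kills x y^a; multiplication by y raises the y-exponent by one.\<close>

definition e0 :: vec where "e0 = (\<lambda>i. if i = 0 then 1 else 0)"
definition e1 :: vec where "e1 = (\<lambda>i. if i = 1 then 1 else 0)"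

definition Rmod :: gmod where
  "Rmod = \<lparr> pc = (\<lambda>n. {v. (\<forall>i\<ge>2. v i = 0) \<and> (n > 0 \<longrightarrow> v 0 = 0) \<and> (n > 1 \<longrightarrow> v 1 = 0)}),
            xa = (\<lambda>n v. (\<lambda>i. if i = 1 then v 0 else 0)),
            ya = (\<lambda>n v. v) \<rparr>"

text \<open>C[y] = R/(x): in degree n, coordinate 0 is the coefficient of y^(-n); x acts by 0.\<close>

definition Cy :: gmod where
  "Cy = \<lparr> pc = (\<lambda>n. {v. (\<forall>i\<ge>1. v i = 0) \<and> (n > 0 \<longrightarrow> v 0 = 0)}),
          xa = (\<lambda>n v. vzero),
          ya = (\<lambda>n v. v) \<rparr>"

definition submod :: "gmod \<Rightarrow> (int \<Rightarrow> vec set) \<Rightarrow> gmod" where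
  "submod M U = M\<lparr>pc := U\<rparr>"

definition shift :: "gmod \<Rightarrow> int \<Rightarrow> gmod" where
  "shift M j = \<lparr> pc = (\<lambda>n. pc M (j + n)), xa = (\<lambda>n. xa M (j + n)), ya = (\<lambda>n. ya M (j + n)) \<rparr>"

definition ideal_xyk :: "nat \<Rightarrow> gmod" where
  "ideal_xyk k = submod Rmod (gen Rmod {(1, e1), (- int k, e0)})"

text \<open>Fin a b is the arc (a,b) with a,b integers; Inf b is the arc (-infinity, b).\<close>

datatype arc = Fin int int | Inf int

fun valid_arc :: "arc \<Rightarrow> bool" where
  "valid_arc (Fin a b) = (a < b)"
| "valid_arc (Inf b) = True"

text \<open>(a,b) and (c,d) cross iff a < c < b < d or c < a < d < b, with -infinity below every integer.\<close>

fun crosses :: "arc \<Rightarrow> arc \<Rightarrow> bool" where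
  "crosses (Fin a b) (Fin c d) = ((a < c \<and> c < b \<and> b < d) \<or> (c < a \<and> a < d \<and> d < b))"
| "crosses (Fin a b) (Inf d) = (a < d \<and> d < b)"
| "crosses (Inf b) (Fin c d) = (c < b \<and> b < d)"
| "crosses (Inf b) (Inf d) = False"

definition triangulation :: "arc set \<Rightarrow> bool" where
  "triangulation T \<longleftrightarrow> (\<forall>\<alpha>\<in>T. valid_arc \<alpha>) \<and> (\<forall>\<alpha>\<in>T. \<forall>\<beta>\<in>T. \<not> crosses \<alpha> \<beta>) \<and>
     (\<forall>\<gamma>. valid_arc \<gamma> \<and> \<gamma> \<notin> T \<longrightarrow> (\<exists>\<alpha>\<in>T. crosses \<gamma> \<alpha>))"

text \<open>Module attached to an arc: (x,y^k)(j) <-> (-j-k, 1-j), i.e. (a,b) <-> (x,y^(b-1-a))(1-b);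
C[y](j) <-> (-infinity, -j), i.e. (-infinity, b) <-> C[y](-b).\<close>

fun arc_mod :: "arc \<Rightarrow> gmod" where
  "arc_mod (Fin a b) = shift (ideal_xyk (nat (b - 1 - a))) (1 - b)"
| "arc_mod (Inf b) = shift Cy (- b)"

definition arcs_of :: "gmod set \<Rightarrow> arc set" where
  "arcs_of A = {\<alpha>. valid_arc \<alpha> \<and> (\<exists>M\<in>A. indec M \<and> gm_iso M (arc_mod \<alpha>))}"

end

theory Submission
  imports Defs "HOL-Library.Function_Algebras"
begin

text \<open>Since \<open>y\<close> is injective, a module in \<open>C2\<close> is a finite-dimensional vector space with a
  decreasing filtration and a square-zero operator \<open>T\<close> (the degree-zero map \<open>y x\<close>) raising the
  filtration by one. Such an object splits into Jordan blocks of size one and two, which gives the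
  indecomposables; their endomorphism rings are local. For two of these modules \<open>Ext\<^sup>1\<close> is computed by
  lifting generators: it vanishes if the arcs do not cross and are not both infinite, and for two
  infinite arcs the middle term of a non-split extension is a single block of size two. If the
  arcs cross, a Mayer--Vietoris sequence is a non-split extension with decomposable middle term.
  Hence almost compatible means non-crossing. Maximality is transferred between subcategories and
  sets of arcs by Krull--Schmidt.\<close>

section \<open>Linear algebra in the ambient space\<close>

text \<open>Two features of the definitions shape the argument. The closure
  \<open>add_closure\<close> is an intersection of subcategories: a module is shown to lie inside by
  lying in every one of them, and is kept outside by exhibiting a single one. The one exhibited
  consists of the modules whose arc summands are all old or isomorphic to the new one. Such a
  condition is inherited by summands at once, while its stability under direct sums is the delicate
  point. Summands are therefore treated as retracts throughout. Compatibility, on the other hand,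
  quantifies over all middle terms \<open>E\<close>, with arbitrary pieces and operators. Replacing
  \<open>E\<close> by an isomorphic module on which \<open>y\<close> is an inclusion makes every
  morphism a single map that does not depend on the degree, and turns the splitting of an extension
  into equations for the lifts of at most two generators. Finite generation is traded for
  \<open>tame\<close>, a degreewise condition that images inherit directly. The endpoints of an arc
  are the degrees of the generators of its module, so the inequalities of a crossing say which
  coordinates survive in which degree.\<close>

lemma vzero_eq: "vzero = 0"
  by (simp add: vzero_def zero_fun_def)

lemma vadd_eq: "vadd u v = u + v"
  by (simp add: vadd_def plus_fun_def)

lemma vsc_apply [simp]: "vsc c v i = c * v i"
  by (simp add: vsc_def)

interpretation V: vector_space vsc
  by unfold_locales (auto simp: vsc_def fun_eq_iff algebra_simps)

interpretation VC: vector_space_pair vsc "(*) :: complex \<Rightarrow> complex \<Rightarrow> complex"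
  by unfold_locales (auto simp: algebra_simps)

lemma subspace_eq: "subspace S \<longleftrightarrow> V.subspace S"
  by (auto simp: subspace_def V.subspace_def vzero_eq vadd_eq)

lemma lin_onI:
  assumes "\<And>u v. u \<in> S \<Longrightarrow> v \<in> S \<Longrightarrow> f (u + v) = f u + f v"
    and "\<And>c u. u \<in> S \<Longrightarrow> f (vsc c u) = vsc c (f u)"
  shows "lin_on S f"
  using assms by (auto simp: lin_on_def vadd_eq)

lemma lin_on_add: "lin_on S f \<Longrightarrow> u \<in> S \<Longrightarrow> v \<in> S \<Longrightarrow> f (u + v) = f u + f v"
  by (auto simp: lin_on_def vadd_eq)

lemma lin_on_scale: "lin_on S f \<Longrightarrow> u \<in> S \<Longrightarrow> f (vsc c u) = vsc c (f u)"
  by (auto simp: lin_on_def)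

lemma lin_on_0: "lin_on S f \<Longrightarrow> V.subspace S \<Longrightarrow> f 0 = 0"
  using lin_on_scale[of S f 0 0] by (simp add: V.subspace_0)

lemma lin_on_minus: "lin_on S f \<Longrightarrow> u \<in> S \<Longrightarrow> f (- u) = - f u"
  using lin_on_scale[of S f u "-1"] by simp

lemma lin_on_diff:
  "lin_on S f \<Longrightarrow> V.subspace S \<Longrightarrow> u \<in> S \<Longrightarrow> v \<in> S \<Longrightarrow> f (u - v) = f u - f v"
  using lin_on_add[of S f u "- v"] lin_on_minus[of S f v] by (simp add: V.subspace_neg)

lemma lin_on_mono: "lin_on S f \<Longrightarrow> S' \<subseteq> S \<Longrightarrow> lin_on S' f"
  unfolding lin_on_def by blast

lemma lin_on_comp: "lin_on S f \<Longrightarrow> f ` S \<subseteq> S' \<Longrightarrow> lin_on S' g \<Longrightarrow> lin_on S (\<lambda>v. g (f v))"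
  unfolding lin_on_def image_subset_iff by simp

lemma subspace_image:
  assumes f: "lin_on S f" and S: "V.subspace S"
  shows "V.subspace (f ` S)"
proof (rule V.subspaceI)
  show "0 \<in> f ` S"
    using lin_on_0[OF f S] V.subspace_0[OF S] by force
next
  fix x y assume "x \<in> f ` S" "y \<in> f ` S"
  then obtain u v where "u \<in> S" "v \<in> S" "x = f u" "y = f v" by blast
  then have "x + y = f (u + v)" "u + v \<in> S"
    using lin_on_add[OF f] V.subspace_add[OF S] by auto
  then show "x + y \<in> f ` S" by simp
next
  fix c x assume "x \<in> f ` S"
  then obtain u where "u \<in> S" "x = f u" by blast
  then have "vsc c x = f (vsc c u)" "vsc c u \<in> S"
    using lin_on_scale[OF f] V.subspace_scale[OF S] by auto
  then show "vsc c x \<in> f ` S" by simp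
qed

lemma span_image_subset:
  assumes f: "lin_on S f" and S: "V.subspace S" and B: "B \<subseteq> S" and fB: "f ` B \<subseteq> C"
    and C: "V.subspace C"
  shows "f ` V.span B \<subseteq> C"
proof -
  have "V.subspace {v \<in> S. f v \<in> C}"
    using S C lin_on_0[OF f S]
    by (auto simp: V.subspace_def lin_on_add[OF f] lin_on_scale[OF f])
  moreover have "B \<subseteq> {v \<in> S. f v \<in> C}"
    using B fB by auto
  ultimately have "V.span B \<subseteq> {v \<in> S. f v \<in> C}"
    by (rule V.span_minimal[rotated])
  then show ?thesis by auto
qed

text \<open>The functional is 1 at \<open>v\<close> and 0 on a basis of \<open>S\<close>. A vector
  outside a subspace thus yields a coordinate function, from which the projection onto a summand is
  built later.\<close>

lemma ex_functional:
  assumes S: "V.subspace S" and v: "v \<notin> S"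
  obtains l :: "vec \<Rightarrow> complex"
  where "\<And>u w. l (u + w) = l u + l w" "\<And>c u. l (vsc c u) = c * l u" "l v = 1"
    "\<And>s. s \<in> S \<Longrightarrow> l s = 0"
proof -
  obtain B where B: "B \<subseteq> S" "V.independent B" "S \<subseteq> V.span B"
    using V.maximal_independent_subset by blast
  have sp: "V.span B = S"
    using B S by (meson V.span_minimal subset_antisym)
  have "V.independent (insert v B)"
    using B v sp by (intro V.independent_insertI) auto
  from VC.linear_independent_extend[OF this, of "\<lambda>x. if x = v then 1 else 0"]
  obtain l where l: "Vector_Spaces.linear vsc (*) l" "\<forall>x\<in>insert v B. l x = (if x = v then 1 else 0)"
    by blast
  interpret l: Vector_Spaces.linear vsc "(*) :: complex \<Rightarrow> complex \<Rightarrow> complex" l by (rule l(1))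
  have "l s = 0" if "s \<in> S" for s
  proof (rule l.eq_0_on_span[of B])
    show "l b = 0" if "b \<in> B" for b
      using l(2) that v B(1) by auto
    show "s \<in> V.span B" using sp that by simp
  qed
  then show thesis
    using that[of l] l(2) l.add l.scale by auto
qed

text \<open>The bound \<open>dim S <= k\<close>, put in terms of a spanning set so that it passes to
  images without any appeal to a dimension function.\<close>

definition spanned :: "vec set \<Rightarrow> nat \<Rightarrow> bool" where
  "spanned S k \<longleftrightarrow> (\<exists>B. finite B \<and> card B \<le> k \<and> B \<subseteq> S \<and> S \<subseteq> V.span B)"

lemma spanned_image:
  assumes "spanned S k" "lin_on S f" "V.subspace S"
  shows "spanned (f ` S) k"
proof -
  obtain B where B: "finite B" "card B \<le> k" "B \<subseteq> S" "S \<subseteq> V.span B"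
    using assms(1) by (auto simp: spanned_def)
  have "f ` V.span B \<subseteq> V.span (f ` B)"
    by (rule span_image_subset[OF assms(2,3) B(3) V.span_superset V.subspace_span])
  then have "f ` S \<subseteq> V.span (f ` B)" using B(4) by blast
  moreover have "card (f ` B) \<le> k" using card_image_le[OF B(1), of f] B(2) by linarith
  ultimately show ?thesis
    unfolding spanned_def using B(1,3) by (intro exI[of _ "f ` B"] conjI) auto
qed

text \<open>A basis of \<open>W\<close> stays independent after adding \<open>u\<close>, so the
  exchange bound leaves at most \<open>k\<close> vectors for the basis itself. This is the drop in
  rank when an arc module is split off.\<close>

lemma spanned_proper_subspace:
  assumes S: "spanned S (Suc k)" and W: "V.subspace W" "W \<subseteq> S" "u \<in> S" "u \<notin> W"
  shows "spanned W k"
proof -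
  obtain C where C: "finite C" "card C \<le> Suc k" "S \<subseteq> V.span C"
    using S unfolding spanned_def by blast
  obtain B where B: "B \<subseteq> W" "V.independent B" "W \<subseteq> V.span B"
    using V.maximal_independent_subset by blast
  have "V.span B \<subseteq> W" using B(1) W(1) by (rule V.span_minimal)
  then have "V.independent (insert u B)"
    using V.independent_insertI[OF _ B(2), of u] W(4) by blast
  moreover have "insert u B \<subseteq> V.span C"
    using B(1) W(2,3) C(3) by blast
  ultimately have "finite (insert u B) \<and> card (insert u B) \<le> card C"
    by (rule V.independent_span_bound[OF C(1)])
  moreover have "u \<notin> B" using B(1) W(4) by blast
  ultimately have "finite B" "card B \<le> k"
    using C(2) by (auto simp: card_insert_disjoint)
  then show ?thesis
    unfolding spanned_def using B(1,3) by (intro exI[of _ B] conjI)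
qed

lemma spanned_0:
  assumes "spanned S 0" shows "S \<subseteq> {0}"
proof -
  obtain B where "finite B" "card B = 0" and S: "S \<subseteq> V.span B"
    using assms unfolding spanned_def by (elim exE conjE) simp
  then have "B = {}" by simp
  with S show ?thesis by simp
qed

section \<open>Graded modules and homomorphisms\<close>

lemma is_gmodD:
  assumes "is_gmod M"
  shows "V.subspace (pc M n)"
    and "v \<in> pc M n \<Longrightarrow> xa M n v \<in> pc M (n + 1)"
    and "lin_on (pc M n) (xa M n)"
    and "v \<in> pc M n \<Longrightarrow> ya M n v \<in> pc M (n - 1)"
    and "lin_on (pc M n) (ya M n)"
    and "v \<in> pc M n \<Longrightarrow> xa M (n - 1) (ya M n v) = ya M (n + 1) (xa M n v)"
    and "v \<in> pc M n \<Longrightarrow> xa M (n + 1) (xa M n v) = 0"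
  using assms unfolding is_gmod_def subspace_eq vzero_eq image_subset_iff by simp_all

lemma is_gmodI:
  assumes "\<And>n. V.subspace (pc M n)"
    and "\<And>n v. v \<in> pc M n \<Longrightarrow> xa M n v \<in> pc M (n + 1)"
    and "\<And>n. lin_on (pc M n) (xa M n)"
    and "\<And>n v. v \<in> pc M n \<Longrightarrow> ya M n v \<in> pc M (n - 1)"
    and "\<And>n. lin_on (pc M n) (ya M n)"
    and "\<And>n v. v \<in> pc M n \<Longrightarrow> xa M (n - 1) (ya M n v) = ya M (n + 1) (xa M n v)"
    and "\<And>n v. v \<in> pc M n \<Longrightarrow> xa M (n + 1) (xa M n v) = 0"
  shows "is_gmod M"
  using assms by (auto simp: is_gmod_def subspace_eq vzero_eq)

lemma homD:
  assumes "hom M N f"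
  shows "v \<in> pc M n \<Longrightarrow> f n v \<in> pc N n"
    and "lin_on (pc M n) (f n)"
    and "v \<in> pc M n \<Longrightarrow> f (n + 1) (xa M n v) = xa N n (f n v)"
    and "v \<in> pc M n \<Longrightarrow> f (n - 1) (ya M n v) = ya N n (f n v)"
  using assms unfolding hom_def image_subset_iff by simp_all

lemma homI:
  assumes "\<And>n v. v \<in> pc M n \<Longrightarrow> f n v \<in> pc N n"
    and "\<And>n. lin_on (pc M n) (f n)"
    and "\<And>n v. v \<in> pc M n \<Longrightarrow> f (n + 1) (xa M n v) = xa N n (f n v)"
    and "\<And>n v. v \<in> pc M n \<Longrightarrow> f (n - 1) (ya M n v) = ya N n (f n v)"
  shows "hom M N f"
  using assms by (auto simp: hom_def)

lemma hom_id: "hom M M (\<lambda>n v. v)"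
  by (rule homI) (auto intro: lin_onI)

lemma hom_comp:
  assumes f: "hom L M f" and g: "hom M N g"
  shows "hom L N (\<lambda>n v. g n (f n v))"
  by (rule homI)
    (auto simp: homD[OF f] homD[OF g] intro!: lin_on_comp[OF homD(2)[OF f] _ homD(2)[OF g]])

lemma hom_add_scale:
  assumes f: "hom M N f" and g: "hom M N g" and M: "is_gmod M" and N: "is_gmod N"
  shows "hom M N (\<lambda>n v. vsc a (f n v) + vsc b (g n v))"
proof -
  note fD = homD[OF f] and gD = homD[OF g] and MD = is_gmodD[OF M] and ND = is_gmodD[OF N]
  show ?thesis
    by (rule homI)
      (auto intro!: lin_onI
        simp: V.subspace_add[OF ND(1)] V.subspace_scale[OF ND(1)] fD gD MD ND lin_on_add[OF fD(2)] lin_on_add[OF gD(2)] lin_on_scale[OF fD(2)]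
          lin_on_scale[OF gD(2)] lin_on_add[OF ND(3)] lin_on_add[OF ND(5)]
          lin_on_scale[OF ND(3)] lin_on_scale[OF ND(5)] V.scale_right_distrib V.scale_left_commute)
qed

lemma hom_inverse:
  assumes f: "hom M N f" and bij: "\<And>n. bij_betw (f n) (pc M n) (pc N n)" and M: "is_gmod M"
  obtains g where "hom N M g" "\<And>n v. v \<in> pc M n \<Longrightarrow> g n (f n v) = v"
    "\<And>n v. v \<in> pc N n \<Longrightarrow> f n (g n v) = v"
proof -
  note MD = is_gmodD[OF M] and fD = homD[OF f]
  define g where "g = (\<lambda>n. inv_into (pc M n) (f n))"
  have gf: "g n (f n v) = v" if "v \<in> pc M n" for n v
    using bij[of n] that by (simp add: g_def bij_betw_def)
  have fg: "f n (g n v) = v" "g n v \<in> pc M n" if "v \<in> pc N n" for n v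
    using bij[of n] that by (auto simp: g_def bij_betw_def f_inv_into_f inv_into_into)
  have "hom N M g"
  proof (rule homI)
    fix n
    show "lin_on (pc N n) (g n)"
    proof (rule lin_onI)
      fix u v assume uv: "u \<in> pc N n" "v \<in> pc N n"
      have "g n u + g n v \<in> pc M n" using uv fg by (auto intro: V.subspace_add MD)
      from gf[OF this] show "g n (u + v) = g n u + g n v"
        using uv fg by (simp add: lin_on_add[OF fD(2)])
    next
      fix c u assume u: "u \<in> pc N n"
      have "vsc c (g n u) \<in> pc M n" using u fg by (auto intro: V.subspace_scale MD)
      from gf[OF this] show "g n (vsc c u) = vsc c (g n u)"
        using u fg by (simp add: lin_on_scale[OF fD(2)])
    qed
  next
    fix n v assume v: "v \<in> pc N n"
    show "g n v \<in> pc M n" using fg v by simp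
    show "g (n + 1) (xa N n v) = xa M n (g n v)"
      using gf[of "xa M n (g n v)" "n + 1"] fg[OF v] MD(2) fD(3) by simp
    show "g (n - 1) (ya N n v) = ya M n (g n v)"
      using gf[of "ya M n (g n v)" "n - 1"] fg[OF v] MD(4) fD(4) by simp
  qed
  then show thesis using that gf fg by blast
qed

lemma gm_iso_bij:
  assumes "hom M N f" "\<And>n. bij_betw (f n) (pc M n) (pc N n)" "is_gmod M"
  shows "gm_iso M N"
proof -
  obtain g where "hom N M g" "\<And>n v. v \<in> pc M n \<Longrightarrow> g n (f n v) = v"
    "\<And>n v. v \<in> pc N n \<Longrightarrow> f n (g n v) = v"
    using hom_inverse[OF assms] by blast
  then show ?thesis
    unfolding gm_iso_def using assms(1) by blast
qed

lemma gm_iso_refl: "gm_iso M M"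
  unfolding gm_iso_def using hom_id by fastforce

lemma gm_iso_sym: "gm_iso M N \<Longrightarrow> gm_iso N M"
  unfolding gm_iso_def by blast

lemma gm_iso_trans:
  assumes "gm_iso L M" "gm_iso M N" shows "gm_iso L N"
proof -
  obtain f g where f: "hom L M f" "hom M L g" "\<forall>n. \<forall>v\<in>pc L n. g n (f n v) = v"
    "\<forall>n. \<forall>v\<in>pc M n. f n (g n v) = v" using assms(1) by (auto simp: gm_iso_def)
  obtain h k where h: "hom M N h" "hom N M k" "\<forall>n. \<forall>v\<in>pc M n. k n (h n v) = v"
    "\<forall>n. \<forall>v\<in>pc N n. h n (k n v) = v" using assms(2) by (auto simp: gm_iso_def)
  show ?thesis
    unfolding gm_iso_def
  proof (intro exI conjI)
    show "hom L N (\<lambda>n v. h n (f n v))" by (rule hom_comp[OF f(1) h(1)])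
    show "hom N L (\<lambda>n v. g n (k n v))" by (rule hom_comp[OF h(2) f(2)])
  qed (use f h homD(1)[OF f(1)] homD(1)[OF h(2)] in auto)
qed

text \<open>Direct summands up to isomorphism. In this form the relation composes and absorbs
  isomorphisms, and no complement has to be chosen until \<open>retract_complement\<close> supplies
  one.\<close>

definition retract :: "gmod \<Rightarrow> gmod \<Rightarrow> bool" where
  "retract Z M \<longleftrightarrow> (\<exists>i p. hom Z M i \<and> hom M Z p \<and> (\<forall>n. \<forall>v\<in>pc Z n. p n (i n v) = v))"

lemma gm_iso_retract: "gm_iso M N \<Longrightarrow> retract M N"
  unfolding gm_iso_def retract_def by blast

lemma retract_trans:
  assumes "retract L M" "retract M N" shows "retract L N"
proof -
  obtain i p where i: "hom L M i" "hom M L p" "\<forall>n. \<forall>v\<in>pc L n. p n (i n v) = v"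
    using assms(1) by (auto simp: retract_def)
  obtain j q where j: "hom M N j" "hom N M q" "\<forall>n. \<forall>v\<in>pc M n. q n (j n v) = v"
    using assms(2) by (auto simp: retract_def)
  show ?thesis
    unfolding retract_def
  proof (intro exI conjI)
    show "hom L N (\<lambda>n v. j n (i n v))" by (rule hom_comp[OF i(1) j(1)])
    show "hom N L (\<lambda>n v. p n (q n v))" by (rule hom_comp[OF j(2) i(2)])
  qed (use i j homD(1)[OF i(1)] in auto)
qed

lemma is_biprod_retract:
  assumes "is_biprod E M N" shows "retract M E" "retract N E"
  using assms unfolding is_biprod_def retract_def by blast+

lemma is_zeroD: "is_zero M \<Longrightarrow> pc M n = {0}"
  by (simp add: is_zero_def vzero_eq)

lemma zero_gm_iso:
  assumes "is_zero M" "is_zero N" "is_gmod M" "is_gmod N"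
  shows "gm_iso M N"
proof (rule gm_iso_bij)
  note z = is_zeroD[OF assms(1)] is_zeroD[OF assms(2)]
  note MD = is_gmodD[OF assms(3)] and ND = is_gmodD[OF assms(4)]
  show "hom M N (\<lambda>n v. v)"
    using lin_on_0[OF MD(3) MD(1)] lin_on_0[OF MD(5) MD(1)] lin_on_0[OF ND(3) ND(1)]
      lin_on_0[OF ND(5) ND(1)]
    by (intro homI) (auto simp: z intro: lin_onI)
qed (use assms in \<open>auto simp: is_zeroD bij_betw_def\<close>)

section \<open>Graded submodules, images and kernels\<close>

lemma gsubD:
  assumes "gsub M U"
  shows "U n \<subseteq> pc M n" "V.subspace (U n)" "v \<in> U n \<Longrightarrow> xa M n v \<in> U (n + 1)"
    "v \<in> U n \<Longrightarrow> ya M n v \<in> U (n - 1)"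
  using assms by (auto simp: gsub_def subspace_eq)

lemma gsubI:
  assumes "\<And>n. U n \<subseteq> pc M n" "\<And>n. V.subspace (U n)"
    "\<And>n v. v \<in> U n \<Longrightarrow> xa M n v \<in> U (n + 1)" "\<And>n v. v \<in> U n \<Longrightarrow> ya M n v \<in> U (n - 1)"
  shows "gsub M U"
  using assms by (auto simp: gsub_def subspace_eq)

lemma submod_sel [simp]: "pc (submod M U) = U" "xa (submod M U) = xa M" "ya (submod M U) = ya M"
  by (auto simp: submod_def)

lemma is_gmod_submod:
  assumes "is_gmod M" "gsub M U" shows "is_gmod (submod M U)"
proof (rule is_gmodI)
  note UD = gsubD[OF assms(2)] and MD = is_gmodD[OF assms(1)]
  show "lin_on (pc (submod M U) n) (xa (submod M U) n)"
    "lin_on (pc (submod M U) n) (ya (submod M U) n)" for n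
    using lin_on_mono[OF MD(3) UD(1)] lin_on_mono[OF MD(5) UD(1)] by auto
qed (use gsubD[OF assms(2)] is_gmodD(6,7)[OF assms(1) subsetD[OF gsubD(1)[OF assms(2)]]] in auto)

lemma gsub_full: "is_gmod M \<Longrightarrow> gsub M (pc M)"
  by (intro gsubI) (auto simp: is_gmodD)

lemma gsub_image:
  assumes f: "hom M N f" and M: "is_gmod M"
  shows "gsub N (\<lambda>n. f n ` pc M n)"
proof (rule gsubI)
  note fD = homD[OF f] and MD = is_gmodD[OF M]
  fix n
  show "f n ` pc M n \<subseteq> pc N n" using fD by auto
  show "V.subspace (f n ` pc M n)" by (intro subspace_image fD MD)
  fix v assume "v \<in> f n ` pc M n"
  then obtain u where u: "u \<in> pc M n" "v = f n u" by blast
  show "xa N n v \<in> f (n + 1) ` pc M (n + 1)" "ya N n v \<in> f (n - 1) ` pc M (n - 1)"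
    using u fD(3,4)[OF u(1), symmetric] MD(2,4)[OF u(1)] by auto
qed

lemma gsub_kernel:
  assumes f: "hom M N f" and M: "is_gmod M" and N: "is_gmod N"
  shows "gsub M (\<lambda>n. {v \<in> pc M n. f n v = 0})"
proof (rule gsubI)
  note fD = homD[OF f] and MD = is_gmodD[OF M] and ND = is_gmodD[OF N]
  fix n
  show "V.subspace {v \<in> pc M n. f n v = 0}"
    using MD(1)[of n] lin_on_0[OF fD(2) MD(1)]
    by (auto simp: V.subspace_def lin_on_add[OF fD(2)] lin_on_scale[OF fD(2)])
  fix v assume "v \<in> {v \<in> pc M n. f n v = 0}"
  then show "xa M n v \<in> {v \<in> pc M (n + 1). f (n + 1) v = 0}"
    "ya M n v \<in> {v \<in> pc M (n - 1). f (n - 1) v = 0}"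
    using fD(3,4)[of v n] MD(2,4)[of v n] lin_on_0[OF ND(3) ND(1)] lin_on_0[OF ND(5) ND(1)] by auto
qed auto

text \<open>\<open>M\<close> is the direct sum of the image of the section and the kernel of the
  retraction. The image is nonzero because \<open>Z\<close> is, so indecomposability kills the
  kernel and the section is onto.\<close>

lemma retract_indec_iso:
  assumes "retract Z M" "\<not> is_zero Z" "indec M" "is_gmod Z" "is_gmod M"
  shows "gm_iso Z M"
proof -
  obtain i p where i: "hom Z M i" and p: "hom M Z p" and pi: "\<And>n v. v \<in> pc Z n \<Longrightarrow> p n (i n v) = v"
    using assms(1) by (auto simp: retract_def)
  note ZD = is_gmodD[OF assms(4)] and MD = is_gmodD[OF assms(5)] and iD = homD[OF i] and pD = homD[OF p]
  define U where "U = (\<lambda>n. i n ` pc Z n)"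
  define W where "W = (\<lambda>n. {v \<in> pc M n. p n v = 0})"
  have U: "gsub M U" and W: "gsub M W"
    using gsub_image[OF i assms(4)] gsub_kernel[OF p assms(5,4)] by (simp_all add: U_def W_def)
  have i0: "i n 0 = 0" for n using lin_on_0[OF iD(2) ZD(1)] .
  have p0: "p n 0 = 0" for n using lin_on_0[OF pD(2) MD(1)] .
  obtain n where n: "pc Z n \<noteq> {0}" using assms(2) by (auto simp: is_zero_def vzero_eq)
  then obtain z where z: "z \<in> pc Z n" "z \<noteq> 0" using V.subspace_0[OF ZD(1)[of n]] by auto
  then have "i n z \<noteq> 0" using pi[OF z(1)] p0 by metis
  then have Un: "\<exists>n. U n \<noteq> {vzero}" using z by (auto simp: U_def vzero_eq)
  have UW: "U n \<inter> W n = {vzero}" for n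
    using V.subspace_0[OF ZD(1)[of n]] V.subspace_0[OF MD(1)[of n]] i0[of n] p0[of n] pi
    by (force simp: U_def W_def vzero_eq)
  have sum: "{vadd u w |u w. u \<in> U n \<and> w \<in> W n} = pc M n" (is "?L = _") for n
  proof
    show "?L \<subseteq> pc M n"
      using gsubD(1)[OF U, of n] gsubD(1)[OF W, of n] V.subspace_add[OF MD(1)[of n]]
      by (auto simp: vadd_eq)
    show "pc M n \<subseteq> ?L"
    proof
      fix v assume v: "v \<in> pc M n"
      have "v - i n (p n v) \<in> W n"
        using v by (auto simp: W_def lin_on_diff[OF pD(2) MD(1)] iD pD pi intro!: V.subspace_diff MD)
      moreover have "i n (p n v) \<in> U n" using v pD by (auto simp: U_def)
      ultimately show "v \<in> ?L" by (force simp: vadd_eq)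
    qed
  qed
  have "\<forall>n. W n = {vzero}"
    using assms(3) U W Un UW sum unfolding indec_def by blast
  then have W0: "W n = {0}" for n by (simp add: vzero_eq)
  have "bij_betw (i n) (pc Z n) (pc M n)" for n
  proof -
    have "inj_on (i n) (pc Z n)" using pi by (metis inj_onI)
    moreover have "v \<in> i n ` pc Z n" if v: "v \<in> pc M n" for v
    proof -
      have "v - i n (p n v) \<in> W n"
        using v by (auto simp: W_def lin_on_diff[OF pD(2) MD(1)] iD pD pi intro!: V.subspace_diff MD)
      then have "v = i n (p n v)" by (simp add: W0)
      then show ?thesis using v pD by blast
    qed
    ultimately show ?thesis using iD by (auto simp: bij_betw_def)
  qed
  then show ?thesis using i assms(4) by (intro gm_iso_bij)
qed

section \<open>Finite generation\<close>

text \<open>Multiplication by \<open>y^k\<close> on degree \<open>n\<close>. The starting degree is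
  an argument because each \<open>ya M n\<close> is a separate map, specified only on its own
  piece.\<close>

primrec dn :: "gmod \<Rightarrow> int \<Rightarrow> nat \<Rightarrow> vec \<Rightarrow> vec" where
  "dn M n 0 v = v"
| "dn M n (Suc k) v = ya M (n - int k) (dn M n k v)"

lemma dn_in:
  assumes "is_gmod M" "v \<in> pc M n" shows "dn M n k v \<in> pc M (n - int k)"
proof (induction k)
  case (Suc k)
  then show ?case
    using is_gmodD(4)[OF assms(1) Suc] by (simp add: algebra_simps)
qed (use assms in simp)

lemma dn_lin:
  assumes "is_gmod M" shows "lin_on (pc M n) (dn M n k)"
proof (induction k)
  case 0
  show ?case by (auto intro: lin_onI)
next
  case (Suc k)
  show ?case
    using lin_on_comp[OF Suc _ is_gmodD(5)[OF assms, of "n - int k"]] dn_in[OF assms] by auto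
qed

lemma dn_xa:
  assumes "is_gmod M" "v \<in> pc M n"
  shows "xa M (n - int k) (dn M n k v) = dn M (n + 1) k (xa M n v)"
proof (induction k)
  case (Suc k)
  have e: "n - int (Suc k) = n - int k - 1" "n + 1 - int k = n - int k + 1" by simp_all
  show ?case
    unfolding dn.simps e using is_gmodD(6)[OF assms(1) dn_in[OF assms, of k]] Suc by simp
qed simp

lemma dn_add: "dn M (n - int j) k (dn M n j v) = dn M n (j + k) v"
  by (induction k) (simp_all add: algebra_simps)

lemma dn_ya: "dn M (n - 1) k (ya M n v) = dn M n (Suc k) v"
  using dn_add[of M n 1 k v] by simp

lemma dn_inj:
  assumes "is_gmod M" "mcm M" shows "inj_on (dn M n k) (pc M n)"
proof (induction k)
  case (Suc k)
  have "inj_on (ya M (n - int k)) (dn M n k ` pc M n)"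
    using assms(2) dn_in[OF assms(1)] by (auto simp: mcm_def intro: inj_on_subset)
  from comp_inj_on[OF Suc this] show ?case by (simp add: o_def)
qed simp

text \<open>The uniform bound on the dimensions is the rank of the module over \<open>\<complex>[y]\<close>.\<close>

definition tame :: "gmod \<Rightarrow> bool" where
  "tame M \<longleftrightarrow> (\<exists>K. \<forall>n. spanned (pc M n) K) \<and> (\<exists>n1. \<forall>n\<ge>n1. pc M n \<subseteq> {0}) \<and>
     (\<exists>n0. \<forall>n\<le>n0. pc M (n - 1) \<subseteq> ya M n ` pc M n)"

text \<open>Since \<open>x\<close> squares to zero and commutes with \<open>y\<close>, the elements
  \<open>y^k g\<close> and \<open>y^k x g\<close> with \<open>g\<close> a generator already span a
  graded submodule. At most two of them per generator fall in a given degree, which gives the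
  uniform bound; the extreme generator degrees give the other two conditions.\<close>

lemma fin_gen_tame:
  assumes M: "is_gmod M" and "fin_gen M" shows "tame M"
proof -
  note MD = is_gmodD[OF M]
  obtain G where G: "finite G" "\<And>d g. (d, g) \<in> G \<Longrightarrow> g \<in> pc M d" "gen M G = pc M"
    using assms(2) by (auto simp: fin_gen_def)
  define X1 where "X1 = (\<lambda>n. (\<lambda>(d, g). dn M d (nat (d - n)) g) ` {(d, g) \<in> G. n \<le> d})"
  define X2 where
    "X2 = (\<lambda>n. (\<lambda>(d, g). dn M (d + 1) (nat (d + 1 - n)) (xa M d g)) ` {(d, g) \<in> G. n \<le> d + 1})"
  define X where "X = (\<lambda>n. X1 n \<union> X2 n)"
  have X1I: "dn M d k g \<in> X n" if "(d, g) \<in> G" "n = d - int k" for d g k n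
    unfolding X_def X1_def using that by (intro UnI1 image_eqI[of _ _ "(d, g)"]) auto
  have X2I: "dn M (d + 1) k (xa M d g) \<in> X n" if "(d, g) \<in> G" "n = d + 1 - int k" for d g k n
    unfolding X_def X2_def using that by (intro UnI2 image_eqI[of _ _ "(d, g)"]) auto
  have XE: "\<exists>d g k. (d, g) \<in> G \<and>
      (w = dn M d k g \<and> n = d - int k \<or> w = dn M (d + 1) k (xa M d g) \<and> n = d + 1 - int k)"
    if "w \<in> X n" for w n
  proof -
    from that consider d g where "(d, g) \<in> G" "n \<le> d" "w = dn M d (nat (d - n)) g"
      | d g where "(d, g) \<in> G" "n \<le> d + 1" "w = dn M (d + 1) (nat (d + 1 - n)) (xa M d g)"
      unfolding X_def X1_def X2_def by auto
    then show ?thesis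
    proof cases
      case 1
      then show ?thesis by (intro exI[of _ d] exI[of _ g] exI[of _ "nat (d - n)"]) simp
    next
      case 2
      then show ?thesis by (intro exI[of _ d] exI[of _ g] exI[of _ "nat (d + 1 - n)"]) simp
    qed
  qed
  have Xpc: "X n \<subseteq> pc M n" for n
  proof
    fix w assume "w \<in> X n"
    from XE[OF this] obtain d g k where dg: "(d, g) \<in> G"
      "w = dn M d k g \<and> n = d - int k \<or> w = dn M (d + 1) k (xa M d g) \<and> n = d + 1 - int k"
      by blast
    then show "w \<in> pc M n"
      using dn_in[OF M G(2)[OF dg(1)], of k] dn_in[OF M MD(2)[OF G(2)[OF dg(1)]], of k] by auto
  qed
  have finX: "finite (X n) \<and> card (X n) \<le> 2 * card G" for n
  proof -
    have "finite {(d, g) \<in> G. n \<le> d}" "finite {(d, g) \<in> G. n \<le> d + 1}"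
      using G(1) by (auto intro: finite_subset)
    moreover have "card {(d, g) \<in> G. n \<le> d} \<le> card G" "card {(d, g) \<in> G. n \<le> d + 1} \<le> card G"
      using G(1) by (auto intro: card_mono)
    ultimately have "finite (X1 n)" "finite (X2 n)" "card (X1 n) \<le> card G" "card (X2 n) \<le> card G"
      unfolding X1_def X2_def by (auto intro: order_trans[OF card_image_le])
    then show ?thesis
      unfolding X_def using card_Un_le[of "X1 n" "X2 n"] by simp
  qed
  have spX: "V.span (X n) \<subseteq> pc M n" for n
    using Xpc MD(1) by (rule V.span_minimal)
  have xX: "xa M n w \<in> V.span (X (n + 1))" if "w \<in> X n" for n w
  proof -
    from XE[OF that] obtain d g k where dg: "(d, g) \<in> G"
      "w = dn M d k g \<and> n = d - int k \<or> w = dn M (d + 1) k (xa M d g) \<and> n = d + 1 - int k"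
      by blast
    from dg(2) show ?thesis
    proof (elim disjE conjE)
      assume w: "w = dn M d k g" and n: "n = d - int k"
      have "xa M n w = dn M (d + 1) k (xa M d g)"
        using dn_xa[OF M G(2)[OF dg(1)]] w n by simp
      then show ?thesis using X2I[OF dg(1), of "n + 1" k] n by (auto intro: V.span_base)
    next
      assume w: "w = dn M (d + 1) k (xa M d g)" and n: "n = d + 1 - int k"
      have "xa M n w = dn M (d + 1 + 1) k (xa M (d + 1) (xa M d g))"
        using dn_xa[OF M MD(2)[OF G(2)[OF dg(1)]]] w n by simp
      also have "\<dots> = 0"
        using MD(7)[OF G(2)[OF dg(1)]] lin_on_0[OF dn_lin[OF M] MD(1)] by simp
      finally show ?thesis by (simp add: V.span_zero)
    qed
  qed
  have yX: "ya M n w \<in> X (n - 1)" if "w \<in> X n" for n w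
  proof -
    from XE[OF that] obtain d g k where dg: "(d, g) \<in> G"
      "w = dn M d k g \<and> n = d - int k \<or> w = dn M (d + 1) k (xa M d g) \<and> n = d + 1 - int k"
      by blast
    from dg(2) show ?thesis
      using X1I[OF dg(1), of "n - 1" "Suc k"] X2I[OF dg(1), of "n - 1" "Suc k"]
      by (elim disjE conjE) simp_all
  qed
  have "gsub M (\<lambda>n. V.span (X n))"
  proof (rule gsubI)
    fix n v assume v: "v \<in> V.span (X n)"
    have "xa M n ` X n \<subseteq> V.span (X (n + 1))" "ya M n ` X n \<subseteq> V.span (X (n - 1))"
      using xX yX V.span_base by (simp_all add: image_subset_iff)
    from span_image_subset[OF MD(3) MD(1) Xpc this(1) V.subspace_span]
      span_image_subset[OF MD(5) MD(1) Xpc this(2) V.subspace_span]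
    show "xa M n v \<in> V.span (X (n + 1))" "ya M n v \<in> V.span (X (n - 1))"
      using v by (simp_all add: image_subset_iff)
  qed (use spX in auto)
  moreover have "g \<in> V.span (X d)" if "(d, g) \<in> G" for d g
    using X1I[OF that, of d 0] by (auto intro: V.span_base)
  ultimately have "gen M G n \<subseteq> V.span (X n)" for n
    unfolding gen_def by blast
  then have pcX: "pc M n \<subseteq> V.span (X n)" for n using G(3) by simp
  define a b where "a = Min (fst ` G)" and "b = Max (fst ` G)"
  have ab: "a \<le> d" "d \<le> b" if "(d, g) \<in> G" for d g
    using G(1) that by (auto simp: a_def b_def intro!: Min_le Max_ge image_eqI[of _ _ "(d, g)"])
  have "spanned (pc M n) (2 * card G)" for n
    unfolding spanned_def using finX[of n] Xpc[of n] pcX[of n] by blast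
  \<comment> \<open>The generators end in degree \<open>b\<close> and their multiples by
    \<open>x\<close> in degree \<open>b + 1\<close>; multiplication by \<open>y\<close> only goes
    down.\<close>
  moreover have "pc M n \<subseteq> {0}" if "n \<ge> b + 2" for n
  proof -
    have "w \<notin> X n" for w
      using XE[of w n] ab(2) that by fastforce
    then have "X n = {}" by blast
    then show ?thesis using pcX[of n] by simp
  qed
  moreover have "pc M (n - 1) \<subseteq> ya M n ` pc M n" if n: "n \<le> a" for n
  proof -
    have "w \<in> ya M n ` pc M n" if "w \<in> X (n - 1)" for w
    proof -
      from XE[OF that] obtain d g k where dg: "(d, g) \<in> G" "w = dn M d k g \<and> n - 1 = d - int k \<or>
        w = dn M (d + 1) k (xa M d g) \<and> n - 1 = d + 1 - int k"
        by blast
      \<comment> \<open>The element has degree \<open>n - 1\<close>, below every generator, so at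
        least one factor \<open>y\<close> can be stripped off.\<close>
      have "0 < k" using dg(2) ab(1)[OF dg(1)] n by auto
      then obtain j where j: "k = Suc j" using gr0_implies_Suc by blast
      from dg(2) show ?thesis
      proof (elim disjE conjE)
        assume *: "w = dn M d k g" "n - 1 = d - int k"
        then have "w = ya M n (dn M d j g)" "n = d - int j" using j by auto
        then show ?thesis using dn_in[OF M G(2)[OF dg(1)], of j] by auto
      next
        assume *: "w = dn M (d + 1) k (xa M d g)" "n - 1 = d + 1 - int k"
        then have n': "n = d + 1 - int j" using j by simp
        have "w = ya M n (dn M (d + 1) j (xa M d g))" unfolding n' using * j by simp
        then show ?thesis using dn_in[OF M MD(2)[OF G(2)[OF dg(1)]], of j] n' by auto
      qed
    qed
    then have "V.span (X (n - 1)) \<subseteq> ya M n ` pc M n"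
      by (intro V.span_minimal subspace_image MD) auto
    then show ?thesis using pcX[of "n - 1"] by simp
  qed
  ultimately show ?thesis unfolding tame_def by blast
qed

text \<open>Spanning sets of the pieces in the finite window from \<open>n0\<close> to
  \<open>n1\<close> generate: above it there is nothing, and below it each piece is the image under
  \<open>y\<close> of the piece one degree higher.\<close>

lemma tame_fin_gen:
  assumes M: "is_gmod M" and "tame M" shows "fin_gen M"
proof -
  note MD = is_gmodD[OF M]
  obtain K n1 n0 where K: "\<And>n. spanned (pc M n) K" and n1: "\<And>n. n \<ge> n1 \<Longrightarrow> pc M n \<subseteq> {0}"
    and n0: "\<And>n. n \<le> n0 \<Longrightarrow> pc M (n - 1) \<subseteq> ya M n ` pc M n"
    using assms(2) unfolding tame_def by blast
  have "\<forall>n. \<exists>B. finite B \<and> B \<subseteq> pc M n \<and> pc M n \<subseteq> V.span B"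
    using K unfolding spanned_def by meson
  then obtain B where B: "\<And>n. finite (B n)" "\<And>n. B n \<subseteq> pc M n" "\<And>n. pc M n \<subseteq> V.span (B n)"
    by metis
  define G where "G = Sigma {n0..n1} B"
  have G: "finite G" "\<forall>(d, g)\<in>G. g \<in> pc M d"
    using B by (auto simp: G_def)
  have sub: "pc M n \<subseteq> U n" if U: "gsub M U" and GU: "\<forall>(d, g)\<in>G. g \<in> U d" for U n
  proof -
    have mid: "pc M m \<subseteq> U m" if "m \<ge> n0" for m
    proof (cases "m \<le> n1")
      case True
      then have "B m \<subseteq> U m" using that GU by (auto simp: G_def)
      then show ?thesis
        using V.span_minimal[OF _ gsubD(2)[OF U]] B(3)[of m] by blast
    next
      case False
      then show ?thesis using n1[of m] V.subspace_0[OF gsubD(2)[OF U, of m]] by auto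
    qed
    show ?thesis
    proof (cases "n \<ge> n0")
      case False
      then have "n \<le> n0" by simp
      then show ?thesis
      proof (induction rule: int_le_induct)
        case base
        show ?case using mid by simp
      next
        case (step i)
        show ?case
        proof
          fix v assume "v \<in> pc M (i - 1)"
          then obtain w where "w \<in> pc M i" "v = ya M i w" using n0[OF step(1)] by blast
          then show "v \<in> U (i - 1)" using step(2) gsubD(4)[OF U] by blast
        qed
      qed
    qed (use mid in blast)
  qed
  have "gen M G n = pc M n" for n
  proof
    show "pc M n \<subseteq> gen M G n" unfolding gen_def using sub by blast
    show "gen M G n \<subseteq> pc M n" unfolding gen_def using gsub_full[OF M] G(2) by blast
  qed
  then show ?thesis unfolding fin_gen_def using G by blast
qed

text \<open>Each of the three conditions survives a surjection. Complements of retracts and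
  isomorphic copies both arise as images, and this is how they are seen to be finitely
  generated.\<close>

lemma tame_image:
  assumes f: "hom M N f" and M: "is_gmod M" and surj: "\<And>n. f n ` pc M n = pc N n" and "tame M"
  shows "tame N"
proof -
  note MD = is_gmodD[OF M] and fD = homD[OF f]
  obtain K n1 n0 where K: "\<And>n. spanned (pc M n) K" and n1: "\<And>n. n \<ge> n1 \<Longrightarrow> pc M n \<subseteq> {0}"
    and n0: "\<And>n. n \<le> n0 \<Longrightarrow> pc M (n - 1) \<subseteq> ya M n ` pc M n"
    using assms(4) unfolding tame_def by blast
  have "spanned (pc N n) K" for n
    using spanned_image[OF K fD(2) MD(1)] surj by metis
  moreover have "pc N n \<subseteq> {0}" if "n \<ge> n1" for n
    unfolding surj[symmetric] using n1[OF that] lin_on_0[OF fD(2) MD(1), of n] by auto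
  moreover have "pc N (n - 1) \<subseteq> ya N n ` pc N n" if n: "n \<le> n0" for n
  proof
    fix v assume "v \<in> pc N (n - 1)"
    then obtain u where u: "u \<in> pc M (n - 1)" "v = f (n - 1) u" using surj by blast
    then obtain w where "w \<in> pc M n" "u = ya M n w" using n0[OF n] by blast
    then show "v \<in> ya N n ` pc N n" using u fD by auto
  qed
  ultimately show ?thesis unfolding tame_def by blast
qed

lemma C2D: assumes "C2 M" shows "is_gmod M" "mcm M" "tame M"
  using assms fin_gen_tame by (auto simp: C2_def)

lemma C2I: "is_gmod M \<Longrightarrow> mcm M \<Longrightarrow> tame M \<Longrightarrow> C2 M"
  using tame_fin_gen by (auto simp: C2_def)


text \<open>All module laws for \<open>N\<close> are checked on preimages. This suits targets that
  are given by formulas, such as the standard form built below and the arc modules.\<close>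

lemma gmod_image:
  assumes f: "hom M N f" and M: "is_gmod M" and surj: "\<And>n. f n ` pc M n = pc N n"
  shows "is_gmod N"
proof (rule is_gmodI)
  note MD = is_gmodD[OF M] and fD = homD[OF f]
  fix n
  show "V.subspace (pc N n)"
    using subspace_image[OF fD(2) MD(1)] surj by metis
  have pre: "\<exists>u. u \<in> pc M n \<and> v = f n u" if "v \<in> pc N n" for v
    using that surj[of n] by blast
  show "lin_on (pc N n) (xa N n)"
  proof (rule lin_onI)
    fix u v assume "u \<in> pc N n" "v \<in> pc N n"
    then obtain u' v' where "u' \<in> pc M n" "u = f n u'" "v' \<in> pc M n" "v = f n v'"
      using pre by blast
    then show "xa N n (u + v) = xa N n u + xa N n v"
      by (simp add: fD(3)[symmetric] MD V.subspace_add[OF MD(1)] lin_on_add[OF fD(2), symmetric]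
        lin_on_add[OF MD(3), symmetric])
  next
    fix c u assume "u \<in> pc N n"
    then obtain u' where "u' \<in> pc M n" "u = f n u'" using pre by blast
    then show "xa N n (vsc c u) = vsc c (xa N n u)"
      by (simp add: fD(3)[symmetric] MD V.subspace_scale[OF MD(1)] lin_on_scale[OF fD(2), symmetric]
        lin_on_scale[OF MD(3), symmetric])
  qed
  show "lin_on (pc N n) (ya N n)"
  proof (rule lin_onI)
    fix u v assume "u \<in> pc N n" "v \<in> pc N n"
    then obtain u' v' where "u' \<in> pc M n" "u = f n u'" "v' \<in> pc M n" "v = f n v'"
      using pre by blast
    then show "ya N n (u + v) = ya N n u + ya N n v"
      by (simp add: fD(4)[symmetric] MD V.subspace_add[OF MD(1)] lin_on_add[OF fD(2), symmetric]
        lin_on_add[OF MD(5), symmetric])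
  next
    fix c u assume "u \<in> pc N n"
    then obtain u' where "u' \<in> pc M n" "u = f n u'" using pre by blast
    then show "ya N n (vsc c u) = vsc c (ya N n u)"
      by (simp add: fD(4)[symmetric] MD V.subspace_scale[OF MD(1)] lin_on_scale[OF fD(2), symmetric]
        lin_on_scale[OF MD(5), symmetric])
  qed
  fix v assume "v \<in> pc N n"
  then obtain u where u: "u \<in> pc M n" "v = f n u" using pre by blast
  then have x: "xa N n v = f (n + 1) (xa M n u)" and y: "ya N n v = f (n - 1) (ya M n u)"
    using fD by simp_all
  show "xa N n v \<in> pc N (n + 1)" "ya N n v \<in> pc N (n - 1)"
    unfolding x y using u MD(2,4) fD(1) by blast+
  have "xa N (n - 1) (ya N n v) = f n (xa M (n - 1) (ya M n u))"
    using fD(3)[OF MD(4)[OF u(1)]] y by simp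
  also have "\<dots> = ya N (n + 1) (xa N n v)"
    using fD(4)[OF MD(2)[OF u(1)]] MD(6)[OF u(1)] x by simp
  finally show "xa N (n - 1) (ya N n v) = ya N (n + 1) (xa N n v)" .
  show "xa N (n + 1) (xa N n v) = 0"
    using fD(3)[OF MD(2)[OF u(1)]] MD(7)[OF u(1)] x lin_on_0[OF fD(2) MD(1)] by simp
qed

section \<open>Filtered vector spaces with a square-zero operator\<close>

text \<open>With \<open>y\<close> the inclusion, lowering the degree does not change a vector, so
  vectors of different degrees can be compared and added in a common smaller degree.\<close>

definition stdmod :: "(int \<Rightarrow> vec set) \<Rightarrow> (vec \<Rightarrow> vec) \<Rightarrow> gmod" where
  "stdmod F T = \<lparr>pc = F, xa = (\<lambda>n. T), ya = (\<lambda>n v. v)\<rparr>"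

lemma stdmod_sel [simp]:
  "pc (stdmod F T) = F" "xa (stdmod F T) = (\<lambda>n. T)" "ya (stdmod F T) = (\<lambda>n v. v)"
  by (simp_all add: stdmod_def)

lemma stdD:
  assumes "is_gmod (stdmod F T)"
  shows "V.subspace (F n)" "v \<in> F n \<Longrightarrow> T v \<in> F (n + 1)" "lin_on (F n) T"
    "v \<in> F n \<Longrightarrow> v \<in> F (n - 1)" "v \<in> F n \<Longrightarrow> T (T v) = 0"
  using is_gmodD[OF assms] by simp_all

lemma std_mono:
  assumes "is_gmod (stdmod F T)" "m \<le> n" "v \<in> F n" shows "v \<in> F m"
  using assms(2)
proof (induction rule: int_le_induct)
  case base
  show ?case by (fact assms(3))
next
  case (step i)
  then show ?case using stdD(4)[OF assms(1)] by simp
qed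

lemma std_gsub_mono:
  assumes "gsub (stdmod F T) U" "m \<le> n" "v \<in> U n" shows "v \<in> U m"
  using assms(2)
proof (induction rule: int_le_induct)
  case base
  show ?case by (fact assms(3))
next
  case (step i)
  then show ?case using gsubD(4)[OF assms(1), of v i] by simp
qed

lemma mcm_std: "mcm (stdmod F T)"
  by (simp add: mcm_def)

text \<open>A morphism commutes with \<open>y\<close>, which is an inclusion on both sides, so its
  components agree on common vectors; two degrees containing the same vector are compared in their
  minimum.\<close>

lemma hom_const:
  assumes f: "hom (stdmod F T) (stdmod G S) f" and F: "is_gmod (stdmod F T)"
  obtains h where "\<And>n v. v \<in> F n \<Longrightarrow> f n v = h v"
proof -
  have dec: "f m v = f n v" if "v \<in> F n" "m \<le> n" for v m n
    using that(2)
  proof (induction rule: int_le_induct)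
    case (step i)
    then have "v \<in> F i" using std_mono[OF F _ that(1)] by blast
    then show ?case using homD(4)[OF f, of v i] step by simp
  qed simp
  define h where "h v = f (SOME n. v \<in> F n) v" for v
  have "f n v = h v" if "v \<in> F n" for n v
  proof -
    have "v \<in> F (SOME n. v \<in> F n)" using that by (rule someI)
    then show ?thesis
      using dec[OF that, of "min n (SOME n. v \<in> F n)"] dec[of v "SOME n. v \<in> F n" "min n (SOME n. v \<in> F n)"]
      by (simp add: h_def)
  qed
  then show thesis using that by blast
qed

text \<open>From the degree where \<open>y\<close> becomes onto, the filtration is constant
  downwards, so \<open>F n0\<close> is the whole underlying space.\<close>

lemma std_bottom:
  assumes F: "is_gmod (stdmod F T)" and "tame (stdmod F T)"
  obtains n0 where "\<And>n. F n \<subseteq> F n0"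
proof -
  obtain n0 where n0: "\<And>n. n \<le> n0 \<Longrightarrow> F (n - 1) \<subseteq> F n"
    using assms(2) unfolding tame_def by auto
  have "F n \<subseteq> F n0" for n
  proof (cases "n \<le> n0")
    case True
    then show ?thesis
    proof (induction rule: int_le_induct)
      case (step i)
      then show ?case using n0[of i] by blast
    qed simp
  next
    case False
    then show ?thesis using std_mono[OF F, of n0 n] by auto
  qed
  then show thesis using that by blast
qed

text \<open>Since \<open>y\<close> is injective, all pieces embed into the piece of a sufficiently small degree
  \<open>n0\<close>; the isomorphism sends \<open>v\<close> of degree \<open>n\<close> to the \<open>w\<close> of degree \<open>n0\<close> with
  \<open>y\<^sup>j v = y\<^sup>k w\<close> whenever \<open>n - j = n0 - k\<close>.\<close>

lemma std_form:
  assumes "C2 M"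
  obtains F T where "C2 (stdmod F T)" "gm_iso M (stdmod F T)"
proof -
  note M = C2D(1)[OF assms] and mcm = C2D(2)[OF assms] and tame = C2D(3)[OF assms]
  note MD = is_gmodD[OF M]
  obtain n0 where n0: "\<And>n. n \<le> n0 \<Longrightarrow> pc M (n - 1) \<subseteq> ya M n ` pc M n"
    using tame unfolding tame_def by blast
  have surj: "\<exists>w\<in>pc M n0. v = dn M n0 k w" if "v \<in> pc M (n0 - int k)" for v k
    using that
  proof (induction k arbitrary: v)
    case (Suc k)
    have "v \<in> pc M (n0 - int k - 1)" using Suc.prems by (simp add: algebra_simps)
    then obtain u where u: "u \<in> pc M (n0 - int k)" "v = ya M (n0 - int k) u"
      using n0[of "n0 - int k"] by auto
    then show ?case using Suc.IH[OF u(1)] by auto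
  qed auto
  define R where "R n v w \<longleftrightarrow> dn M n (nat (n - n0)) v = dn M n0 (nat (n0 - n)) w" for n v w
  \<comment> \<open>\<open>R\<close> uses the smallest possible exponents. Injectivity of the powers
    of \<open>y\<close> makes every other pair of exponents ending in the same degree equivalent,
    which leaves room to move \<open>x\<close> and \<open>y\<close> past each other.\<close>
  have R_iff: "R n v w \<longleftrightarrow> dn M n j v = dn M n0 k w"
    if v: "v \<in> pc M n" and w: "w \<in> pc M n0" and jk: "n - int j = n0 - int k" for n v w j k
  proof -
    define i where "i = j - nat (n - n0)"
    have i: "j = nat (n - n0) + i" "k = nat (n0 - n) + i" "n - int (nat (n - n0)) = n0 - int (nat (n0 - n))"
      using jk by (auto simp: i_def)
    let ?m = "n0 - int (nat (n0 - n))"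
    have "dn M n (nat (n - n0)) v \<in> pc M ?m" "dn M n0 (nat (n0 - n)) w \<in> pc M ?m"
      using dn_in[OF M v, of "nat (n - n0)"] dn_in[OF M w, of "nat (n0 - n)"] i(3) by simp_all
    moreover have "dn M n j v = dn M ?m i (dn M n (nat (n - n0)) v)"
      "dn M n0 k w = dn M ?m i (dn M n0 (nat (n0 - n)) w)"
      using dn_add[of M n "nat (n - n0)" i v] dn_add[of M n0 "nat (n0 - n)" i w] i by simp_all
    ultimately show ?thesis
      unfolding R_def using inj_on_eq_iff[OF dn_inj[OF M mcm, of ?m i]] by simp
  qed
  have deg: "n - int (nat (n - n0)) = n0 - int (nat (n0 - n))" for n by simp
  define \<phi> where "\<phi> n v = (THE w. w \<in> pc M n0 \<and> R n v w)" for n v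
  have \<phi>_ex: "\<exists>!w. w \<in> pc M n0 \<and> R n v w" if v: "v \<in> pc M n" for n v
  proof -
    have "dn M n (nat (n - n0)) v \<in> pc M (n0 - int (nat (n0 - n)))"
      using dn_in[OF M v, of "nat (n - n0)"] deg by simp
    from surj[OF this] obtain w where "w \<in> pc M n0" "R n v w" unfolding R_def by blast
    moreover have "w = w'" if "w \<in> pc M n0" "R n v w" "w' \<in> pc M n0" "R n v w'" for w w'
      using that inj_on_eq_iff[OF dn_inj[OF M mcm, of n0 "nat (n0 - n)"] that(1,3)]
      unfolding R_def by metis
    ultimately show ?thesis by blast
  qed
  have \<phi>: "\<phi> n v \<in> pc M n0" "R n v (\<phi> n v)" if "v \<in> pc M n" for n v
    using theI'[OF \<phi>_ex[OF that]] by (simp_all add: \<phi>_def)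
  have \<phi>_eq: "\<phi> n v = w" if "v \<in> pc M n" "w \<in> pc M n0" "R n v w" for n v w
    using \<phi>_ex[OF that(1)] \<phi>[OF that(1)] that(2,3) by blast
  note L = dn_lin[OF M]
  define T where "T w = ya M (n0 + 1) (xa M n0 w)" for w
  define F where "F n = \<phi> n ` pc M n" for n
  have \<phi>y: "\<phi> (n - 1) (ya M n v) = \<phi> n v" if v: "v \<in> pc M n" for n v
  proof (rule \<phi>_eq[OF MD(4)[OF v] \<phi>(1)[OF v]])
    let ?j = "nat (n - n0)" and ?k = "nat (n0 - n)"
    \<comment> \<open>One more \<open>y\<close> is applied on both sides, so that on the left it can
      be absorbed into the argument \<open>ya M n v\<close>.\<close>
    have "dn M n (Suc ?j) v = dn M n0 (Suc ?k) (\<phi> n v)"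
      using R_iff[OF v \<phi>(1)[OF v], of "Suc ?j" "Suc ?k"] \<phi>(2)[OF v] deg[of n] by simp
    then have "dn M (n - 1) ?j (ya M n v) = dn M n0 (Suc ?k) (\<phi> n v)"
      by (simp only: dn_ya)
    then show "R (n - 1) (ya M n v) (\<phi> n v)"
      using R_iff[OF MD(4)[OF v] \<phi>(1)[OF v], of ?j "Suc ?k"] deg[of n] by simp
  qed
  have \<phi>x: "\<phi> (n + 1) (xa M n v) = T (\<phi> n v)" if v: "v \<in> pc M n" for n v
  proof (rule \<phi>_eq[OF MD(2)[OF v]])
    let ?j = "nat (n - n0)" and ?k = "nat (n0 - n)"
    let ?w = "\<phi> n v"
    have w: "?w \<in> pc M n0" by (rule \<phi>(1)[OF v])
    show Tw: "T ?w \<in> pc M n0" using MD(2)[OF w] MD(4) unfolding T_def by fastforce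
    have "dn M n ?j v = dn M n0 ?k ?w" using \<phi>(2)[OF v] by (simp add: R_def)
    then have "dn M (n + 1) ?j (xa M n v) = dn M (n0 + 1) ?k (xa M n0 ?w)"
      using dn_xa[OF M v, of ?j] dn_xa[OF M w, of ?k] deg[of n] by simp
    then have "dn M (n + 1) (Suc ?j) (xa M n v) = dn M (n0 + 1) (Suc ?k) (xa M n0 ?w)"
      using deg[of n] by (simp add: algebra_simps)
    \<comment> \<open>On the right one \<open>y\<close> merges with \<open>x\<close> into the
      degree-zero operator \<open>T\<close>; this is why the exponents to be compared are
      \<open>Suc ?j\<close> and \<open>?k\<close>.\<close>
    also have "\<dots> = dn M n0 ?k (T ?w)"
      using dn_ya[of M "n0 + 1" ?k] by (simp add: T_def del: dn.simps)
    finally show "R (n + 1) (xa M n v) (T ?w)"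
      using R_iff[OF MD(2)[OF v] Tw, of "Suc ?j" ?k] deg[of n] by simp
  qed
  have hom: "hom M (stdmod F T) \<phi>"
  proof (rule homI)
    fix n
    show "lin_on (pc M n) (\<phi> n)"
    proof (rule lin_onI)
      fix u v assume uv: "u \<in> pc M n" "v \<in> pc M n"
      have "R n (u + v) (\<phi> n u + \<phi> n v)"
        using \<phi>[OF uv(1)] \<phi>[OF uv(2)] lin_on_add[OF L] uv by (simp add: R_def)
      then show "\<phi> n (u + v) = \<phi> n u + \<phi> n v"
        using uv \<phi>(1) by (intro \<phi>_eq V.subspace_add MD)
    next
      fix c u assume u: "u \<in> pc M n"
      have "R n (vsc c u) (vsc c (\<phi> n u))"
        using \<phi>[OF u] lin_on_scale[OF L] u by (simp add: R_def)
      then show "\<phi> n (vsc c u) = vsc c (\<phi> n u)"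
        using u \<phi>(1) by (intro \<phi>_eq V.subspace_scale MD)
    qed
  qed (use \<phi>x \<phi>y F_def in auto)
  have im: "\<phi> n ` pc M n = pc (stdmod F T) n" for n by (simp add: F_def)
  have "inj_on (\<phi> n) (pc M n)" for n
  proof (rule inj_onI)
    fix u v assume uv: "u \<in> pc M n" "v \<in> pc M n" "\<phi> n u = \<phi> n v"
    then have "dn M n (nat (n - n0)) u = dn M n (nat (n - n0)) v"
      using \<phi>(2)[of u n] \<phi>(2)[of v n] by (simp add: R_def)
    then show "u = v" using inj_on_eq_iff[OF dn_inj[OF M mcm]] uv by blast
  qed
  then have "gm_iso M (stdmod F T)"
    using gm_iso_bij[OF hom _ M] im by (simp add: bij_betw_def)
  moreover have "C2 (stdmod F T)"
    using gmod_image[OF hom M im] mcm_std tame_image[OF hom M im tame] by (rule C2I)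
  ultimately show thesis using that by blast
qed

section \<open>Models of the arc modules\<close>

text \<open>Jordan blocks of size two, one on each pair of coordinates \<open>2 i\<close> and
  \<open>2 i + 1\<close>. A block of size one arises by giving the even coordinate the degree minus
  infinity, so a single operator serves all models.\<close>

definition sh :: "vec \<Rightarrow> vec" where
  "sh v = (\<lambda>i. if odd i then v (i - 1) else 0)"

lemma sh_lin: "sh (u + v) = sh u + sh v" "sh (vsc c u) = vsc c (sh u)"
  by (auto simp: sh_def)

lemma sh_sh: "sh (sh v) = 0"
  by (auto simp: sh_def)

lemma lin_on_id: "lin_on S (\<lambda>v. v)"
  by (auto intro: lin_onI)

lemma lin_on_sh: "lin_on S sh"
  by (auto intro: lin_onI simp: sh_lin)

text \<open>\<open>None\<close> stands for the degree minus infinity.\<close>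

fun present :: "int option \<Rightarrow> int \<Rightarrow> bool" where
  "present None n = False"
| "present (Some a) n = (n \<le> a)"

lemma upto_mono: "present a n \<Longrightarrow> m \<le> n \<Longrightarrow> present a m"
  by (cases a) auto

text \<open>\<open>d i\<close> is the last degree in which coordinate \<open>i\<close> is present.
  Going down in degree, coordinates only appear, so inclusion can serve as \<open>y\<close>.\<close>

definition gr :: "nat \<Rightarrow> (nat \<Rightarrow> int option) \<Rightarrow> int \<Rightarrow> vec set" where
  "gr k d n = {v. (\<forall>i<k. v i \<noteq> 0 \<longrightarrow> present (d i) n) \<and> (\<forall>i\<ge>k. v i = 0)}"

lemma subspace_gr: "V.subspace (gr k d n)"
proof (rule V.subspaceI)
  fix u v assume "u \<in> gr k d n" "v \<in> gr k d n"
  moreover have "u i \<noteq> 0 \<or> v i \<noteq> 0" if "u i + v i \<noteq> 0" for i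
    using that by auto
  ultimately show "u + v \<in> gr k d n"
    unfolding gr_def mem_Collect_eq plus_fun_apply by (metis add.right_neutral)
qed (auto simp: gr_def)

lemma support_span:
  fixes v :: vec
  assumes "\<And>i. i \<ge> k \<Longrightarrow> v i = 0"
  shows "v \<in> V.span ((\<lambda>i j. if j = i then 1 else 0) ` {i. i < k \<and> v i \<noteq> 0})"
  using assms
proof (induction k arbitrary: v)
  case 0
  then have "v = 0" by (auto simp: fun_eq_iff)
  show ?case unfolding \<open>v = 0\<close> by (rule V.span_zero)
next
  case (Suc k)
  let ?u = "\<lambda>i j. if j = i then 1 else 0 :: complex"
  let ?w = "v(k := 0)"
  have "?w \<in> V.span (?u ` {i. i < k \<and> ?w i \<noteq> 0})"
    using Suc.prems by (intro Suc.IH) auto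
  also have "\<dots> \<subseteq> V.span (?u ` {i. i < Suc k \<and> v i \<noteq> 0})"
    by (intro V.span_mono image_mono) auto
  finally have w: "?w \<in> V.span (?u ` {i. i < Suc k \<and> v i \<noteq> 0})" .
  have "vsc (v k) (?u k) \<in> V.span (?u ` {i. i < Suc k \<and> v i \<noteq> 0})"
  proof (cases "v k = 0")
    case True
    then show ?thesis by (simp add: V.span_zero)
  next
    case False
    then show ?thesis by (intro V.span_scale V.span_base) auto
  qed
  from V.span_add[OF w this] show ?case
    by (rule back_subst[where P = "\<lambda>x. x \<in> _"]) auto
qed

text \<open>\<open>sh\<close> carries coordinate \<open>i\<close> in degree \<open>n\<close> to
  coordinate \<open>i + 1\<close> in degree \<open>n + 1\<close>; the condition on \<open>d\<close>
  makes room for it, and \<open>k\<close> is even so that no block is cut in half.\<close>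

lemma C2_gr:
  assumes k: "even k"
    and d: "\<And>i n. i < k \<Longrightarrow> even i \<Longrightarrow> present (d i) n \<Longrightarrow> present (d (Suc i)) (n + 1)"
  shows "C2 (stdmod (gr k d) sh)"
proof (rule C2I)
  show "is_gmod (stdmod (gr k d) sh)"
  proof (rule is_gmodI; simp add: subspace_gr lin_on_sh sh_sh lin_on_id)
    fix n v assume v: "v \<in> gr k d n"
    then show "v \<in> gr k d (n - 1)"
      by (auto simp: gr_def intro: upto_mono)
    have "present (d i) (n + 1)" if "i < k" "odd i" "v (i - 1) \<noteq> 0" for i
      using that v d[of "i - 1" n] by (auto simp: gr_def)
    moreover have "v (i - 1) = 0" if "i \<ge> k" "odd i" for i
    proof -
      have "i \<noteq> k" using that(2) k by auto
      then show ?thesis using that v by (auto simp: gr_def)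
    qed
    ultimately show "sh v \<in> gr k d (n + 1)"
      by (auto simp: gr_def sh_def)
  qed
  show "tame (stdmod (gr k d) sh)"
  proof -
    \<comment> \<open>All finite entries of \<open>d\<close> lie between \<open>-B\<close> and
      \<open>B\<close>: above \<open>B\<close> nothing is present, and from \<open>-B\<close>
      downwards the pieces no longer change.\<close>
    define B where "B = (\<Sum>i<k. case d i of None \<Rightarrow> 0 | Some a \<Rightarrow> \<bar>a\<bar>)"
    have B: "- B \<le> a \<and> a \<le> B" if "i < k" "d i = Some a" for i a
    proof -
      have "(case d i of None \<Rightarrow> 0 | Some a \<Rightarrow> \<bar>a\<bar>) \<le> B"
        unfolding B_def using that(1) by (intro member_le_sum) (auto split: option.split)
      then show ?thesis using that(2) by auto
    qed
    have "spanned (gr k d n) k" for n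
    proof -
      let ?u = "\<lambda>i j. if j = i then 1 else 0 :: complex"
      let ?B = "?u ` {i. i < k \<and> present (d i) n}"
      have "gr k d n \<subseteq> V.span ?B"
      proof
        fix v assume v: "v \<in> gr k d n"
        then have "v \<in> V.span (?u ` {i. i < k \<and> v i \<noteq> 0})"
          by (intro support_span) (auto simp: gr_def)
        also have "\<dots> \<subseteq> V.span ?B"
          using v by (intro V.span_mono image_mono) (auto simp: gr_def)
        finally show "v \<in> V.span ?B" .
      qed
      moreover have "?B \<subseteq> gr k d n" by (auto simp: gr_def split: if_splits)
      moreover have "card ?B \<le> card {..<k}"
        by (intro surj_card_le[of _ _ ?u]) auto
      ultimately show ?thesis
        unfolding spanned_def by (intro exI[of _ ?B]) simp
    qed
    moreover have "gr k d n \<subseteq> {0}" if "n \<ge> B + 1" for n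
    proof
      fix v assume v: "v \<in> gr k d n"
      have "v i = 0" for i
      proof (cases "i < k")
        case True
        then show ?thesis using v B[OF True] that by (cases "d i") (fastforce simp: gr_def)+
      qed (use v in \<open>auto simp: gr_def\<close>)
      then show "v \<in> {0}" by (simp add: fun_eq_iff)
    qed
    moreover have "gr k d (n - 1) \<subseteq> gr k d n" if "n \<le> - B" for n
    proof
      fix v assume v: "v \<in> gr k d (n - 1)"
      have "present (d i) n" if "i < k" "v i \<noteq> 0" for i
        using that v B[OF that(1)] \<open>n \<le> - B\<close> by (cases "d i") (fastforce simp: gr_def)+
      then show "v \<in> gr k d n" using v by (simp add: gr_def)
    qed
    ultimately show ?thesis unfolding tame_def by auto
  qed
qed (rule mcm_std)

text \<open>For the arc \<open>(a, b)\<close>, the generator \<open>y^k\<close> of the shifted ideal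
  has degree \<open>a\<close> and the generator \<open>x\<close> has degree \<open>b\<close>. For an
  infinite arc coordinate 0 is switched off and the only generator sits in coordinate 1, so for both
  kinds of arcs \<open>e 0 1\<close> has degree \<open>b\<close> and spans the kernel of
  \<open>sh\<close>.\<close>

definition model :: "int option \<Rightarrow> int \<Rightarrow> gmod" where
  "model l b = stdmod (gr 2 (\<lambda>i. if i = 0 then l else Some b)) sh"

lemma pc_model:
  "v \<in> pc (model l b) n \<longleftrightarrow>
     (v 0 \<noteq> 0 \<longrightarrow> present l n) \<and> (v 1 \<noteq> 0 \<longrightarrow> n \<le> b) \<and> (\<forall>i\<ge>2. v i = 0)"
  by (auto simp: model_def gr_def less_2_cases_iff)

lemma xy_model [simp]: "xa (model l b) n = sh" "ya (model l b) n = (\<lambda>v. v)"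
  by (simp_all add: model_def)

text \<open>Coordinate 0 in its last degree \<open>a\<close> is sent by \<open>sh\<close> to
  coordinate 1 in degree \<open>a + 1\<close>, which must be at most \<open>b\<close>.\<close>

definition valid :: "int option \<Rightarrow> int \<Rightarrow> bool" where
  "valid l b \<longleftrightarrow> (\<forall>a. l = Some a \<longrightarrow> a < b)"

lemma C2_model: "valid l b \<Longrightarrow> C2 (model l b)"
  unfolding model_def by (rule C2_gr) (auto simp: valid_def less_2_cases_iff elim: present.elims)

definition e :: "complex \<Rightarrow> complex \<Rightarrow> vec" where
  "e p q = (\<lambda>i. if i = 0 then p else if i = 1 then q else 0)"

lemma e_simps [simp]: "e p q 0 = p" "e p q (Suc 0) = q" "i \<ge> 2 \<Longrightarrow> e p q i = 0"
  by (auto simp: e_def)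

lemma e_pc: "e p q \<in> pc (model l b) n \<longleftrightarrow> (p \<noteq> 0 \<longrightarrow> present l n) \<and> (q \<noteq> 0 \<longrightarrow> n \<le> b)"
  by (simp add: pc_model)

lemma model_e: "v \<in> pc (model l b) n \<Longrightarrow> v = e (v 0) (v 1)"
  by (auto simp: pc_model e_def fun_eq_iff)

lemma e_add: "e p q + e p' q' = e (p + p') (q + q')" and e_vsc: "vsc c (e p q) = e (c * p) (c * q)"
  and e_0: "e 0 0 = 0"
  by (auto simp: e_def fun_eq_iff)

lemma e_sh: "sh (e p q) = e 0 p"
proof
  fix i :: nat
  have "i - 1 \<noteq> 1" if "odd i" using that by presburger
  then show "sh (e p q) i = e 0 p i" by (auto simp: e_def sh_def)
qed

lemma e_inject: "e p q = e p' q' \<longleftrightarrow> p = p' \<and> q = q'"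
  by (metis e_simps(1,2))

fun lo :: "arc \<Rightarrow> int option" where
  "lo (Fin a b) = Some a"
| "lo (Inf b) = None"

fun hi :: "arc \<Rightarrow> int" where
  "hi (Fin a b) = b"
| "hi (Inf b) = b"

lemma valid_lo_hi: "valid_arc \<alpha> \<longleftrightarrow> valid (lo \<alpha>) (hi \<alpha>)"
  by (cases \<alpha>) (auto simp: valid_def)

text \<open>The right side is a graded submodule containing both generators. Conversely, as
  \<open>y\<close> acts by the identity on coordinates, its vectors are combinations of the two
  generators moved down in degree.\<close>

lemma pc_ideal:
  "pc (ideal_xyk k) n =
     {v. (\<forall>i\<ge>2. v i = 0) \<and> (n > - int k \<longrightarrow> v 0 = 0) \<and> (n > 1 \<longrightarrow> v 1 = 0)}" (is "_ = ?J n")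
proof
  have R: "xa Rmod n v = (\<lambda>i. if i = 1 then v 0 else 0)" "ya Rmod n v = v" for n v
    by (simp_all add: Rmod_def)
  have J: "gsub Rmod ?J"
  proof (rule gsubI)
    fix n
    show "?J n \<subseteq> pc Rmod n" by (auto simp: Rmod_def)
    show "V.subspace (?J n)" by (auto simp: V.subspace_def)
  qed (auto simp: R)
  have "\<forall>(d, g)\<in>{(1, e1), (- int k, e0)}. g \<in> ?J d"
    by (auto simp: e0_def e1_def)
  with J show "pc (ideal_xyk k) n \<subseteq> ?J n"
    unfolding ideal_xyk_def submod_sel gen_def by blast
  show "?J n \<subseteq> pc (ideal_xyk k) n"
    unfolding ideal_xyk_def submod_sel gen_def
  proof (intro subsetI InterI, elim CollectE exE conjE)
    fix v :: vec and X U assume v: "(\<forall>i\<ge>2. v i = 0)" "(n > - int k \<longrightarrow> v 0 = 0)" "(n > 1 \<longrightarrow> v 1 = 0)"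
      and X: "X = U n" and U: "gsub Rmod U" and G: "\<forall>(d, g)\<in>{(1, e1), (- int k, e0)}. g \<in> U d"
    have desc: "w \<in> U m" if "w \<in> U m'" "m \<le> m'" for w m m'
      using that(2)
    proof (induction rule: int_le_induct)
      case (step i)
      then show ?case using gsubD(4)[OF U, of w i] by (simp add: R)
    qed (fact that(1))
    have "vsc (v 0) e0 \<in> U n"
    proof (cases "n > - int k")
      case True
      then show ?thesis using v V.subspace_0[OF gsubD(2)[OF U]] by simp
    next
      case False
      then show ?thesis
        using G desc[of e0 "- int k" n] by (intro V.subspace_scale[OF gsubD(2)[OF U]]) auto
    qed
    moreover have "vsc (v 1) e1 \<in> U n"
    proof (cases "n > 1")
      case True
      then show ?thesis using v V.subspace_0[OF gsubD(2)[OF U]] by simp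
    next
      case False
      then show ?thesis
        using G desc[of e1 1 n] by (intro V.subspace_scale[OF gsubD(2)[OF U]]) auto
    qed
    ultimately have "vsc (v 0) e0 + vsc (v 1) e1 \<in> U n"
      by (rule V.subspace_add[OF gsubD(2)[OF U]])
    also have "vsc (v 0) e0 + vsc (v 1) e1 = v"
    proof
      fix i :: nat
      consider "i = 0" | "i = 1" | "i \<ge> 2" by linarith
      then show "(vsc (v 0) e0 + vsc (v 1) e1) i = v i"
        using v(1) by cases (auto simp: e0_def e1_def)
    qed
    finally show "v \<in> X" using X by simp
  qed
qed

lemma model_arc_iso:
  assumes "valid_arc \<alpha>" shows "gm_iso (model (lo \<alpha>) (hi \<alpha>)) (arc_mod \<alpha>)"
proof (cases \<alpha>)
  case (Fin a b)
  have ab: "a < b" using assms Fin by simp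
  let ?A = "arc_mod (Fin a b)"
  have pcA: "pc ?A n = pc (model (Some a) b) n" for n
    using ab by (auto simp: shift_def pc_ideal pc_model)
  have xyA: "xa ?A n v = (\<lambda>i. if i = 1 then v 0 else 0)" "ya ?A n v = v" for n v
    by (simp_all add: shift_def ideal_xyk_def submod_def Rmod_def)
  have "(\<lambda>i. if i = 1 then v 0 else 0) = sh v" if "\<forall>i\<ge>2. v i = 0" for v
    using that by (auto simp: sh_def fun_eq_iff elim!: oddE)
  then have "hom (model (Some a) b) ?A (\<lambda>n v. v)"
    by (intro homI) (auto simp: xyA pcA pc_model intro: lin_onI simp del: arc_mod.simps)
  then show ?thesis
    using gm_iso_bij[of _ ?A "\<lambda>n v. v"] C2D(1)[OF C2_model] assms Fin
    by (simp add: pcA bij_betw_def valid_lo_hi del: arc_mod.simps)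
next
  case (Inf b)
  let ?A = "shift Cy (- b)"
  have pcA: "v \<in> pc ?A n \<longleftrightarrow> (v 0 \<noteq> 0 \<longrightarrow> n \<le> b) \<and> (\<forall>i\<ge>1. v i = 0)" for v n
    by (auto simp: shift_def Cy_def)
  \<comment> \<open>\<open>Cy\<close> keeps its generator in coordinate 0, the model in coordinate
    1; \<open>sh\<close> moves it back.\<close>
  let ?f = "\<lambda>v :: vec. (\<lambda>i. if i = 0 then v 1 else 0) :: vec"
  have "hom (model None b) ?A (\<lambda>n. ?f)"
  proof (rule homI)
    show "lin_on (pc (model None b) n) ?f" for n
      by (rule lin_onI) (auto simp: fun_eq_iff)
  qed (auto simp: pcA pc_model sh_def shift_def Cy_def vzero_def)
  moreover have "bij_betw ?f (pc (model None b) n) (pc ?A n)" for n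
  proof (rule bij_betw_byWitness[where f' = sh])
    show "?f ` pc (model None b) n \<subseteq> pc ?A n" by (auto simp: pcA pc_model)
    show "sh ` pc ?A n \<subseteq> pc (model None b) n" by (auto simp: pcA pc_model sh_def)
    show "\<forall>v\<in>pc (model None b) n. sh (?f v) = v"
    proof
      fix v assume v: "v \<in> pc (model None b) n"
      have "sh (?f v) i = v i" for i
      proof -
        consider "i = 0" | "i = 1" | "i \<ge> 2" by linarith
        then show ?thesis using v by cases (auto simp: pc_model sh_def)
      qed
      then show "sh (?f v) = v" by blast
    qed
    show "\<forall>v\<in>pc ?A n. ?f (sh v) = v"
      by (auto simp: pcA sh_def fun_eq_iff)
  qed
  ultimately show ?thesis
    using gm_iso_bij[of "model None b" ?A] C2D(1)[OF C2_model, of None b] Inf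
    by (simp add: valid_def)
qed

section \<open>Indecomposability and summands\<close>

lemma indec_gm_iso:
  assumes iso: "gm_iso M N" and M: "is_gmod M" and N: "is_gmod N" and "indec M"
  shows "indec N"
proof (rule ccontr)
  obtain f g where f: "hom M N f" and g: "hom N M g" and gf: "\<And>n v. v \<in> pc M n \<Longrightarrow> g n (f n v) = v"
    and fg: "\<And>n v. v \<in> pc N n \<Longrightarrow> f n (g n v) = v"
    using iso unfolding gm_iso_def by blast
  note fD = homD[OF f] and gD = homD[OF g] and ND = is_gmodD[OF N] and MD = is_gmodD[OF M]
  have g0: "g n 0 = 0" for n using lin_on_0[OF gD(2) ND(1)] .
  have f0: "f n 0 = 0" for n using lin_on_0[OF fD(2) MD(1)] .
  have "\<not> is_zero N"
  proof
    assume "is_zero N"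
    have "pc M n = {0}" for n
    proof -
      have "v = 0" if "v \<in> pc M n" for v
        using gf[OF that] fD(1)[OF that] g0[of n] is_zeroD[OF \<open>is_zero N\<close>, of n] by simp
      then show ?thesis using V.subspace_0[OF MD(1), of n] by blast
    qed
    then have "is_zero M"
      by (simp add: is_zero_def vzero_eq)
    then show False using assms(4) by (simp add: indec_def)
  qed
  moreover assume "\<not> indec N"
  ultimately have "\<exists>U W. gsub N U \<and> gsub N W \<and> (\<exists>n. U n \<noteq> {0}) \<and> (\<exists>n. W n \<noteq> {0}) \<and>
      (\<forall>n. U n \<inter> W n = {0} \<and> {u + w |u w. u \<in> U n \<and> w \<in> W n} = pc N n)"
    unfolding indec_def vzero_eq vadd_eq by simp
  then obtain U W where UW': "gsub N U \<and> gsub N W \<and> (\<exists>n. U n \<noteq> {0}) \<and> (\<exists>n. W n \<noteq> {0}) \<and>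
      (\<forall>n. U n \<inter> W n = {0} \<and> {u + w |u w. u \<in> U n \<and> w \<in> W n} = pc N n)"
    by (elim exE)
  then have U: "gsub N U" and W: "gsub N W" and Un: "\<exists>n. U n \<noteq> {0}" and Wn: "\<exists>n. W n \<noteq> {0}"
    and UW: "\<And>n. U n \<inter> W n = {0}" and sum: "\<And>n. {u + w |u w. u \<in> U n \<and> w \<in> W n} = pc N n"
    by simp_all
  have img: "gsub M (\<lambda>n. g n ` X n)" if X: "gsub N X" for X
  proof (rule gsubI)
    fix n
    show "g n ` X n \<subseteq> pc M n" using gsubD(1)[OF X, of n] gD(1) by blast
    show "V.subspace (g n ` X n)"
      by (rule subspace_image[OF lin_on_mono[OF gD(2) gsubD(1)[OF X]] gsubD(2)[OF X]])
    fix v assume "v \<in> g n ` X n"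
    then obtain x where x: "x \<in> X n" "v = g n x" by blast
    have "x \<in> pc N n" using gsubD(1)[OF X] x(1) by blast
    from gD(3,4)[OF this, symmetric]
    show "xa M n v \<in> g (n + 1) ` X (n + 1)" "ya M n v \<in> g (n - 1) ` X (n - 1)"
      using x(2) gsubD(3,4)[OF X x(1)] by simp_all
  qed
  have nz: "\<exists>n. g n ` X n \<noteq> {0}" if X: "gsub N X" "\<exists>n. X n \<noteq> {0}" for X
  proof -
    obtain n x where x: "x \<in> X n" "x \<noteq> 0"
      using X(2) V.subspace_0[OF gsubD(2)[OF X(1)]] by blast
    have "x \<in> pc N n" using gsubD(1)[OF X(1)] x(1) by blast
    then have "g n x \<noteq> 0" using fg[of x n] f0[of n] x(2) by auto
    then show ?thesis using x(1) by blast
  qed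
  have int: "g n ` U n \<inter> g n ` W n = {0}" for n
  proof -
    have eq: "u = w" if uw: "u \<in> U n" "w \<in> W n" and gg: "g n u = g n w" for u w
    proof -
      have "u = f n (g n u)" using fg[OF subsetD[OF gsubD(1)[OF U] uw(1)]] by (rule sym)
      also have "\<dots> = w" unfolding gg by (rule fg[OF subsetD[OF gsubD(1)[OF W] uw(2)]])
      finally show ?thesis .
    qed
    have "0 \<in> g n ` U n" "0 \<in> g n ` W n"
      using V.subspace_0[OF gsubD(2)[OF img[OF U]]] V.subspace_0[OF gsubD(2)[OF img[OF W]]] by simp_all
    moreover have "x = 0" if x: "x \<in> g n ` U n" "x \<in> g n ` W n" for x
    proof -
      obtain u w where uw: "u \<in> U n" "w \<in> W n" "x = g n u" "x = g n w" using x by blast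
      have "u = w" by (rule eq[OF uw(1,2)]) (use uw(3,4) in simp)
      then have "u \<in> U n \<inter> W n" using uw by simp
      then show ?thesis using UW uw(3) g0 by simp
    qed
    ultimately show ?thesis by blast
  qed
  have sum': "{u + w |u w. u \<in> g n ` U n \<and> w \<in> g n ` W n} = pc M n" for n
  proof
    show "{u + w |u w. u \<in> g n ` U n \<and> w \<in> g n ` W n} \<subseteq> pc M n"
    proof
      fix x assume "x \<in> {u + w |u w. u \<in> g n ` U n \<and> w \<in> g n ` W n}"
      then obtain u w where uw: "x = u + w" "u \<in> g n ` U n" "w \<in> g n ` W n" by blast
      then show "x \<in> pc M n"
        using V.subspace_add[OF MD(1)] subsetD[OF gsubD(1)[OF img[OF U]] uw(2)]
          subsetD[OF gsubD(1)[OF img[OF W]] uw(3)] by simp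
    qed
    show "pc M n \<subseteq> {u + w |u w. u \<in> g n ` U n \<and> w \<in> g n ` W n}"
    proof
      fix v assume v: "v \<in> pc M n"
      then have "f n v \<in> {u + w |u w. u \<in> U n \<and> w \<in> W n}" using sum fD(1) by simp
      then obtain u w where uw: "u \<in> U n" "w \<in> W n" "f n v = u + w" by blast
      have "u \<in> pc N n" "w \<in> pc N n" using gsubD(1)[OF U] gsubD(1)[OF W] uw by blast+
      then have "v = g n u + g n w"
        using gf[OF v] uw(3) lin_on_add[OF gD(2)] by simp
      moreover have "g n u \<in> g n ` U n" "g n w \<in> g n ` W n" using uw by simp_all
      ultimately show "v \<in> {u + w |u w. u \<in> g n ` U n \<and> w \<in> g n ` W n}" by blast
    qed
  qed
  have "\<exists>U W. gsub M U \<and> gsub M W \<and> (\<exists>n. U n \<noteq> {0}) \<and> (\<exists>n. W n \<noteq> {0}) \<and>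
      (\<forall>n. U n \<inter> W n = {0} \<and> {u + w |u w. u \<in> U n \<and> w \<in> W n} = pc M n)"
    by (rule exI[of _ "\<lambda>n. g n ` U n"], rule exI[of _ "\<lambda>n. g n ` W n"])
      (intro conjI allI img[OF U] img[OF W] nz[OF U Un] nz[OF W Wn] int sum')
  then show False
    using assms(4) unfolding indec_def vzero_eq vadd_eq by simp
qed

text \<open>Any two nonzero submodules contain \<open>s\<close>, and both contain it in the smaller
  of the two degrees, so they cannot meet in zero.\<close>

lemma indec_essential:
  assumes s: "s \<noteq> 0" "s \<in> F m"
    and ess: "\<And>U n u. gsub (stdmod F T) U \<Longrightarrow> u \<in> U n \<Longrightarrow> u \<noteq> 0 \<Longrightarrow> \<exists>k. s \<in> U k"
  shows "indec (stdmod F T)"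
  unfolding indec_def vzero_eq
proof (intro conjI notI)
  assume "is_zero (stdmod F T)"
  then show False using s is_zeroD[of "stdmod F T" m] by auto
next
  assume "\<exists>U W. gsub (stdmod F T) U \<and> gsub (stdmod F T) W \<and> (\<exists>n. U n \<noteq> {0}) \<and> (\<exists>n. W n \<noteq> {0}) \<and>
    (\<forall>n. U n \<inter> W n = {0} \<and> {vadd u w |u w. u \<in> U n \<and> w \<in> W n} = pc (stdmod F T) n)"
  then obtain U W where UW': "gsub (stdmod F T) U \<and> gsub (stdmod F T) W \<and> (\<exists>n. U n \<noteq> {0}) \<and>
    (\<exists>n. W n \<noteq> {0}) \<and>
    (\<forall>n. U n \<inter> W n = {0} \<and> {vadd u w |u w. u \<in> U n \<and> w \<in> W n} = pc (stdmod F T) n)"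
    by (elim exE)
  then have U: "gsub (stdmod F T) U" "\<exists>n. U n \<noteq> {0}"
    and W: "gsub (stdmod F T) W" "\<exists>n. W n \<noteq> {0}" and UW: "\<And>n. U n \<inter> W n = {0}"
    by simp_all
  have "\<exists>k. s \<in> X k" if X: "gsub (stdmod F T) X" "\<exists>n. X n \<noteq> {0}" for X
    using X ess[OF X(1)] V.subspace_0[OF gsubD(2)[OF X(1)]] by blast
  from this[OF U] this[OF W] obtain j k where "s \<in> U j" "s \<in> W k" by blast
  then have "s \<in> U (min j k) \<inter> W (min j k)"
    using std_gsub_mono[OF U(1), of "min j k" j] std_gsub_mono[OF W(1), of "min j k" k] by simp
  then show False using UW s(1) by blast
qed

lemma indec_model: "indec (model l b)"
  unfolding model_def
proof (rule indec_essential[where s = "e 0 1" and m = b])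
  show "e 0 1 \<noteq> 0" by (simp add: e_inject flip: e_0)
  show "e 0 1 \<in> gr 2 (\<lambda>i. if i = 0 then l else Some b) b"
    using e_pc[of 0 1 l b b] by (simp add: model_def)
next
  fix U n u
  assume "gsub (stdmod (gr 2 (\<lambda>i. if i = 0 then l else Some b)) sh) U"
    and u: "u \<in> U n" "u \<noteq> 0"
  then have U: "gsub (model l b) U" by (simp add: model_def)
  note UD = gsubD[OF U]
  have "u \<in> pc (model l b) n" using UD(1) u(1) by blast
  then obtain p q where pq: "u = e p q" using model_e by blast
  show "\<exists>k. e 0 1 \<in> U k"
  proof (cases "p = 0")
    case True
    then have "q \<noteq> 0" using u(2) pq e_0 by auto
    then have "e 0 1 = vsc (1 / q) u" using pq True by (simp add: e_vsc)
    then show ?thesis using V.subspace_scale[OF UD(2) u(1)] by metis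
  next
    case False
    then have "e 0 1 = vsc (1 / p) (sh u)" using pq by (simp add: e_vsc e_sh)
    then show ?thesis using V.subspace_scale[OF UD(2)] UD(3)[OF u(1)] by (metis xy_model(1))
  qed
qed

lemma C2_arc: assumes "valid_arc \<alpha>" shows "C2 (arc_mod \<alpha>)"
proof -
  let ?M = "model (lo \<alpha>) (hi \<alpha>)"
  have M: "C2 ?M" using assms valid_lo_hi C2_model by blast
  obtain f g where fg: "hom ?M (arc_mod \<alpha>) f" "hom (arc_mod \<alpha>) ?M g"
    "\<And>n v. v \<in> pc ?M n \<Longrightarrow> g n (f n v) = v" "\<And>n v. v \<in> pc (arc_mod \<alpha>) n \<Longrightarrow> f n (g n v) = v"
    using model_arc_iso[OF assms] unfolding gm_iso_def by blast
  have im: "f n ` pc ?M n = pc (arc_mod \<alpha>) n" for n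
  proof
    show "f n ` pc ?M n \<subseteq> pc (arc_mod \<alpha>) n" using homD(1)[OF fg(1)] by blast
    show "pc (arc_mod \<alpha>) n \<subseteq> f n ` pc ?M n"
    proof
      fix v assume v: "v \<in> pc (arc_mod \<alpha>) n"
      from fg(4)[OF v, symmetric] homD(1)[OF fg(2) v] show "v \<in> f n ` pc ?M n" by (rule image_eqI)
    qed
  qed
  have "mcm (arc_mod \<alpha>)"
    by (cases \<alpha>) (auto simp: mcm_def shift_def ideal_xyk_def submod_def Rmod_def Cy_def)
  then show ?thesis
    using gmod_image[OF fg(1) C2D(1)[OF M] im] tame_image[OF fg(1) C2D(1)[OF M] im C2D(3)[OF M]]
    by (intro C2I)
qed

lemma indec_arc: "valid_arc \<alpha> \<Longrightarrow> indec (arc_mod \<alpha>)"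
  using indec_gm_iso[OF model_arc_iso C2D(1) C2D(1) indec_model] C2_arc C2_model valid_lo_hi by blast

text \<open>The complement is the kernel of the retraction, with \<open>1 - i p\<close> as
  projection. The last clause records that something is lost in every degree where \<open>Z\<close>
  is nonzero; it drives the induction in \<open>arcs_generate\<close>.\<close>

lemma retract_complement:
  assumes "retract Z M" "C2 Z" "C2 M"
  shows "\<exists>W. C2 W \<and> is_biprod M Z W \<and> (\<forall>n. V.subspace (pc W n) \<and> pc W n \<subseteq> pc M n \<and>
    (pc Z n \<noteq> {0} \<longrightarrow> pc W n \<noteq> pc M n))"
proof -
  note Z = C2D(1)[OF assms(2)] and M = C2D(1)[OF assms(3)]
  obtain i p where i: "hom Z M i" and p: "hom M Z p" and pi: "\<And>n v. v \<in> pc Z n \<Longrightarrow> p n (i n v) = v"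
    using assms(1) by (auto simp: retract_def)
  note ZD = is_gmodD[OF Z] and MD = is_gmodD[OF M] and iD = homD[OF i] and pD = homD[OF p]
  have p0: "p n 0 = 0" and i0: "i n 0 = 0" for n
    using lin_on_0[OF pD(2) MD(1)] lin_on_0[OF iD(2) ZD(1)] by auto
  define U where "U = (\<lambda>n. {v \<in> pc M n. p n v = 0})"
  have U: "gsub M U" unfolding U_def by (rule gsub_kernel[OF p M Z])
  let ?W = "submod M U"
  define q where "q n v = v - i n (p n v)" for n v
  have "hom M M (\<lambda>n v. vsc 1 v + vsc (- 1) (i n (p n v)))"
    by (rule hom_add_scale[OF hom_id hom_comp[OF p i] M M])
  then have qM: "hom M M q" unfolding q_def by simp
  note qD = homD[OF qM]
  have qU: "q n v \<in> U n" if v: "v \<in> pc M n" for n v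
  proof -
    have "p n (q n v) = 0"
      using v by (simp add: q_def lin_on_diff[OF pD(2) MD(1)] iD pD pi)
    then show ?thesis using qD(1)[OF v] by (simp add: U_def)
  qed
  have q: "hom M ?W q"
    by (rule homI) (use qU qD in auto)
  have j: "hom ?W M (\<lambda>n v. v)"
    by (rule homI) (auto simp: U_def lin_on_id)
  have W: "is_gmod ?W" by (rule is_gmod_submod[OF M U])
  have qid: "q n v = v" if "v \<in> U n" for n v
    using that i0 by (simp add: q_def U_def)
  have "q n ` pc M n = pc ?W n" for n
  proof
    show "q n ` pc M n \<subseteq> pc ?W n" using qU by auto
    show "pc ?W n \<subseteq> q n ` pc M n"
      using qid[of _ n] gsubD(1)[OF U, of n] by (force simp: image_iff)
  qed
  from tame_image[OF q M this C2D(3)[OF assms(3)]] have "tame ?W" .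
  moreover have "mcm ?W"
    using C2D(2)[OF assms(3)] gsubD(1)[OF U] by (auto simp: mcm_def intro: inj_on_subset)
  ultimately have "C2 ?W" using W by (intro C2I)
  moreover have "is_biprod M Z ?W"
    unfolding is_biprod_def vzero_eq vadd_eq
    by (rule exI[of _ i], rule exI[of _ "\<lambda>n v. v"], rule exI[of _ p], rule exI[of _ q])
      (use i j p q pi qid in \<open>auto simp: U_def q_def\<close>)
  moreover have "pc ?W n \<noteq> pc M n" if "pc Z n \<noteq> {0}" for n
  proof -
    obtain z where z: "z \<in> pc Z n" "z \<noteq> 0"
      using \<open>pc Z n \<noteq> {0}\<close> V.subspace_0[OF ZD(1)[of n]] by auto
    then have "i n z \<in> pc M n" "i n z \<notin> U n"
      using iD(1) pi by (auto simp: U_def)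
    then show ?thesis by auto
  qed
  moreover have "V.subspace (pc ?W n)" "pc ?W n \<subseteq> pc M n" for n
    using gsubD(1,2)[OF U] by simp_all
  ultimately show ?thesis by (intro exI[of _ ?W] conjI allI impI)
qed

text \<open>The universal property of a model: it is generated by \<open>e 1 0\<close> and
  \<open>e 0 1\<close> with \<open>sh\<close> taking the first to the second and the second to zero.
  For an infinite arc coordinate 0 vanishes and so does the contribution of
  \<open>u\<close>.\<close>

lemma hom_from_model:
  assumes F: "is_gmod (stdmod F T)" and v: "v \<in> F b" "T v = 0"
    and u: "\<And>a. l = Some a \<Longrightarrow> u \<in> F a \<and> T u = v"
  shows "hom (model l b) (stdmod F T) (\<lambda>n z. vsc (z 0) u + vsc (z 1) v)"
proof (rule homI)
  note FD = stdD[OF F]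
  have zu: "vsc (z 0) u \<in> F n \<and> T (vsc (z 0) u) = vsc (z 0) v"
    and zv: "vsc (z 1) v \<in> F n \<and> T (vsc (z 1) v) = 0" if z: "z \<in> pc (model l b) n" for z n
  proof -
    have T0: "T 0 = 0" using lin_on_0[OF FD(3,1)] .
    show "vsc (z 0) u \<in> F n \<and> T (vsc (z 0) u) = vsc (z 0) v"
    proof (cases "z 0 = 0")
      case True
      then show ?thesis using V.subspace_0[OF FD(1)] T0 by simp
    next
      case False
      then obtain a where a: "l = Some a" "n \<le> a" using z by (cases l) (auto simp: pc_model)
      then have "u \<in> F n" "T u = v" using std_mono[OF F a(2)] u[OF a(1)] by simp_all
      then show ?thesis
        using V.subspace_scale[OF FD(1)[of n]] lin_on_scale[OF FD(3)[of n]] by simp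
    qed
    show "vsc (z 1) v \<in> F n \<and> T (vsc (z 1) v) = 0"
    proof (cases "z 1 = 0")
      case True
      then show ?thesis using V.subspace_0[OF FD(1)] T0 by simp
    next
      case False
      then have "n \<le> b" using z by (auto simp: pc_model)
      then have "v \<in> F n" using std_mono[OF F _ v(1)] by simp
      then show ?thesis
        using V.subspace_scale[OF FD(1)[of n]] lin_on_scale[OF FD(3)[of n]] v(2) by simp
    qed
  qed
  fix n
  show "lin_on (pc (model l b) n) (\<lambda>z. vsc (z 0) u + vsc (z 1) v)"
    by (rule lin_onI) (simp_all add: V.scale_left_distrib V.scale_right_distrib)
  fix z assume z: "z \<in> pc (model l b) n"
  show "vsc (z 0) u + vsc (z 1) v \<in> pc (stdmod F T) n"
    using zu[OF z] zv[OF z] V.subspace_add[OF FD(1)[of n]] by simp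
  have "T (vsc (z 0) u + vsc (z 1) v) = vsc (z 0) v"
    using zu[OF z] zv[OF z] lin_on_add[OF FD(3)[of n], of "vsc (z 0) u" "vsc (z 1) v"] by simp
  then show "vsc (xa (model l b) n z 0) u + vsc (xa (model l b) n z 1) v =
      xa (stdmod F T) n (vsc (z 0) u + vsc (z 1) v)"
    by (simp add: sh_def)
qed simp

text \<open>A functional \<open>f\<close> determines a map to a block with coordinates
  \<open>f (T w)\<close> and \<open>f w\<close>; it respects the operators because \<open>T\<close>
  squares to zero. The last two assumptions keep it inside the filtration, and the values of
  \<open>f\<close> at \<open>u\<close> and \<open>v\<close> make it a retraction.\<close>

lemma retract_model:
  assumes F: "is_gmod (stdmod F T)" and v: "v \<in> F b" "T v = 0"
    and u: "\<And>a. l = Some a \<Longrightarrow> u \<in> F a \<and> T u = v \<and> f u = 0"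
    and f: "\<And>x y. f (x + y) = f x + f y" "\<And>c x. f (vsc c x) = c * f x" "f v = (1 :: complex)"
    and fF: "\<And>n w. w \<in> F n \<Longrightarrow> f w \<noteq> 0 \<Longrightarrow> n \<le> b"
      "\<And>n w. w \<in> F n \<Longrightarrow> f (T w) \<noteq> 0 \<Longrightarrow> present l n"
  shows "retract (model l b) (stdmod F T)"
  unfolding retract_def
proof (intro exI conjI)
  note FD = stdD[OF F]
  have f0: "f 0 = 0" using f(2)[of 0 0] by simp
  show "hom (model l b) (stdmod F T) (\<lambda>n z. vsc (z 0) u + vsc (z 1) v)"
    using u by (intro hom_from_model[OF F v]) auto
  show "hom (stdmod F T) (model l b) (\<lambda>n w. e (f (T w)) (f w))"
  proof (rule homI)
    fix n
    show "lin_on (pc (stdmod F T) n) (\<lambda>w. e (f (T w)) (f w))"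
      by (rule lin_onI) (simp_all add: e_add e_vsc f lin_on_add[OF FD(3)[of n]] lin_on_scale[OF FD(3)[of n]])
    fix w assume w: "w \<in> pc (stdmod F T) n"
    then show "e (f (T w)) (f w) \<in> pc (model l b) n"
      using fF[of w n] by (simp add: e_pc)
    show "e (f (T (xa (stdmod F T) n w))) (f (xa (stdmod F T) n w)) =
        xa (model l b) n (e (f (T w)) (f w))"
      using w FD(5)[of w n] f0 by (simp add: e_sh)
  qed simp
  show "\<forall>n. \<forall>z\<in>pc (model l b) n.
    e (f (T (vsc (z 0) u + vsc (z 1) v))) (f (vsc (z 0) u + vsc (z 1) v)) = z"
  proof (intro allI ballI)
    fix n z assume z: "z \<in> pc (model l b) n"
    show "e (f (T (vsc (z 0) u + vsc (z 1) v))) (f (vsc (z 0) u + vsc (z 1) v)) = z"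
    proof (cases "z 0 = 0")
      case True
      then have "T (vsc (z 1) v) = 0" using v lin_on_scale[OF FD(3)] by auto
      then show ?thesis using True model_e[OF z] f f0 by simp
    next
      case False
      then obtain a where a: "l = Some a" using z by (cases l) (auto simp: pc_model)
      then have u: "u \<in> F (min a b)" "T u = v" "f u = 0" and v': "v \<in> F (min a b)"
        using u[OF a] v(1) std_mono[OF F min.cobounded1] std_mono[OF F min.cobounded2] by blast+
      have "T (vsc (z 0) u + vsc (z 1) v) = vsc (z 0) v"
        using u v' v(2) V.subspace_scale[OF FD(1)]
          lin_on_add[OF FD(3)[of "min a b"], of "vsc (z 0) u" "vsc (z 1) v"]
          lin_on_scale[OF FD(3)[of "min a b"]] by simp
      then show ?thesis using model_e[OF z] f u by simp
    qed
  qed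
qed

section \<open>Existence of arc summands\<close>

lemma int_last:
  fixes m b :: int
  assumes "P m" "\<And>n. n > b \<Longrightarrow> \<not> P n"
  shows "\<exists>n. P n \<and> \<not> P (n + 1)"
proof (rule ccontr)
  assume *: "\<nexists>n. P n \<and> \<not> P (n + 1)"
  have "P (m + int k)" for k
  proof (induction k)
    case (Suc k)
    then have "P (m + int k + 1)" using * by blast
    then show ?case by (simp add: algebra_simps)
  qed (use assms(1) in simp)
  from this[of "nat (b - m) + 1"] show False using assms(2) by simp
qed

text \<open>A vector \<open>v\<close> of maximal degree splits off as a one-dimensional summand if it is not in the image
  of \<open>T\<close>. Otherwise it splits off together with a preimage \<open>u\<close> of maximal degree \<open>m\<close>: by
  maximality \<open>v\<close> is not in \<open>T (F (m + 1))\<close>, so some functional separates the two, and this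
  functional defines the projection.\<close>

lemma std_has_retract:
  assumes C2: "C2 (stdmod F T)" and nz: "\<not> is_zero (stdmod F T)"
  obtains \<alpha> where "valid_arc \<alpha>" "retract (arc_mod \<alpha>) (stdmod F T)"
proof -
  note F = C2D(1)[OF C2]
  note FD = stdD[OF F]
  obtain n0 where n0: "\<And>n. F n \<subseteq> F n0" using std_bottom[OF F C2D(3)[OF C2]] by blast
  obtain n1 where n1: "\<And>n. n \<ge> n1 \<Longrightarrow> F n \<subseteq> {0}"
    using C2D(3)[OF C2] unfolding tame_def by auto
  obtain m0 where "\<not> F m0 \<subseteq> {0}"
    using nz V.subspace_0[OF FD(1)] unfolding is_zero_def vzero_eq by auto
  then obtain b where b: "\<not> F b \<subseteq> {0}" "F (b + 1) \<subseteq> {0}"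
    using int_last[of "\<lambda>n. \<not> F n \<subseteq> {0}" m0 n1] n1 by auto
  then obtain v where v: "v \<in> F b" "v \<noteq> 0" by blast
  have top: "n \<le> b" if "w \<in> F n" "w \<noteq> 0" for n w
    using std_mono[OF F, of "b + 1" n w] that b(2) by force
  have Tv: "T v = 0" using FD(2)[OF v(1)] b(2) by blast
  have "\<exists>l. valid l b \<and> retract (model l b) (stdmod F T)"
  proof (cases "v \<in> T ` F n0")
    case False
    obtain f :: "vec \<Rightarrow> complex" where f: "\<And>x y. f (x + y) = f x + f y"
      "\<And>c x. f (vsc c x) = c * f x" "f v = 1" "\<And>s. s \<in> T ` F n0 \<Longrightarrow> f s = 0"
      using ex_functional[OF subspace_image[OF FD(3,1)] False] by blast
    have f0: "f 0 = 0" using f(2)[of 0 0] by simp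
    have "retract (model None b) (stdmod F T)"
    proof (rule retract_model[OF F v(1) Tv _ f(1,2,3)])
      show "n \<le> b" if "w \<in> F n" "f w \<noteq> 0" for n w
        using top that f0 by metis
      show "present None n" if "w \<in> F n" "f (T w) \<noteq> 0" for n w
        using f(4) that n0 by blast
    qed simp_all
    then show ?thesis by (auto simp: valid_def)
  next
    case True
    have *: "v \<notin> T ` F n" if "n > n1" for n
      using n1[of n] lin_on_0[OF FD(3,1)] v(2) that by auto
    have "\<exists>a. v \<in> T ` F a \<and> v \<notin> T ` F (a + 1)"
      by (rule int_last[of _ n0 n1]) (fact True, rule *)
    then obtain a where a: "v \<in> T ` F a" "v \<notin> T ` F (a + 1)" by (elim exE conjE)
    have "v \<in> F (a + 1)" using a(1) FD(2) by blast
    then have ab: "a < b" using top v(2) by fastforce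
    obtain f :: "vec \<Rightarrow> complex" where f: "\<And>x y. f (x + y) = f x + f y"
      "\<And>c x. f (vsc c x) = c * f x" "f v = 1" "\<And>s. s \<in> T ` F (a + 1) \<Longrightarrow> f s = 0"
      using ex_functional[OF subspace_image[OF FD(3,1)] a(2)] by blast
    have f0: "f 0 = 0" using f(2)[of 0 0] by simp
    obtain u' where u': "u' \<in> F a" "T u' = v" using a(1) by blast
    \<comment> \<open>Subtracting a multiple of \<open>v\<close> makes \<open>f\<close> vanish at
      the preimage, as \<open>f v = 1\<close>, and does not change its image, as
      \<open>T v = 0\<close>.\<close>
    define u where "u = u' + vsc (- f u') v"
    have va: "v \<in> F a" using std_mono[OF F _ v(1)] ab by simp
    have "T u = v"
      using u' va Tv unfolding u_def by (simp add: lin_on_add[OF FD(3)[of a]]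
        lin_on_scale[OF FD(3)[of a]] V.subspace_neg[OF FD(1)] lin_on_minus[OF FD(3)[of a]]
        V.subspace_scale[OF FD(1)] lin_on_diff[OF FD(3)[of a] FD(1)[of a]])
    moreover have "u \<in> F a"
      unfolding u_def by (intro V.subspace_add V.subspace_scale FD u' va)
    moreover have "f u = 0" by (simp only: u_def f) simp
    ultimately have u: "u \<in> F a \<and> T u = v \<and> f u = 0" by blast
    have "retract (model (Some a) b) (stdmod F T)"
    proof (rule retract_model[OF F v(1) Tv _ f(1,2,3)])
      show "n \<le> b" if "w \<in> F n" "f w \<noteq> 0" for n w
        using top that f0 by metis
      \<comment> \<open>Past degree \<open>a\<close> the vector \<open>w\<close> lies in
        \<open>F (a + 1)\<close>, on whose image under \<open>T\<close> the functional was chosen to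
        vanish.\<close>
      show "present (Some a) n" if "w \<in> F n" "f (T w) \<noteq> 0" for n w
      proof (rule ccontr)
        assume "\<not> present (Some a) n"
        then have "w \<in> F (a + 1)" using std_mono[OF F _ that(1), of "a + 1"] by simp
        then show False using f(4) that(2) by blast
      qed
    qed (use u in simp)
    then show ?thesis using ab by (auto simp: valid_def)
  qed
  then obtain l where l: "valid l b" "retract (model l b) (stdmod F T)" by blast
  define \<alpha> where "\<alpha> = (case l of None \<Rightarrow> Inf b | Some a \<Rightarrow> Fin a b)"
  have \<alpha>: "lo \<alpha> = l" "hi \<alpha> = b" by (auto simp: \<alpha>_def split: option.split)
  then have "valid_arc \<alpha>" using l valid_lo_hi by simp
  moreover have "retract (arc_mod \<alpha>) (stdmod F T)"
    using retract_trans[OF gm_iso_retract[OF gm_iso_sym[OF model_arc_iso[OF \<open>valid_arc \<alpha>\<close>]]]] l(2) \<alpha>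
    by simp
  ultimately show thesis by (rule that)
qed

lemma has_arc_retract:
  assumes "C2 M" "\<not> is_zero M"
  obtains \<alpha> where "valid_arc \<alpha>" "retract (arc_mod \<alpha>) M"
proof -
  obtain F T where S: "C2 (stdmod F T)" "gm_iso M (stdmod F T)" using std_form[OF assms(1)] .
  have "\<not> is_zero (stdmod F T)"
  proof
    assume z: "is_zero (stdmod F T)"
    obtain f g where f: "hom M (stdmod F T) f" "hom (stdmod F T) M g" "\<And>n v. v \<in> pc M n \<Longrightarrow> g n (f n v) = v"
      using S(2) unfolding gm_iso_def by blast
    have "v = 0" if "v \<in> pc M n" for v n
    proof -
      have "f n v = 0" using homD(1)[OF f(1) that] is_zeroD[OF z] by auto
      then show ?thesis
        using f(3)[OF that] lin_on_0[OF homD(2)[OF f(2)] is_gmodD(1)[OF C2D(1)[OF S(1)]]] by simp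
    qed
    then have "pc M n = {0}" for n
      using V.subspace_0[OF is_gmodD(1)[OF C2D(1)[OF assms(1)]]] by blast
    then show False using assms(2) by (simp add: is_zero_def vzero_eq)
  qed
  from std_has_retract[OF S(1) this] obtain \<alpha> where "valid_arc \<alpha>" "retract (arc_mod \<alpha>) (stdmod F T)" .
  then show thesis
    using that retract_trans[OF _ gm_iso_retract[OF gm_iso_sym[OF S(2)]]] by blast
qed

section \<open>Classification of indecomposables and the exchange property\<close>

lemma not_zero_indec: "indec M \<Longrightarrow> \<not> is_zero M"
  by (simp add: indec_def)

lemma indec_is_arc:
  assumes "C2 M" "indec M"
  obtains \<alpha> where "valid_arc \<alpha>" "gm_iso M (arc_mod \<alpha>)"
proof -
  obtain \<alpha> where \<alpha>: "valid_arc \<alpha>" "retract (arc_mod \<alpha>) M"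
    using has_arc_retract[OF assms(1) not_zero_indec[OF assms(2)]] .
  have "gm_iso (arc_mod \<alpha>) M"
    using retract_indec_iso[OF \<alpha>(2) not_zero_indec[OF indec_arc] assms(2)] \<alpha>(1) C2D(1) C2_arc assms(1)
    by blast
  then show thesis using that[OF \<alpha>(1)] gm_iso_sym by blast
qed

text \<open>The endomorphism ring of a model is local: a degree-preserving endomorphism is a scalar \<open>c\<close> plus a
  multiple of the square-zero map \<open>sh\<close>, and the scalar is read off from the image of \<open>e 0 1\<close>.\<close>

lemma model_endo_unit:
  assumes h: "hom (model l b) (model l b) h" and c: "h b (e 0 1) 1 \<noteq> 0" and lb: "valid l b"
  obtains k where "hom (model l b) (model l b) k" "\<And>n v. v \<in> pc (model l b) n \<Longrightarrow> k n (h n v) = v"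
proof -
  let ?Z = "model l b"
  note Z = C2D(1)[OF C2_model[OF lb]]
  note ZD = is_gmodD[OF Z] and hD = homD[OF h]
  obtain g where g: "\<And>n v. v \<in> pc ?Z n \<Longrightarrow> h n v = g v"
    using hom_const[OF h[unfolded model_def] Z[unfolded model_def]] unfolding model_def by auto
  define c where "c = g (e 0 1) 1"
  have e01: "e 0 1 \<in> pc ?Z b" by (simp add: e_pc)
  have c0: "c \<noteq> 0" using c g[OF e01] by (simp add: c_def)
  have glin: "g (vsc p x + vsc q y) = vsc p (g x) + vsc q (g y)"
    if x: "x \<in> pc ?Z n" and y: "y \<in> pc ?Z n" for p q x y n
  proof -
    have xy: "vsc p x \<in> pc ?Z n" "vsc q y \<in> pc ?Z n"
      using V.subspace_scale[OF ZD(1)] x y by blast+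
    then have "g (vsc p x + vsc q y) = h n (vsc p x + vsc q y)"
      using g V.subspace_add[OF ZD(1)] by metis
    also have "\<dots> = vsc p (h n x) + vsc q (h n y)"
      using lin_on_add[OF hD(2) xy] lin_on_scale[OF hD(2) x] lin_on_scale[OF hD(2) y] by simp
    also have "\<dots> = vsc p (g x) + vsc q (g y)" using g x y by simp
    finally show ?thesis .
  qed
  have gsh: "g (sh x) = sh (g x)" and gin: "g x \<in> pc ?Z n" if "x \<in> pc ?Z n" for x n
  proof -
    have "sh x \<in> pc ?Z (n + 1)" using ZD(2)[OF that] by simp
    then show "g (sh x) = sh (g x)" using hD(3)[OF that] g[OF that] g[of "sh x" "n + 1"] by simp
    show "g x \<in> pc ?Z n" using hD(1)[OF that] g[OF that] by simp
  qed
  have g0: "g 0 = 0" using glin[OF e01 e01, of 0 0] by simp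
  have g1: "g (e 0 1) = e 0 c"
  proof -
    have "sh (g (e 0 1)) = 0" using gsh[OF e01] g0 by (simp add: e_sh e_0)
    moreover have "g (e 0 1) = e (g (e 0 1) 0) c"
      using model_e[OF gin[OF e01]] by (simp add: c_def)
    ultimately have "e 0 (g (e 0 1) 0) = e 0 0" by (metis e_sh e_0)
    then have "g (e 0 1) 0 = 0" by (simp add: e_inject)
    then show ?thesis using \<open>g (e 0 1) = e (g (e 0 1) 0) c\<close> by simp
  qed
  have "\<exists>y. \<forall>n p q. e p q \<in> pc ?Z n \<longrightarrow> g (e p q) = e (c * p) (y * p + c * q)"
  proof (cases l)
    case None
    have "g (e p q) = e (c * p) (0 * p + c * q)" if "e p q \<in> pc ?Z n" for n p q
    proof -
      have "p = 0" using that None by (simp add: e_pc)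
      then have "e p q = vsc q (e 0 1) + vsc 0 (e 0 1)" by (simp add: e_vsc e_0)
      then show ?thesis using glin[OF e01 e01, of q 0] g1 \<open>p = 0\<close> by (simp add: e_vsc mult.commute)
    qed
    then show ?thesis by blast
  next
    case (Some a)
    have e10: "e 1 0 \<in> pc ?Z a" by (simp add: e_pc Some)
    obtain x y where xy: "g (e 1 0) = e x y" using model_e[OF gin[OF e10]] by blast
    have "e 0 x = e 0 c" using gsh[OF e10] g1 xy by (simp add: e_sh)
    then have x: "x = c" by (simp add: e_inject)
    have "g (e p q) = e (c * p) (y * p + c * q)" for p q
    proof -
      have "e 1 0 \<in> pc ?Z (min a b)" "e 0 1 \<in> pc ?Z (min a b)" by (auto simp: e_pc Some)
      from glin[OF this, of p q] show ?thesis
        using g1 xy x by (simp add: e_vsc e_add algebra_simps)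
    qed
    then show ?thesis by blast
  qed
  then obtain y where y: "\<And>n p q. e p q \<in> pc ?Z n \<Longrightarrow> g (e p q) = e (c * p) (y * p + c * q)" by blast
  obtain r where r: "r * c = 1" using c0 by (metis left_inverse)
  \<comment> \<open>\<open>h\<close> acts as \<open>c\<close> plus \<open>y\<close> times
    \<open>sh\<close>; as \<open>sh\<close> squares to zero, the inverse is \<open>r\<close> minus
    \<open>y * r * r\<close> times \<open>sh\<close>, where \<open>r\<close> is the inverse of
    \<open>c\<close>.\<close>
  define k where "k = (\<lambda>(n :: int) v. vsc r v + vsc (- (y * r * r)) (sh v))"
  have "hom ?Z ?Z (\<lambda>n. sh)"
  proof (rule homI)
    fix n v assume "v \<in> pc ?Z n"
    then show "sh v \<in> pc ?Z n" using ZD(2) ZD(4) by fastforce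
  qed (auto simp: lin_on_sh)
  from hom_add_scale[OF hom_id this Z Z] have "hom ?Z ?Z k" unfolding k_def .
  moreover have "k n (h n v) = v" if v: "v \<in> pc ?Z n" for n v
  proof -
    obtain p q where pq: "v = e p q" using model_e[OF v] by blast
    have "h n v = e (c * p) (y * p + c * q)" using g[OF v] y[of p q n] v pq by simp
    moreover have "r * (c * p) + - (y * r * r) * 0 = p"
      "r * (y * p + c * q) + - (y * r * r) * (c * p) = q"
      using r by algebra+
    ultimately show ?thesis
      unfolding pq k_def by (simp only: e_vsc e_add e_sh)
  qed
  ultimately show thesis by (rule that)
qed

text \<open>The endomorphisms of the model that factor through the two summands add up to the
  identity, so one of them has a nonzero coefficient at \<open>e 0 1\<close>. By
  \<open>model_endo_unit\<close> that one has a left inverse, and its two factors exhibit the model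
  as a retract of the summand.\<close>

lemma model_retract_biprod:
  assumes "valid l b" and ret: "retract (model l b) E" and bi: "is_biprod E X Y" and E: "is_gmod E"
  shows "retract (model l b) X \<or> retract (model l b) Y"
proof -
  let ?Z = "model l b"
  obtain i p where i: "hom ?Z E i" and p: "hom E ?Z p" and pi: "\<And>n v. v \<in> pc ?Z n \<Longrightarrow> p n (i n v) = v"
    using ret unfolding retract_def by blast
  obtain i1 i2 p1 p2 where ip: "hom X E i1" "hom Y E i2" "hom E X p1" "hom E Y p2"
    and sum: "\<And>n v. v \<in> pc E n \<Longrightarrow> i1 n (p1 n v) + i2 n (p2 n v) = v"
    using bi unfolding is_biprod_def vadd_eq by blast
  have key: "retract ?Z A" if j: "hom A E j" and q: "hom E A q"
    and ne: "p b (j b (q b (i b (e 0 1)))) 1 \<noteq> 0" for A j q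
  proof -
    note Zq = hom_comp[OF i q] and jp = hom_comp[OF j p]
    obtain k where k: "hom ?Z ?Z k" "\<And>n v. v \<in> pc ?Z n \<Longrightarrow> k n (p n (j n (q n (i n v)))) = v"
      using model_endo_unit[OF hom_comp[OF Zq jp] ne assms(1)] by blast
    show ?thesis
      unfolding retract_def using Zq hom_comp[OF jp k(1)] k(2) by blast
  qed
  have e01: "e 0 1 \<in> pc ?Z b" by (simp add: e_pc)
  let ?w = "i b (e 0 1)"
  have w: "?w \<in> pc E b" using homD(1)[OF i e01] .
  have "i1 b (p1 b ?w) \<in> pc E b" "i2 b (p2 b ?w) \<in> pc E b"
    using homD(1)[OF ip(1) homD(1)[OF ip(3) w]] homD(1)[OF ip(2) homD(1)[OF ip(4) w]] .
  then have "p b (i1 b (p1 b ?w)) + p b (i2 b (p2 b ?w)) = e 0 1"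
    using lin_on_add[OF homD(2)[OF p]] sum[OF w] pi[OF e01] by metis
  then have "p b (i1 b (p1 b ?w)) 1 + p b (i2 b (p2 b ?w)) 1 = 1"
    by (metis One_nat_def e_simps(2) plus_fun_apply)
  then have "p b (i1 b (p1 b ?w)) 1 \<noteq> 0 \<or> p b (i2 b (p2 b ?w)) 1 \<noteq> 0"
    by auto
  then show ?thesis using key[OF ip(1,3)] key[OF ip(2,4)] by blast
qed

section \<open>Extensions between arc modules\<close>

lemma hom_cong:
  assumes f: "hom M N f" and M: "is_gmod M" and fg: "\<And>n v. v \<in> pc M n \<Longrightarrow> f n v = g n v"
  shows "hom M N g"
proof (rule homI)
  note fD = homD[OF f] and MD = is_gmodD[OF M]
  fix n
  show "lin_on (pc M n) (g n)"
  proof (rule lin_onI)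
    show "g n (u + v) = g n u + g n v" if "u \<in> pc M n" "v \<in> pc M n" for u v
      using lin_on_add[OF fD(2) that] fg[OF that(1)] fg[OF that(2)]
        fg[OF V.subspace_add[OF MD(1) that]] by simp
    show "g n (vsc c u) = vsc c (g n u)" if "u \<in> pc M n" for c u
      using lin_on_scale[OF fD(2) that] fg[OF that] fg[OF V.subspace_scale[OF MD(1) that]] by simp
  qed
  fix v assume v: "v \<in> pc M n"
  show "g n v \<in> pc N n" "g (n + 1) (xa M n v) = xa N n (g n v)" "g (n - 1) (ya M n v) = ya N n (g n v)"
    using fD(1,3,4)[OF v] fg[OF v] fg[OF MD(2)[OF v]] fg[OF MD(4)[OF v]] by simp_all
qed

lemma sesD:
  assumes "ses N E M f g"
  shows "hom N E f" "hom E M g" "inj_on (f n) (pc N n)" "g n ` pc E n = pc M n"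
    "f n ` pc N n = {v \<in> pc E n. g n v = 0}"
  using assms by (simp_all add: ses_def vzero_eq)

lemma ses_cong:
  assumes ses: "ses N E M f g" and N: "is_gmod N" and E: "is_gmod E"
    and f: "\<And>n v. v \<in> pc N n \<Longrightarrow> f n v = f' n v" and g: "\<And>n v. v \<in> pc E n \<Longrightarrow> g n v = g' n v"
  shows "ses N E M f' g'"
proof -
  note D = sesD[OF ses]
  have "f' n ` pc N n = f n ` pc N n" "g' n ` pc E n = g n ` pc E n" "inj_on (f' n) (pc N n)"
    "{v \<in> pc E n. g' n v = 0} = {v \<in> pc E n. g n v = 0}" for n
    using f[of _ n] g[of _ n] D(3)[of n] by (auto simp: inj_on_def)
  then show ?thesis
    using hom_cong[OF D(1) N f] hom_cong[OF D(2) E g] D(4,5)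
    unfolding ses_def vzero_eq by metis
qed

lemma nonsplit_ext_iso:
  assumes ext: "nonsplit_ext N E M" and isos: "gm_iso N N'" "gm_iso E E'" "gm_iso M M'"
    and C: "C2 N'" "C2 E'" "C2 M'"
  shows "nonsplit_ext N' E' M'"
proof -
  obtain f g where ses: "ses N E M f g" and ns: "\<not> splits E M g" and CN: "C2 N" and CE: "C2 E" and CM: "C2 M"
    using ext unfolding nonsplit_ext_def by blast
  obtain a a' where a: "hom N N' a" "hom N' N a'" "\<And>n v. v \<in> pc N n \<Longrightarrow> a' n (a n v) = v"
    "\<And>n v. v \<in> pc N' n \<Longrightarrow> a n (a' n v) = v" using isos(1) unfolding gm_iso_def by blast
  obtain b b' where b: "hom E E' b" "hom E' E b'" "\<And>n v. v \<in> pc E n \<Longrightarrow> b' n (b n v) = v"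
    "\<And>n v. v \<in> pc E' n \<Longrightarrow> b n (b' n v) = v" using isos(2) unfolding gm_iso_def by blast
  obtain c c' where c: "hom M M' c" "hom M' M c'" "\<And>n v. v \<in> pc M n \<Longrightarrow> c' n (c n v) = v"
    "\<And>n v. v \<in> pc M' n \<Longrightarrow> c n (c' n v) = v" using isos(3) unfolding gm_iso_def by blast
  note D = sesD[OF ses]
  note m = homD(1)[OF a(1)] homD(1)[OF a(2)] homD(1)[OF b(1)] homD(1)[OF b(2)] homD(1)[OF c(1)]
    homD(1)[OF c(2)] homD(1)[OF D(1)] homD(1)[OF D(2)]
  let ?f = "\<lambda>n v. b n (f n (a' n v))" and ?g = "\<lambda>n v. c n (g n (b' n v))"
  have hf: "hom N' E' ?f" by (intro hom_comp[OF hom_comp[OF a(2) D(1)] b(1)])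
  have hg: "hom E' M' ?g" by (intro hom_comp[OF hom_comp[OF b(2) D(2)] c(1)])
  have c0: "c n 0 = 0" "c' n 0 = 0" for n
    using lin_on_0[OF homD(2)[OF c(1)] is_gmodD(1)[OF C2D(1)[OF CM]]]
      lin_on_0[OF homD(2)[OF c(2)] is_gmodD(1)[OF C2D(1)[OF C(3)]]] by auto
  have "ses N' E' M' ?f ?g"
    unfolding ses_def vzero_eq
  proof (intro conjI allI hf hg)
    fix n
    show "inj_on (?f n) (pc N' n)"
    proof (rule inj_onI)
      fix u v assume uv: "u \<in> pc N' n" "v \<in> pc N' n" "?f n u = ?f n v"
      have "f n (a' n u) = f n (a' n v)"
        using b(3)[OF m(7)[OF m(2)[OF uv(1)]]] b(3)[OF m(7)[OF m(2)[OF uv(2)]]] uv(3) by metis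
      then have "a' n u = a' n v"
        using D(3) m(2)[OF uv(1)] m(2)[OF uv(2)] by (meson inj_onD)
      then show "u = v" using a(4)[OF uv(1)] a(4)[OF uv(2)] by metis
    qed
    show "?g n ` pc E' n = pc M' n"
    proof (intro subset_antisym subsetI)
      fix w assume w: "w \<in> pc M' n"
      then obtain u where u: "u \<in> pc E n" "g n u = c' n w" using D(4) m(6) by (metis imageE)
      then have "?g n (b n u) = w" using b(3) c(4) w by simp
      then show "w \<in> ?g n ` pc E' n" using m(3)[OF u(1)] by (metis imageI)
    qed (use homD(1)[OF hg] in blast)
    show "?f n ` pc N' n = {v \<in> pc E' n. ?g n v = 0}"
    proof (intro subset_antisym subsetI)
      fix v assume "v \<in> ?f n ` pc N' n"
      then obtain w where w: "w \<in> pc N' n" "v = ?f n w" by blast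
      have "f n (a' n w) \<in> {v \<in> pc E n. g n v = 0}" using D(5) m(2)[OF w(1)] by (metis imageI)
      then have "?g n v = 0" using b(3) w(2) c0 by simp
      then show "v \<in> {v \<in> pc E' n. ?g n v = 0}" using homD(1)[OF hf w(1)] w(2) by simp
    next
      fix v assume "v \<in> {v \<in> pc E' n. ?g n v = 0}"
      then have v: "v \<in> pc E' n" "?g n v = 0" by simp_all
      have "g n (b' n v) = 0" using c(3)[OF m(8)[OF m(4)[OF v(1)]]] v(2) c0 by simp
      then obtain w where w: "w \<in> pc N n" "b' n v = f n w" using D(5) m(4)[OF v(1)] by blast
      have "v = ?f n (a n w)" using a(3)[OF w(1)] b(4)[OF v(1)] w(2) by simp
      then show "v \<in> ?f n ` pc N' n" using m(1)[OF w(1)] by (rule image_eqI)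
    qed
  qed
  moreover have "\<not> splits E' M' ?g"
  proof
    assume "splits E' M' ?g"
    then obtain s where s: "hom M' E' s" "\<And>n v. v \<in> pc M' n \<Longrightarrow> ?g n (s n v) = v"
      unfolding splits_def by blast
    have "g n (b' n (s n (c n v))) = v" if v: "v \<in> pc M n" for n v
    proof -
      have "b' n (s n (c n v)) \<in> pc E n" using m(4) homD(1)[OF s(1)] m(5)[OF v] by blast
      from c(3)[OF m(8)[OF this]] s(2)[OF m(5)[OF v]] c(3)[OF v] show ?thesis by simp
    qed
    then have "splits E M g"
      unfolding splits_def using hom_comp[OF hom_comp[OF c(1) s(1)] b(2)] by blast
    then show False using ns by simp
  qed
  ultimately show ?thesis unfolding nonsplit_ext_def using C by blast
qed

lemma almost_compatible_iso:
  assumes "gm_iso M M'" "gm_iso N N'" and C: "C2 M" "C2 N" "C2 M'" "C2 N'"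
  shows "almost_compatible M N \<longleftrightarrow> almost_compatible M' N'"
proof -
  have C2E: "C2 E" if "nonsplit_ext A E B" for A B E
    using that by (simp add: nonsplit_ext_def)
  have "nonsplit_ext M E N \<longleftrightarrow> nonsplit_ext M' E N'" "nonsplit_ext N E M \<longleftrightarrow> nonsplit_ext N' E M'" for E
    using nonsplit_ext_iso[OF _ assms(1) gm_iso_refl assms(2)] nonsplit_ext_iso[OF _ assms(2) gm_iso_refl assms(1)]
      nonsplit_ext_iso[OF _ gm_iso_sym[OF assms(1)] gm_iso_refl gm_iso_sym[OF assms(2)]]
      nonsplit_ext_iso[OF _ gm_iso_sym[OF assms(2)] gm_iso_refl gm_iso_sym[OF assms(1)]] C C2E
    by blast+
  then show ?thesis unfolding almost_compatible_def by simp
qed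

section \<open>Extensions in standard form and criteria for splitting\<close>

lemma ext_std:
  assumes "nonsplit_ext (stdmod G S) E (stdmod H R)"
  obtains F T \<phi> \<gamma> where "C2 (stdmod F T)" "gm_iso E (stdmod F T)"
    "ses (stdmod G S) (stdmod F T) (stdmod H R) (\<lambda>n. \<phi>) (\<lambda>n. \<gamma>)"
    "\<not> splits (stdmod F T) (stdmod H R) (\<lambda>n. \<gamma>)"
proof -
  have C: "C2 (stdmod G S)" "C2 E" "C2 (stdmod H R)"
    using assms by (simp_all add: nonsplit_ext_def)
  obtain F T where FT: "C2 (stdmod F T)" "gm_iso E (stdmod F T)" using std_form[OF C(2)] .
  from nonsplit_ext_iso[OF assms gm_iso_refl FT(2) gm_iso_refl C(1) FT(1) C(3)]
  obtain f g where fg: "ses (stdmod G S) (stdmod F T) (stdmod H R) f g"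
    "\<not> splits (stdmod F T) (stdmod H R) g"
    unfolding nonsplit_ext_def by blast
  obtain \<phi> where \<phi>: "\<And>n v. v \<in> G n \<Longrightarrow> f n v = \<phi> v"
    using hom_const[OF sesD(1)[OF fg(1)] C2D(1)[OF C(1)]] by blast
  obtain \<gamma> where \<gamma>: "\<And>n v. v \<in> F n \<Longrightarrow> g n v = \<gamma> v"
    using hom_const[OF sesD(2)[OF fg(1)] C2D(1)[OF FT(1)]] by blast
  have "ses (stdmod G S) (stdmod F T) (stdmod H R) (\<lambda>n. \<phi>) (\<lambda>n. \<gamma>)"
    using \<phi> \<gamma> by (intro ses_cong[OF fg(1) C2D(1)[OF C(1)] C2D(1)[OF FT(1)]]) simp_all
  moreover have "\<not> splits (stdmod F T) (stdmod H R) (\<lambda>n. \<gamma>)"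
  proof
    assume "splits (stdmod F T) (stdmod H R) (\<lambda>n. \<gamma>)"
    then obtain s where s: "hom (stdmod H R) (stdmod F T) s" "\<forall>n. \<forall>v\<in>H n. \<gamma> (s n v) = v"
      unfolding splits_def by auto
    then have "\<forall>n. \<forall>v\<in>H n. g n (s n v) = v"
      using \<gamma> homD(1)[OF s(1)] by simp
    then show False using fg(2) s(1) unfolding splits_def by auto
  qed
  ultimately show thesis using that FT by blast
qed

lemma ses_stdD:
  assumes "ses (stdmod G S) (stdmod F T) (stdmod H R) (\<lambda>n. \<phi>) (\<lambda>n. \<gamma>)"
  shows "v \<in> G n \<Longrightarrow> \<phi> v \<in> F n" "lin_on (G n) \<phi>" "v \<in> G n \<Longrightarrow> \<phi> (S v) = T (\<phi> v)"
    "v \<in> F n \<Longrightarrow> \<gamma> v \<in> H n" "lin_on (F n) \<gamma>" "v \<in> F n \<Longrightarrow> \<gamma> (T v) = R (\<gamma> v)"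
    "u \<in> G n \<Longrightarrow> v \<in> G n \<Longrightarrow> \<phi> u = \<phi> v \<Longrightarrow> u = v"
    "w \<in> H n \<Longrightarrow> \<exists>v\<in>F n. \<gamma> v = w"
    "v \<in> F n \<Longrightarrow> \<gamma> v = 0 \<Longrightarrow> \<exists>w\<in>G n. v = \<phi> w"
    "v \<in> G n \<Longrightarrow> \<gamma> (\<phi> v) = 0"
proof -
  note D = sesD[OF assms] and fD = homD[OF sesD(1)[OF assms]] and gD = homD[OF sesD(2)[OF assms]]
  show "v \<in> G n \<Longrightarrow> \<phi> v \<in> F n" "lin_on (G n) \<phi>" "v \<in> G n \<Longrightarrow> \<phi> (S v) = T (\<phi> v)"
    using fD(1)[of _ n] fD(2)[of n] fD(3)[of _ n] by simp_all
  show "v \<in> F n \<Longrightarrow> \<gamma> v \<in> H n" "lin_on (F n) \<gamma>" "v \<in> F n \<Longrightarrow> \<gamma> (T v) = R (\<gamma> v)"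
    using gD(1)[of _ n] gD(2)[of n] gD(3)[of _ n] by simp_all
  show "u \<in> G n \<Longrightarrow> v \<in> G n \<Longrightarrow> \<phi> u = \<phi> v \<Longrightarrow> u = v"
    using D(3)[of n] by (simp add: inj_on_def)
  show "w \<in> H n \<Longrightarrow> \<exists>v\<in>F n. \<gamma> v = w"
    using D(4)[of n] by (simp add: set_eq_iff image_iff) metis
  show "v \<in> F n \<Longrightarrow> \<gamma> v = 0 \<Longrightarrow> \<exists>w\<in>G n. v = \<phi> w"
    using D(5)[of n] by (simp add: set_eq_iff image_iff)
  show "v \<in> G n \<Longrightarrow> \<gamma> (\<phi> v) = 0"
    using D(5)[of n] by (simp add: set_eq_iff image_iff) blast
qed

text \<open>Lift the generators \<open>e 1 0\<close> and \<open>e 0 1\<close> to \<open>u\<close> and \<open>v\<close>. The obstruction \<open>T u - v\<close>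
  comes from some \<open>w\<close>; correcting the lifts by \<open>h\<close> and \<open>w + S h\<close> removes it.\<close>

lemma split_fin:
  assumes ab: "a < b" and G: "is_gmod (stdmod G S)" and F: "is_gmod (stdmod F T)"
    and ses: "ses (stdmod G S) (stdmod F T) (model (Some a) b) (\<lambda>n. \<phi>) (\<lambda>n. \<gamma>)"
    and ob: "\<And>w. w \<in> G (a + 1) \<Longrightarrow> S w \<in> G (b + 1) \<Longrightarrow> \<exists>h\<in>G a. w + S h \<in> G b"
  shows "splits (stdmod F T) (model (Some a) b) (\<lambda>n. \<gamma>)"
proof -
  note D = ses_stdD[OF ses[unfolded model_def], folded model_def] and FD = stdD[OF F] and GD = stdD[OF G]
  define H where "H = pc (model (Some a) b)"
  have H: "gr 2 (\<lambda>i. if i = 0 then Some a else Some b) = H" by (simp add: H_def model_def)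
  note D = D[unfolded H]
  have e10: "e 1 0 \<in> H a" and e01: "e 0 1 \<in> H b" by (simp_all add: H_def e_pc)
  obtain u where u: "u \<in> F a" "\<gamma> u = e 1 0" using D(8)[OF e10] by blast
  obtain v where v: "v \<in> F b" "\<gamma> v = e 0 1" using D(8)[OF e01] by blast
  have va: "v \<in> F (a + 1)" using std_mono[OF F _ v(1)] ab by simp
  have Tu: "T u \<in> F (a + 1)" using FD(2)[OF u(1)] .
  have "\<gamma> (T u - v) = 0"
    using lin_on_diff[OF D(5) FD(1) Tu va] D(6)[OF u(1)] u v by (simp add: e_sh)
  then obtain w where w: "w \<in> G (a + 1)" "T u - v = \<phi> w"
    using D(9)[OF V.subspace_diff[OF FD(1) Tu va]] by blast
  \<comment> \<open>There is a second defect: the lift \<open>v\<close> need not be killed by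
    \<open>T\<close>. It is controlled by the first one, since \<open>T\<close> squares to zero:
    this forces \<open>S w = - w'\<close>, and hence the membership in \<open>G (b + 1)\<close> that
    \<open>ob\<close> asks for.\<close>
  have Tv: "T v \<in> F (b + 1)" using FD(2)[OF v(1)] .
  have "\<gamma> (T v) = 0" using D(6)[OF v(1)] v(2) by (simp add: e_sh e_0)
  then obtain w' where w': "w' \<in> G (b + 1)" "T v = \<phi> w'" using D(9)[OF Tv] by blast
  have "T (T u - v) = - T v"
    using lin_on_diff[OF FD(3,1) Tu va] FD(5)[OF u(1)] by simp
  then have "\<phi> (S w) = - \<phi> w'" using D(3)[OF w(1)] w(2) w'(2) by simp
  then have "\<phi> (S w) = \<phi> (- w')" using lin_on_minus[OF D(2) w'(1)] by simp
  moreover have "S w \<in> G (a + 1 + 1)" "- w' \<in> G (a + 1 + 1)"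
    using GD(2)[OF w(1)] V.subspace_neg[OF GD(1)] std_mono[OF G _ w'(1), of "a + 1 + 1"] ab by simp_all
  ultimately have "S w = - w'" using D(7) by blast
  then have "S w \<in> G (b + 1)" using V.subspace_neg[OF GD(1) w'(1)] by simp
  with ob w(1) obtain h where h: "h \<in> G a" "w + S h \<in> G b" by blast
  define u' where "u' = u + \<phi> h"
  define v' where "v' = v + \<phi> (w + S h)"
  have u'F: "u' \<in> F a" unfolding u'_def by (intro V.subspace_add FD u D h)
  have v'F: "v' \<in> F b" unfolding v'_def by (intro V.subspace_add FD v D h)
  have "T u' = T u + \<phi> (S h)"
    using lin_on_add[OF FD(3) u(1) D(1)[OF h(1)]] D(3)[OF h(1)] by (simp add: u'_def)
  also have "\<dots> = v + (\<phi> w + \<phi> (S h))" using w(2) by (simp add: algebra_simps)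
  also have "\<dots> = v'"
    using lin_on_add[OF D(2) w(1) GD(2)[OF h(1)]] by (simp add: v'_def)
  finally have Tu': "T u' = v'" .
  have "\<gamma> u' = e 1 0" "\<gamma> v' = e 0 1"
    using lin_on_add[OF D(5) u(1) D(1)[OF h(1)]] lin_on_add[OF D(5) v(1) D(1)[OF h(2)]]
      D(10)[OF h(1)] D(10)[OF h(2)] u v by (simp_all add: u'_def v'_def)
  note g' = this
  have hom: "hom (model (Some a) b) (stdmod F T) (\<lambda>n z. vsc (z 0) u' + vsc (z 1) v')"
    using u'F Tu' FD(5)[OF u'F] by (intro hom_from_model[OF F v'F]) auto
  have "\<gamma> (vsc (z 0) u' + vsc (z 1) v') = z" if z: "z \<in> H n" for z n
  proof -
    have v'a: "v' \<in> F a" using std_mono[OF F _ v'F] ab by simp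
    have "\<gamma> (vsc (z 0) u' + vsc (z 1) v') = vsc (z 0) (\<gamma> u') + vsc (z 1) (\<gamma> v')"
      using lin_on_add[OF D(5) V.subspace_scale[OF FD(1) u'F] V.subspace_scale[OF FD(1) v'a]]
        lin_on_scale[OF D(5) u'F] lin_on_scale[OF D(5) v'a] by simp
    also have "\<dots> = z" using model_e[OF z[unfolded H_def]] g' by (simp add: e_vsc e_add)
    finally show ?thesis .
  qed
  then show ?thesis unfolding splits_def H_def using hom by blast
qed

text \<open>Changing the lift \<open>v\<close> by the image of \<open>h\<close> changes the
  obstruction \<open>w\<close> by \<open>S h\<close>. With \<open>inf_ext\<close>, the extension is
  thus governed by the kernel of \<open>S\<close> in \<open>G (b + 1)\<close> modulo
  \<open>S (G b)\<close>.\<close>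

lemma split_inf:
  assumes G: "is_gmod (stdmod G S)" and F: "is_gmod (stdmod F T)"
    and ses: "ses (stdmod G S) (stdmod F T) (model None b) (\<lambda>n. \<phi>) (\<lambda>n. \<gamma>)"
    and v: "v \<in> F b" "\<gamma> v = e 0 1" and w: "w \<in> G (b + 1)" "T v = \<phi> w"
    and h: "h \<in> G b" "w + S h = 0"
  shows "splits (stdmod F T) (model None b) (\<lambda>n. \<gamma>)"
proof -
  define H where "H = pc (model None b)"
  have H: "gr 2 (\<lambda>i. if i = 0 then None else Some b) = H" by (simp add: H_def model_def)
  note D = ses_stdD[OF ses[unfolded model_def], folded model_def, unfolded H]
    and FD = stdD[OF F] and GD = stdD[OF G]
  define v' where "v' = v + \<phi> h"
  have v'F: "v' \<in> F b" unfolding v'_def by (intro V.subspace_add FD v D h)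
  have "T v' = \<phi> w + \<phi> (S h)"
    using lin_on_add[OF FD(3) v(1) D(1)[OF h(1)]] D(3)[OF h(1)] w(2) by (simp add: v'_def)
  also have "\<dots> = 0"
    using lin_on_add[OF D(2) w(1) GD(2)[OF h(1)]] h(2) lin_on_0[OF D(2) GD(1)] by simp
  finally have Tv': "T v' = 0" .
  have g': "\<gamma> v' = e 0 1"
    using lin_on_add[OF D(5) v(1) D(1)[OF h(1)]] D(10)[OF h(1)] v by (simp add: v'_def)
  have hom: "hom (model None b) (stdmod F T) (\<lambda>n z. vsc (z 0) 0 + vsc (z 1) v')"
    using Tv' by (intro hom_from_model[OF F v'F]) auto
  have "\<gamma> (vsc (z 0) 0 + vsc (z 1) v') = z" if z: "z \<in> H n" for z n
  proof -
    have "z 0 = 0" using z by (auto simp: H_def pc_model)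
    then show ?thesis
      using lin_on_scale[OF D(5) v'F] model_e[OF z[unfolded H_def]] g' by (simp add: e_vsc e_add)
  qed
  then show ?thesis unfolding splits_def H_def using hom by blast
qed

text \<open>The generator of the quotient is killed by \<open>x\<close>, so \<open>T v\<close> comes
  from \<open>G\<close>; that \<open>S w = 0\<close> reflects that \<open>T\<close> squares to
  zero.\<close>

lemma inf_ext:
  assumes G: "is_gmod (stdmod G S)" and F: "is_gmod (stdmod F T)"
    and ses: "ses (stdmod G S) (stdmod F T) (model None b) (\<lambda>n. \<phi>) (\<lambda>n. \<gamma>)"
  obtains v w where "v \<in> F b" "\<gamma> v = e 0 1" "w \<in> G (b + 1)" "T v = \<phi> w" "S w = 0"
proof -
  define H where "H = pc (model None b)"
  have H: "gr 2 (\<lambda>i. if i = 0 then None else Some b) = H" by (simp add: H_def model_def)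
  note D = ses_stdD[OF ses[unfolded model_def], folded model_def, unfolded H]
    and FD = stdD[OF F] and GD = stdD[OF G]
  have e01: "e 0 1 \<in> H b" by (simp add: H_def e_pc)
  obtain v where v: "v \<in> F b" "\<gamma> v = e 0 1" using D(8)[OF e01] by blast
  have "\<gamma> (T v) = 0" using D(6)[OF v(1)] v(2) by (simp add: e_sh e_0)
  then obtain w where w: "w \<in> G (b + 1)" "T v = \<phi> w" using D(9)[OF FD(2)[OF v(1)]] by blast
  have "\<phi> (S w) = \<phi> 0"
    using D(3)[OF w(1)] w(2) FD(5)[OF v(1)] lin_on_0[OF D(2) GD(1)] by simp
  then have "S w = 0" using D(7)[OF GD(2)[OF w(1)] V.subspace_0[OF GD(1)]] by simp
  then show thesis using that v w by blast
qed

section \<open>Extensions and crossings of arcs\<close>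

definition arc_model :: "arc \<Rightarrow> gmod" where
  "arc_model \<alpha> = model (lo \<alpha>) (hi \<alpha>)"

text \<open>The obstruction of \<open>split_fin\<close> is removed as follows, with
  \<open>d = hi \<beta>\<close>. If \<open>b \<le> d\<close>, a nonzero coordinate 0 of
  \<open>w\<close> must survive to degree \<open>b\<close>, as otherwise the left end of
  \<open>\<beta>\<close> would lie strictly between \<open>a\<close> and \<open>b\<close> and the
  arcs would cross; so \<open>h = 0\<close> works. If \<open>d < b\<close>, only coordinate 1 is
  left, and non-crossing puts \<open>e (- q) 0\<close> into degree \<open>a\<close>, where its image
  under \<open>sh\<close> cancels \<open>w\<close>.\<close>

lemma fin_ext_splits:
  assumes ab: "a < b" and \<beta>: "valid_arc \<beta>" and nc: "\<not> crosses \<beta> (Fin a b)"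
  shows "\<not> nonsplit_ext (arc_model \<beta>) E (arc_model (Fin a b))"
proof
  define l d where "l = lo \<beta>" and "d = hi \<beta>"
  define G where "G = (\<lambda>n. pc (model l d) n)"
  have N: "model l d = stdmod G sh" by (simp add: G_def model_def)
  define H where "H = (\<lambda>n. pc (model (Some a) b) n)"
  have M: "model (Some a) b = stdmod H sh" by (simp add: H_def model_def)
  assume "nonsplit_ext (arc_model \<beta>) E (arc_model (Fin a b))"
  then have "nonsplit_ext (stdmod G sh) E (stdmod H sh)"
    by (simp add: arc_model_def flip: l_def d_def N M)
  then obtain F T \<phi> \<gamma> where FT: "C2 (stdmod F T)"
    "ses (stdmod G sh) (stdmod F T) (stdmod H sh) (\<lambda>n. \<phi>) (\<lambda>n. \<gamma>)"
    "\<not> splits (stdmod F T) (stdmod H sh) (\<lambda>n. \<gamma>)" by (rule ext_std)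
  have "is_gmod (stdmod G sh)"
    using C2D(1)[OF C2_model[of l d]] \<beta> valid_lo_hi N by (simp add: l_def d_def)
  moreover have "\<exists>h\<in>G a. w + sh h \<in> G b" if w: "w \<in> G (a + 1)" "sh w \<in> G (b + 1)" for w
  proof -
    obtain p q where pq: "w = e p q" using model_e w(1) unfolding G_def by blast
    have p: "p \<noteq> 0 \<longrightarrow> present l (a + 1) \<and> b + 1 \<le> d" and q: "q \<noteq> 0 \<longrightarrow> a + 1 \<le> d"
      using w by (auto simp: G_def pq e_pc e_sh)
    show ?thesis
    proof (cases "b \<le> d")
      case True
      then have "w + sh 0 \<in> G b"
        using p nc ab by (cases \<beta>) (auto simp: G_def pq e_sh e_add e_pc l_def d_def simp flip: e_0)
      moreover have "0 \<in> G a" by (simp add: G_def e_pc flip: e_0)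
      ultimately show ?thesis by blast
    next
      case False
      then have "p = 0" using p by auto
      then have "w + sh (e (- q) 0) \<in> G b"
        by (simp add: G_def pq e_sh e_add e_pc)
      moreover have "e (- q) 0 \<in> G a"
        using False q nc ab by (cases \<beta>) (auto simp: G_def e_pc l_def d_def)
      ultimately show ?thesis by blast
    qed
  qed
  ultimately show False
    using split_fin[OF ab _ C2D(1)[OF FT(1)] FT(2)[folded M]] FT(3)[folded M] by blast
qed

text \<open>Non-splitting forces \<open>w = e 0 q\<close> with \<open>q \<noteq> 0\<close>, hence
  \<open>b < d\<close>. A finite \<open>\<beta>\<close> not crossing \<open>Inf b\<close> would
  contain a preimage of \<open>w\<close> in degree \<open>b\<close>, so \<open>\<beta>\<close> is
  infinite, and the relation \<open>T v = q s\<close> joins two blocks of size one into a block of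
  size two.\<close>

lemma inf_ext_indec:
  assumes \<beta>: "valid_arc \<beta>" and nc: "\<not> crosses \<beta> (Inf b)"
    and ext: "nonsplit_ext (arc_model \<beta>) E (arc_model (Inf b))"
  shows "indec E"
proof -
  define l d where "l = lo \<beta>" and "d = hi \<beta>"
  define G where "G = (\<lambda>n. pc (model l d) n)"
  have N: "model l d = stdmod G sh" by (simp add: G_def model_def)
  define H where "H = (\<lambda>n. pc (model None b) n)"
  have M: "model None b = stdmod H sh" by (simp add: H_def model_def)
  have "nonsplit_ext (stdmod G sh) E (stdmod H sh)"
    using ext by (simp add: arc_model_def flip: l_def d_def N M)
  then obtain F T \<phi> \<gamma> where FT: "C2 (stdmod F T)" "gm_iso E (stdmod F T)"
    and ses: "ses (stdmod G sh) (stdmod F T) (stdmod H sh) (\<lambda>n. \<phi>) (\<lambda>n. \<gamma>)"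
    and ns: "\<not> splits (stdmod F T) (stdmod H sh) (\<lambda>n. \<gamma>)" by (rule ext_std)
  have G: "is_gmod (stdmod G sh)"
    using C2D(1)[OF C2_model[of l d]] \<beta> valid_lo_hi N by (simp add: l_def d_def)
  note F = C2D(1)[OF FT(1)]
  note D = ses_stdD[OF ses] and FD = stdD[OF F] and GD = stdD[OF G]
  obtain v w where v: "v \<in> F b" "\<gamma> v = e 0 1" and w: "w \<in> G (b + 1)" "T v = \<phi> w" "sh w = 0"
    using inf_ext[OF G F ses[folded M]] by blast
  have nh: "w + sh h \<noteq> 0" if "h \<in> G b" for h
    using split_inf[OF G F ses[folded M] v w(1,2) that] ns[folded M] by blast
  obtain q where wq: "w = e 0 q"
  proof -
    obtain p q where "w = e p q" using model_e w(1) unfolding G_def by blast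
    then show thesis using that w(3) by (simp add: e_sh e_inject flip: e_0)
  qed
  have z: "0 \<in> G b" by (rule V.subspace_0[OF GD(1)])
  have q0: "q \<noteq> 0"
    using nh[OF z] wq by (auto simp: e_sh e_add simp flip: e_0)
  then have bd: "b + 1 \<le> d" using w(1) wq by (simp add: G_def e_pc)
  have "\<beta> = Inf d"
  proof (cases \<beta>)
    case (Fin c d')
    then have "b \<le> c" using nc bd by (simp add: d_def)
    then have "e (- q) 0 \<in> G b" using Fin by (simp add: G_def e_pc l_def)
    from nh[OF this] show ?thesis using wq by (simp add: e_sh e_add e_0)
  qed (simp add: d_def)
  then have l: "l = None" by (simp add: l_def)
  define s where "s = \<phi> (e 0 1)"
  have e01: "e 0 1 \<in> G d" by (simp add: G_def e_pc)
  have \<phi>s: "\<phi> (e 0 r) = vsc r s" for r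
    using lin_on_scale[OF D(2) e01, of r] by (simp add: s_def e_vsc)
  have Ts: "T s = 0"
    using D(3)[OF e01] lin_on_0[OF D(2) GD(1)] by (simp add: s_def e_sh e_0)
  have sF: "s \<in> F d" unfolding s_def by (rule D(1)[OF e01])
  have "indec (stdmod F T)"
  proof (rule indec_essential[of s F d T, OF _ sF])
    show "s \<noteq> 0"
    proof
      assume "s = 0"
      then have "\<phi> (e 0 1) = \<phi> 0" using lin_on_0[OF D(2) GD(1)] by (simp add: s_def)
      then have "e 0 1 = 0" using D(7)[OF e01 V.subspace_0[OF GD(1)]] by blast
      then show False by (simp add: e_inject flip: e_0)
    qed
    fix U n u assume U: "gsub (stdmod F T) U" and u: "u \<in> U n" "u \<noteq> 0"
    note UD = gsubD[OF U]
    have uF: "u \<in> F n" using UD(1) u(1) by auto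
    have "\<gamma> u \<in> pc (model None b) n" using D(4)[OF uF] by (simp add: H_def)
    then obtain c where c: "\<gamma> u = e 0 c"
      using model_e[of "\<gamma> u" None b n] by (auto simp: pc_model)
    define m where "m = min n b"
    have um: "u \<in> F m" and vm: "v \<in> F m"
      using std_mono[OF F _ uF, of m] std_mono[OF F _ v(1), of m] by (simp_all add: m_def)
    have cv: "vsc c v \<in> F m" by (rule V.subspace_scale[OF FD(1) vm])
    have "\<gamma> (u - vsc c v) = 0"
      using lin_on_diff[OF D(5) FD(1) um cv] lin_on_scale[OF D(5) vm] c v(2) by (simp add: e_vsc)
    then obtain x where x: "x \<in> G m" "u - vsc c v = \<phi> x"
      using D(9)[OF V.subspace_diff[OF FD(1) um cv]] by blast
    obtain r where r: "x = e 0 r"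
      using model_e[of x l d m] x(1) l by (auto simp: G_def pc_model)
    \<comment> \<open>Every vector of the middle term has this form, so a nonzero submodule reaches
      \<open>s\<close>: by rescaling if \<open>c = 0\<close>, and after applying \<open>T\<close>
      otherwise.\<close>
    have ur: "u = vsc c v + vsc r s" using x(2) r \<phi>s by (simp add: algebra_simps)
    show "\<exists>k. s \<in> U k"
    proof (cases "c = 0")
      case True
      then have "u = vsc r s" using ur by simp
      moreover from this have "r \<noteq> 0" using u(2) by auto
      ultimately have "vsc (1 / r) u = s" by simp
      then show ?thesis using V.subspace_scale[OF UD(2) u(1)] by metis
    next
      case False
      have "vsc r s \<in> F (min m d)" "vsc c v \<in> F (min m d)"
        using V.subspace_scale[OF FD(1)] std_mono[OF F _ sF, of "min m d"]
          std_mono[OF F _ vm, of "min m d"] by simp_all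
      then have "T u = T (vsc c v) + T (vsc r s)"
        using lin_on_add[OF FD(3)] ur by simp
      also have "\<dots> = vsc c (T v)"
        using lin_on_scale[OF FD(3) vm] lin_on_scale[OF FD(3) sF] Ts by simp
      also have "\<dots> = vsc (c * q) s" using w(2) wq \<phi>s by simp
      finally have "vsc (1 / (c * q)) (T u) = s" using False q0 by simp
      moreover have "T u \<in> U (n + 1)" using UD(3)[OF u(1)] by simp
      ultimately show ?thesis using V.subspace_scale[OF UD(2)] by metis
    qed
  qed
  moreover have "is_gmod E" using ext C2D(1) by (simp add: nonsplit_ext_def)
  ultimately show ?thesis
    using indec_gm_iso[OF gm_iso_sym[OF FT(2)] F] by blast
qed

text \<open>Mayer--Vietoris: with \<open>X\<close> and \<open>Y\<close> the models of \<open>(l, d)\<close> and \<open>(c, b)\<close> inside a common ambient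
  space, this is \<open>0 \<rightarrow> X \<inter> Y \<rightarrow> X \<oplus> Y \<rightarrow> X + Y \<rightarrow> 0\<close>. Coordinates 0 and 1 of the middle term
  belong to \<open>X\<close>, coordinates 2 and 3 to \<open>Y\<close>.\<close>

lemma crossing_ext:
  assumes cb: "c < b" and bd: "b < d" and l: "\<And>a. l = Some a \<Longrightarrow> a < c"
  obtains E where "nonsplit_ext (model l b) E (model (Some c) d)" "\<not> indec E"
proof -
  \<comment> \<open>These are the degrees of \<open>X\<close>, namely \<open>l\<close> and
    \<open>d\<close>, followed by those of \<open>Y\<close>, namely \<open>c\<close> and
    \<open>b\<close>. As \<open>l < c\<close> and \<open>b < d\<close>, the intersection is the
    model of \<open>(l, b)\<close> and the sum is that of \<open>(c, d)\<close>.\<close>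
  define dd where "dd = (\<lambda>i :: nat. if i = 0 then l else if i = 1 then Some d else if i = 2 then Some c else Some b)"
  let ?E = "stdmod (gr 4 dd) sh"
  let ?M = "model (Some c) d" and ?N = "model l b"
  have less4: "i < 4 \<longleftrightarrow> i = 0 \<or> i = 1 \<or> i = 2 \<or> i = 3" for i :: nat by auto
  have E: "v \<in> gr 4 dd n \<longleftrightarrow> (v 0 \<noteq> 0 \<longrightarrow> present l n) \<and> (v 1 \<noteq> 0 \<longrightarrow> n \<le> d) \<and>
      (v 2 \<noteq> 0 \<longrightarrow> n \<le> c) \<and> (v 3 \<noteq> 0 \<longrightarrow> n \<le> b) \<and> (\<forall>i\<ge>4. v i = 0)" for v n
    by (simp add: gr_def less4 dd_def all_conj_distrib imp_disjL conj_assoc)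
  have lc: "n < c" if "present l n" for n using that l by (cases l) auto
  have C2E: "C2 ?E"
  proof (rule C2_gr)
    fix i n assume "i < 4" "even i" "present (dd i) n"
    then consider "i = 0" "present l n" | "i = 2" "n \<le> c" by (auto simp: less4 dd_def)
    then show "present (dd (Suc i)) (n + 1)"
      using lc[of n] cb bd by cases (auto simp: dd_def)
  qed simp
  note Eg = C2D(1)[OF C2E]
  have C2N: "C2 ?N" and C2M: "C2 ?M"
    using cb bd l by (auto intro!: C2_model simp: valid_def)
  define f where "f = (\<lambda>z :: vec. (\<lambda>i. if i < 4 then z (i mod 2) else 0) :: vec)"
  define g where "g = (\<lambda>v :: vec. e (v 0 - v 2) (v 1 - v 3))"
  have f_simps: "f z 0 = z 0" "f z (Suc 0) = z 1" "f z 1 = z 1" "f z 2 = z 0" "f z 3 = z 1"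
    "i \<ge> 4 \<Longrightarrow> f z i = 0" for z i
    by (auto simp: f_def)
  have sh_simps: "sh v 0 = 0" "sh v 1 = v 0" "sh v (Suc 0) = v 0" "sh v 2 = 0" "sh v 3 = v 2" for v
    by (simp_all add: sh_def)
  have eq4: "u = v" if "u 0 = v 0" "u 1 = v 1" "u 2 = v 2" "u 3 = v 3" "\<And>i. i \<ge> 4 \<Longrightarrow> u i = v i"
    for u v :: vec
  proof
    fix i show "u i = v i" using that less4[of i] by (cases "i < 4") auto
  qed
  have hf: "hom ?N ?E (\<lambda>n. f)"
  proof (rule homI)
    fix n
    show "lin_on (pc ?N n) f" by (rule lin_onI) (auto simp: f_def)
    fix z assume z: "z \<in> pc ?N n"
    show "f z \<in> pc ?E n" using z lc[of n] cb bd by (auto simp: pc_model E f_simps)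
    have "sh (f z) i = 0" if i: "i \<ge> 4" for i
    proof (cases "odd i")
      case True
      then have "i - 1 \<ge> 4" using i by (cases "i = 4") auto
      then show ?thesis by (simp add: sh_def f_simps)
    qed (simp add: sh_def)
    then have "f (sh z) = sh (f z)"
      by (intro eq4) (simp_all add: f_simps sh_simps)
    then show "f (xa ?N n z) = xa ?E n (f z)" by simp
  qed simp
  have hg: "hom ?E ?M (\<lambda>n. g)"
  proof (rule homI)
    fix n
    show "lin_on (pc ?E n) g" by (rule lin_onI) (auto simp: g_def e_add e_vsc algebra_simps)
    fix v assume v: "v \<in> pc ?E n"
    then show "g v \<in> pc ?M n" using lc[of n] cb bd by (auto simp: g_def e_pc E)
    show "g (xa ?E n v) = xa ?M n (g v)" by (simp add: g_def e_sh sh_simps)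
  qed simp
  have "ses ?N ?E ?M (\<lambda>n. f) (\<lambda>n. g)"
    unfolding ses_def vzero_eq
  proof (intro conjI allI hf hg)
    fix n
    show "inj_on f (pc ?N n)"
    proof (rule inj_onI)
      fix u v assume uv: "u \<in> pc ?N n" "v \<in> pc ?N n" and eq: "f u = f v"
      have "f u 0 = f v 0" "f u 1 = f v 1" using eq by simp_all
      then show "u = v" using model_e[OF uv(1)] model_e[OF uv(2)] by (simp add: f_simps)
    qed
    show "g ` pc ?E n = pc ?M n"
    proof (intro subset_antisym subsetI)
      fix w assume w: "w \<in> pc ?M n"
      \<comment> \<open>In each coordinate the summand that reaches the higher degree supplies the
        preimage: \<open>X\<close> for coordinate 1 and \<open>Y\<close>, with a sign, for
        coordinate 0.\<close>
      let ?v = "\<lambda>i :: nat. if i = 1 then w 1 else if i = 2 then - w 0 else 0"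
      have "w = g ?v" using model_e[OF w] by (simp add: g_def)
      moreover have "?v \<in> pc ?E n" using w by (auto simp: E pc_model)
      ultimately show "w \<in> g ` pc ?E n" by (rule image_eqI)
    qed (use homD(1)[OF hg] in blast)
    show "f ` pc ?N n = {v \<in> pc ?E n. g v = 0}"
    proof (intro subset_antisym subsetI)
      fix v assume "v \<in> f ` pc ?N n"
      then obtain z where "z \<in> pc ?N n" "v = f z" by blast
      then show "v \<in> {v \<in> pc ?E n. g v = 0}"
        using homD(1)[OF hf] by (simp add: g_def f_simps e_0)
    next
      fix v assume "v \<in> {v \<in> pc ?E n. g v = 0}"
      then have v: "v \<in> gr 4 dd n" and "g v = 0" by simp_all
      then have v02: "v 0 = v 2" "v 1 = v 3" by (simp_all add: g_def e_inject flip: e_0)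
      have "v = f (e (v 0) (v 1))"
        by (rule eq4) (use v v02 in \<open>auto simp: f_simps E\<close>)
      moreover have "e (v 0) (v 1) \<in> pc ?N n"
        using v v02 by (auto simp: E e_pc)
      ultimately show "v \<in> f ` pc ?N n" by (rule image_eqI)
    qed
  qed
  moreover have "\<not> splits ?E ?M (\<lambda>n. g)"
  proof
    assume "splits ?E ?M (\<lambda>n. g)"
    then obtain s where s: "hom ?M ?E s" "\<And>n v. v \<in> pc ?M n \<Longrightarrow> g (s n v) = v"
      unfolding splits_def by blast
    obtain t where t: "\<And>n v. v \<in> pc ?M n \<Longrightarrow> s n v = t v"
      using hom_const[OF s(1)[unfolded model_def] C2D(1)[OF C2M, unfolded model_def]]
      unfolding model_def by auto
    have e10: "e 1 0 \<in> pc ?M c" and e01: "e 0 1 \<in> pc ?M d" by (simp_all add: e_pc)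
    have "sh (e 1 0) \<in> pc ?M (c + 1)" using cb bd by (simp add: e_sh e_pc)
    then have shift: "t (e 0 1) = sh (t (e 1 0))"
      using homD(3)[OF s(1) e10] t[OF e10] t[of "sh (e 1 0)" "c + 1"] by (simp add: e_sh)
    have t1: "t (e 1 0) \<in> gr 4 dd c" using homD(1)[OF s(1) e10] t[OF e10] by simp
    have t2: "t (e 0 1) \<in> gr 4 dd d" using homD(1)[OF s(1) e01] t[OF e01] by simp
    have "g (t (e 1 0)) = e 1 0" using s(2)[OF e10] t[OF e10] by simp
    \<comment> \<open>The difference cannot be 1. In degree \<open>c\<close> coordinate 0 is absent
      because \<open>l < c\<close>, and coordinate 2 equals coordinate 3 of the shifted lift, which
      lies in degree \<open>d > b\<close> and so vanishes.\<close>
    then have "t (e 1 0) 0 - t (e 1 0) 2 = 1" by (simp add: g_def e_inject)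
    moreover have "t (e 1 0) 0 = 0" using t1 lc[of c] by (auto simp: E)
    moreover have "t (e 1 0) 2 = t (e 0 1) 3" using shift by (simp add: sh_simps)
    moreover have "t (e 0 1) 3 = 0" using t2 bd by (auto simp: E)
    ultimately show False by simp
  qed
  ultimately have "nonsplit_ext ?N ?E ?M"
    unfolding nonsplit_ext_def using C2N C2E C2M by blast
  moreover have "\<not> indec ?E"
  proof -
    define U where "U = (\<lambda>n. {v \<in> gr 4 dd n. v 2 = 0 \<and> v 3 = 0})"
    define W where "W = (\<lambda>n. {v \<in> gr 4 dd n. v 0 = 0 \<and> v 1 = 0})"
    note ED = stdD[OF Eg]
    have U: "gsub ?E U"
    proof (rule gsubI)
      show "V.subspace (U n)" for n
        using ED(1)[of n] by (auto simp: U_def V.subspace_def)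
    qed (use ED(2,4) in \<open>auto simp: U_def sh_simps\<close>)
    have W: "gsub ?E W"
    proof (rule gsubI)
      show "V.subspace (W n)" for n
        using ED(1)[of n] by (auto simp: W_def V.subspace_def)
    qed (use ED(2,4) in \<open>auto simp: W_def sh_simps\<close>)
    have "(\<lambda>i. if i = 1 then 1 else 0) \<in> U d" "(\<lambda>i. if i = 3 then 1 else 0) \<in> W b"
      by (auto simp: U_def W_def E)
    moreover have "(\<lambda>i. if i = k then 1 else 0) \<noteq> (0 :: vec)" for k :: nat
    proof
      assume "(\<lambda>i. if i = k then 1 else 0) = (0 :: vec)"
      from fun_cong[OF this, of k] show False by simp
    qed
    ultimately have "U d \<noteq> {0}" "W b \<noteq> {0}" by auto
    then have Un: "\<exists>n. U n \<noteq> {0}" and Wn: "\<exists>n. W n \<noteq> {0}" by blast+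
    have int: "U n \<inter> W n = {0}" for n
    proof (intro subset_antisym subsetI)
      fix v assume "v \<in> U n \<inter> W n"
      then have "v = 0" by (intro eq4) (auto simp: U_def W_def E)
      then show "v \<in> {0}" by simp
    qed (use V.subspace_0[OF gsubD(2)[OF U]] V.subspace_0[OF gsubD(2)[OF W]] in auto)
    have sum: "{u + w |u w. u \<in> U n \<and> w \<in> W n} = pc ?E n" for n
    proof (intro subset_antisym subsetI)
      fix v assume "v \<in> {u + w |u w. u \<in> U n \<and> w \<in> W n}"
      then obtain u w where uw: "v = u + w" "u \<in> U n" "w \<in> W n" by blast
      then show "v \<in> pc ?E n"
        using V.subspace_add[OF ED(1)[of n]] by (simp add: U_def W_def)
    next
      fix v assume v: "v \<in> pc ?E n"
      let ?u = "\<lambda>i :: nat. if i < 2 then v i else 0" and ?w = "\<lambda>i :: nat. if i < 2 then 0 else v i"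
      have "v = ?u + ?w" by (rule ext) simp
      moreover have "?u \<in> U n" "?w \<in> W n" using v by (auto simp: U_def W_def E)
      ultimately show "v \<in> {u + w |u w. u \<in> U n \<and> w \<in> W n}" by blast
    qed
    have "\<exists>U W. gsub ?E U \<and> gsub ?E W \<and> (\<exists>n. U n \<noteq> {0}) \<and> (\<exists>n. W n \<noteq> {0}) \<and>
        (\<forall>n. U n \<inter> W n = {0} \<and> {u + w |u w. u \<in> U n \<and> w \<in> W n} = pc ?E n)"
      by (rule exI[of _ U], rule exI[of _ W]) (intro conjI allI U W Un Wn int sum)
    then show ?thesis unfolding indec_def vzero_eq vadd_eq by blast
  qed
  ultimately show thesis by (rule that)
qed

lemma crosses_sym: "crosses \<alpha> \<beta> \<longleftrightarrow> crosses \<beta> \<alpha>"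
  by (cases \<alpha>; cases \<beta>) auto

text \<open>For non-crossing arcs the second alternative of \<open>almost_compatible\<close> holds,
  vacuously where there are no extensions. For crossing arcs one extension with decomposable middle
  term refutes both alternatives; the arc that starts further left is the submodule.\<close>

lemma compatible_iff:
  assumes \<alpha>: "valid_arc \<alpha>" and \<beta>: "valid_arc \<beta>"
  shows "almost_compatible (arc_mod \<alpha>) (arc_mod \<beta>) \<longleftrightarrow> \<not> crosses \<alpha> \<beta>"
proof -
  have C2m: "C2 (arc_model \<gamma>)" if "valid_arc \<gamma>" for \<gamma>
    using that C2_model valid_lo_hi by (simp add: arc_model_def)
  have iso: "gm_iso (arc_model \<gamma>) (arc_mod \<gamma>)" if "valid_arc \<gamma>" for \<gamma>
    using model_arc_iso[OF that] by (simp add: arc_model_def)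
  have "almost_compatible (arc_model \<alpha>) (arc_model \<beta>) \<longleftrightarrow> \<not> crosses \<alpha> \<beta>"
  proof
    have indec: "indec E" if "valid_arc \<alpha>" "valid_arc \<beta>" "\<not> crosses \<alpha> \<beta>"
      "nonsplit_ext (arc_model \<alpha>) E (arc_model \<beta>)" for \<alpha> \<beta> E
    proof (cases \<beta>)
      case (Fin a b)
      then show ?thesis using fin_ext_splits[of a b \<alpha> E] that by simp
    next
      case (Inf b)
      then show ?thesis using inf_ext_indec[of \<alpha> b E] that by simp
    qed
    assume "\<not> crosses \<alpha> \<beta>"
    then show "almost_compatible (arc_model \<alpha>) (arc_model \<beta>)"
      unfolding almost_compatible_def using indec[OF \<alpha> \<beta>] indec[OF \<beta> \<alpha>] crosses_sym by blast
  next
    have bad: "\<exists>E. nonsplit_ext (arc_model \<alpha>) E (arc_model \<beta>) \<and> \<not> indec E"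
      if "\<beta> = Fin c d" "hi \<alpha> = b" "c < b" "b < d" "\<And>a. lo \<alpha> = Some a \<Longrightarrow> a < c" for \<alpha> \<beta> b c d
      using crossing_ext[OF that(3,4), of "lo \<alpha>"] that by (auto simp: arc_model_def)
    assume compat: "almost_compatible (arc_model \<alpha>) (arc_model \<beta>)"
    show "\<not> crosses \<alpha> \<beta>"
    proof
      assume cr: "crosses \<alpha> \<beta>"
      have "(\<exists>E. nonsplit_ext (arc_model \<alpha>) E (arc_model \<beta>) \<and> \<not> indec E) \<or>
          (\<exists>E. nonsplit_ext (arc_model \<beta>) E (arc_model \<alpha>) \<and> \<not> indec E)"
      proof (cases \<alpha>)
        case \<alpha>: (Fin a b)
        show ?thesis
        proof (cases \<beta>)
          case \<beta>: (Fin c d)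
          then consider "a < c" "c < b" "b < d" | "c < a" "a < d" "d < b"
            using cr \<alpha> by auto
          then show ?thesis
            using bad[of \<beta> c d \<alpha> b] bad[of \<alpha> a b \<beta> d] \<alpha> \<beta> by cases auto
        next
          case \<beta>: (Inf d)
          then show ?thesis using bad[of \<alpha> a b \<beta> d] \<alpha> cr by auto
        qed
      next
        case \<alpha>: (Inf b)
        then obtain c d where "\<beta> = Fin c d" using cr by (cases \<beta>) auto
        then show ?thesis using bad[of \<beta> c d \<alpha> b] \<alpha> cr by auto
      qed
      then show False using compat unfolding almost_compatible_def by blast
    qed
  qed
  then show ?thesis
    using almost_compatible_iso[OF iso[OF \<alpha>] iso[OF \<beta>] C2m[OF \<alpha>] C2m[OF \<beta>] C2_arc[OF \<alpha>] C2_arc[OF \<beta>]]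
    by simp
qed

section \<open>Subcategories and sets of arcs\<close>

lemma subcatD:
  assumes "subcat A"
  shows "M \<in> A \<Longrightarrow> C2 M" "M \<in> A \<Longrightarrow> C2 N \<Longrightarrow> gm_iso M N \<Longrightarrow> N \<in> A" "\<exists>Z\<in>A. is_zero Z"
    "M \<in> A \<Longrightarrow> N \<in> A \<Longrightarrow> C2 E \<Longrightarrow> is_biprod E M N \<Longrightarrow> E \<in> A"
    "E \<in> A \<Longrightarrow> C2 M \<Longrightarrow> C2 N \<Longrightarrow> is_biprod E M N \<Longrightarrow> M \<in> A"
  using assms unfolding subcat_def by blast+

lemma arc_mod_in_iff:
  assumes "subcat A" "valid_arc \<alpha>" shows "arc_mod \<alpha> \<in> A \<longleftrightarrow> \<alpha> \<in> arcs_of A"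
  using assms indec_arc C2_arc gm_iso_refl subcatD(2)[OF assms(1)] unfolding arcs_of_def by blast

lemma arcs_of_valid: "\<alpha> \<in> arcs_of A \<Longrightarrow> valid_arc \<alpha>"
  by (simp add: arcs_of_def)

lemma retract_in_subcat:
  assumes "subcat A" "M \<in> A" "C2 Z" "retract Z M" shows "Z \<in> A"
proof -
  have "C2 M" using subcatD(1)[OF assms(1,2)] .
  from retract_complement[OF assms(4,3) this] obtain W where "C2 W" "is_biprod M Z W"
    by (elim exE conjE)
  then show ?thesis using subcatD(5)[OF assms(1,2,3)] by blast
qed

text \<open>The class \<open>A\<close> and the set \<open>X\<close> are kept apart because two cases
  are covered: a subcategory with its own arcs, and the enlarged one, with one arc added.\<close>

lemma almost_rigid_arcs:
  assumes C2: "\<And>M. M \<in> A \<Longrightarrow> C2 M"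
    and arcs: "\<And>M. M \<in> A \<Longrightarrow> indec M \<Longrightarrow> \<exists>\<alpha>\<in>X. gm_iso M (arc_mod \<alpha>)"
    and X: "\<And>\<alpha>. \<alpha> \<in> X \<Longrightarrow> valid_arc \<alpha>" "\<And>\<alpha> \<beta>. \<alpha> \<in> X \<Longrightarrow> \<beta> \<in> X \<Longrightarrow> \<not> crosses \<alpha> \<beta>"
  shows "almost_rigid A"
  unfolding almost_rigid_def
proof (intro ballI impI)
  fix M N assume M: "M \<in> A" and N: "N \<in> A" and "indec M \<and> indec N"
  then obtain \<alpha> \<beta> where ab: "\<alpha> \<in> X" "gm_iso M (arc_mod \<alpha>)" "\<beta> \<in> X" "gm_iso N (arc_mod \<beta>)"
    using arcs by meson
  have "almost_compatible (arc_mod \<alpha>) (arc_mod \<beta>)"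
    using compatible_iff X ab(1,3) by blast
  then show "almost_compatible M N"
    using almost_compatible_iso[OF ab(2,4) C2[OF M] C2[OF N] C2_arc[OF X(1)[OF ab(1)]] C2_arc[OF X(1)[OF ab(3)]]]
    by simp
qed

lemma almost_rigid_noncrossing:
  assumes "almost_rigid A" "arc_mod \<alpha> \<in> A" "arc_mod \<beta> \<in> A" "valid_arc \<alpha>" "valid_arc \<beta>"
  shows "\<not> crosses \<alpha> \<beta>"
proof -
  have "almost_compatible (arc_mod \<alpha>) (arc_mod \<beta>)"
    using assms(1-3) indec_arc[OF assms(4)] indec_arc[OF assms(5)] unfolding almost_rigid_def by blast
  then show ?thesis using compatible_iff[OF assms(4,5)] by simp
qed

lemma subcat_almost_rigid_iff:
  assumes A: "subcat A"
  shows "almost_rigid A \<longleftrightarrow> (\<forall>\<alpha>\<in>arcs_of A. \<forall>\<beta>\<in>arcs_of A. \<not> crosses \<alpha> \<beta>)"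
proof
  assume "almost_rigid A"
  then show "\<forall>\<alpha>\<in>arcs_of A. \<forall>\<beta>\<in>arcs_of A. \<not> crosses \<alpha> \<beta>"
    using almost_rigid_noncrossing[of A] arc_mod_in_iff[OF A] arcs_of_valid by blast
next
  assume nc: "\<forall>\<alpha>\<in>arcs_of A. \<forall>\<beta>\<in>arcs_of A. \<not> crosses \<alpha> \<beta>"
  have "\<exists>\<alpha>\<in>arcs_of A. gm_iso M (arc_mod \<alpha>)" if M: "M \<in> A" "indec M" for M
  proof -
    obtain \<alpha> where "valid_arc \<alpha>" "gm_iso M (arc_mod \<alpha>)"
      using indec_is_arc[OF subcatD(1)[OF A M(1)] M(2)] .
    then show ?thesis using M unfolding arcs_of_def by blast
  qed
  then show "almost_rigid A"
    using subcatD(1)[OF A] arcs_of_valid nc by (intro almost_rigid_arcs[of A "arcs_of A"]) blast+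
qed

section \<open>Generation of subcategories by arc modules\<close>

lemma nonzero_below:
  assumes "is_gmod M" "mcm M" "v \<in> pc M m" "v \<noteq> 0" "n \<le> m"
  shows "pc M n \<noteq> {0}"
proof
  assume "pc M n = {0}"
  moreover have "dn M m (nat (m - n)) v \<in> pc M n"
    using dn_in[OF assms(1,3), of "nat (m - n)"] assms(5) by simp
  ultimately have "dn M m (nat (m - n)) v = dn M m (nat (m - n)) 0"
    using lin_on_0[OF dn_lin[OF assms(1)] is_gmodD(1)[OF assms(1)]] by simp
  then have "v = 0"
    using inj_onD[OF dn_inj[OF assms(1,2)]] assms(3) V.subspace_0[OF is_gmodD(1)[OF assms(1)]] by blast
  then show False using assms(4) by simp
qed

lemma not_is_zeroE:
  assumes "is_gmod M" "\<not> is_zero M"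
  obtains v m where "v \<in> pc M m" "v \<noteq> 0"
  using assms V.subspace_0[OF is_gmodD(1)[OF assms(1)]] unfolding is_zero_def vzero_eq by blast

text \<open>The existence half of Krull--Schmidt: arc modules are split off one at a time. Arc
  summands of a complement are again arc summands of \<open>M\<close>, and the sum is put back
  together by additivity of \<open>A\<close>.\<close>

lemma arcs_generate:
  assumes A: "subcat A" and "C2 M"
    and "\<And>\<alpha>. valid_arc \<alpha> \<Longrightarrow> retract (arc_mod \<alpha>) M \<Longrightarrow> \<alpha> \<in> arcs_of A"
  shows "M \<in> A"
proof -
  \<comment> \<open>The induction bounds dimensions in low degrees only. An arc module is nonzero
    from some degree \<open>m\<close> downwards, so splitting it off lowers the dimension there, and
    \<open>n0\<close> is replaced by \<open>min n0 m\<close>.\<close>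
  have "M \<in> A" if "C2 M" "\<And>n. n \<le> n0 \<Longrightarrow> spanned (pc M n) K"
    "\<And>\<alpha>. valid_arc \<alpha> \<Longrightarrow> retract (arc_mod \<alpha>) M \<Longrightarrow> \<alpha> \<in> arcs_of A" for K M n0
    using that
  proof (induction K arbitrary: M n0)
    case (0 M n0)
    note M = C2D(1,2)[OF \<open>C2 M\<close>]
    have "is_zero M"
    proof (rule ccontr)
      assume "\<not> is_zero M"
      then obtain v m where v: "v \<in> pc M m" "v \<noteq> 0" using not_is_zeroE[OF M(1)] by blast
      have "pc M (min m n0) \<noteq> {0}" by (rule nonzero_below[OF M v]) simp
      then show False
        using spanned_0[OF "0.prems"(2)[of "min m n0"]] V.subspace_0[OF is_gmodD(1)[OF M(1)]] by fastforce
    qed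
    moreover obtain Z where "Z \<in> A" "is_zero Z" using subcatD(3)[OF A] by blast
    ultimately show ?case
      using zero_gm_iso[of Z M] C2D(1) subcatD(1,2)[OF A] \<open>C2 M\<close> by blast
  next
    case (Suc K M n0)
    show ?case
    proof (cases "is_zero M")
      case True
      obtain Z where "Z \<in> A" "is_zero Z" using subcatD(3)[OF A] by blast
      then show ?thesis
        using zero_gm_iso[of Z M] True C2D(1) subcatD(1,2)[OF A] \<open>C2 M\<close> by blast
    next
      case False
      obtain \<alpha> where \<alpha>: "valid_arc \<alpha>" "retract (arc_mod \<alpha>) M"
        using has_arc_retract[OF \<open>C2 M\<close> False] .
      note Z = C2_arc[OF \<alpha>(1)]
      from retract_complement[OF \<alpha>(2) Z \<open>C2 M\<close>]
      obtain W where W: "C2 W" "is_biprod M (arc_mod \<alpha>) W" and W': "\<forall>n. V.subspace (pc W n) \<and>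
        pc W n \<subseteq> pc M n \<and> (pc (arc_mod \<alpha>) n \<noteq> {0} \<longrightarrow> pc W n \<noteq> pc M n)"
        by (elim exE conjE)
      obtain v m where v: "v \<in> pc (arc_mod \<alpha>) m" "v \<noteq> 0"
        using not_is_zeroE[OF C2D(1)[OF Z] not_zero_indec[OF indec_arc[OF \<alpha>(1)]]] by blast
      have "W \<in> A"
      proof (rule Suc.IH[OF W(1)])
        fix n assume n: "n \<le> min n0 m"
        have "pc (arc_mod \<alpha>) n \<noteq> {0}"
          using nonzero_below[OF C2D(1,2)[OF Z] v] n by simp
        then have sub: "V.subspace (pc W n)" "pc W n \<subseteq> pc M n" "pc W n \<noteq> pc M n" using W' by simp_all
        then obtain u where u: "u \<in> pc M n" "u \<notin> pc W n" by blast
        have "spanned (pc M n) (Suc K)" using Suc.prems(2)[of n] n by simp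
        then show "spanned (pc W n) K" by (rule spanned_proper_subspace[OF _ sub(1,2) u])
      next
        fix \<delta> assume "valid_arc \<delta>" "retract (arc_mod \<delta>) W"
        then show "\<delta> \<in> arcs_of A"
          using Suc.prems(3) retract_trans is_biprod_retract(2)[OF W(2)] by blast
      qed
      moreover have "arc_mod \<alpha> \<in> A"
        using arc_mod_in_iff[OF A \<alpha>(1)] Suc.prems(3)[OF \<alpha>] by simp
      ultimately show ?thesis using subcatD(4)[OF A _ _ \<open>C2 M\<close> W(2)] by blast
    qed
  qed
  moreover obtain K where "\<And>n. spanned (pc M n) K"
    using C2D(3)[OF \<open>C2 M\<close>] unfolding tame_def by blast
  ultimately show ?thesis using assms(2,3) by blast
qed

lemma arc_retract_biprod:
  assumes "valid_arc \<alpha>" "retract (arc_mod \<alpha>) E" "is_biprod E X Y" "C2 E"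
  shows "retract (arc_mod \<alpha>) X \<or> retract (arc_mod \<alpha>) Y"
proof -
  note iso = model_arc_iso[OF assms(1)]
  have "retract (model (lo \<alpha>) (hi \<alpha>)) E"
    using retract_trans[OF gm_iso_retract[OF iso] assms(2)] .
  then have "retract (model (lo \<alpha>) (hi \<alpha>)) X \<or> retract (model (lo \<alpha>) (hi \<alpha>)) Y"
    using model_retract_biprod assms(1,3,4) valid_lo_hi C2D(1) by blast
  then show ?thesis
    using retract_trans[OF gm_iso_retract[OF gm_iso_sym[OF iso]]] by blast
qed

text \<open>Closure under direct sums is where local endomorphism rings enter.\<close>

lemma subcat_adjoin_arc:
  assumes A: "subcat A" and \<gamma>: "valid_arc \<gamma>"
  defines "B \<equiv> {X. C2 X \<and> (\<forall>\<delta>. valid_arc \<delta> \<longrightarrow> retract (arc_mod \<delta>) X \<longrightarrow>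
    \<delta> \<in> arcs_of A \<or> gm_iso (arc_mod \<delta>) (arc_mod \<gamma>))}"
  shows "subcat B" "insert (arc_mod \<gamma>) A \<subseteq> B"
proof -
  have AB: "A \<subseteq> B"
  proof
    fix X assume X: "X \<in> A"
    have "\<delta> \<in> arcs_of A" if "valid_arc \<delta>" "retract (arc_mod \<delta>) X" for \<delta>
      using retract_in_subcat[OF A X C2_arc[OF that(1)] that(2)] arc_mod_in_iff[OF A that(1)] by simp
    then show "X \<in> B" unfolding B_def using subcatD(1)[OF A X] by blast
  qed
  have "gm_iso (arc_mod \<delta>) (arc_mod \<gamma>)" if "valid_arc \<delta>" "retract (arc_mod \<delta>) (arc_mod \<gamma>)" for \<delta>
    using retract_indec_iso[OF that(2) not_zero_indec[OF indec_arc[OF that(1)]] indec_arc[OF \<gamma>]]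
      C2D(1)[OF C2_arc] that(1) \<gamma> by blast
  then show "insert (arc_mod \<gamma>) A \<subseteq> B"
    using AB C2_arc[OF \<gamma>] unfolding B_def by blast
  show "subcat B"
    unfolding subcat_def
  proof (intro conjI allI impI ballI)
    show "B \<subseteq> {M. C2 M}" by (auto simp: B_def)
    show "\<exists>Z\<in>B. is_zero Z" using subcatD(3)[OF A] AB by blast
  next
    fix M N assume M: "M \<in> B" and N: "C2 N \<and> gm_iso M N"
    then have "retract N M" using gm_iso_retract gm_iso_sym by blast
    then show "N \<in> B" using M N retract_trans unfolding B_def by blast
  next
    fix E M N assume *: "M \<in> B \<and> N \<in> B \<and> C2 E \<and> is_biprod E M N"
    then show "E \<in> B" using arc_retract_biprod[of _ E M N] unfolding B_def by blast
  next
    fix E M N assume *: "E \<in> B \<and> C2 M \<and> C2 N \<and> is_biprod E M N"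
    then have "retract M E" "retract N E" using is_biprod_retract by blast+
    then show "M \<in> B" "N \<in> B" using * retract_trans unfolding B_def by blast+
  qed
qed

theorem theorem5p5:
  assumes "subcat A"
  shows "max_almost_rigid A \<longleftrightarrow> triangulation (arcs_of A)"
proof
  note A = assms
  assume max: "max_almost_rigid A"
  have nc: "\<not> crosses \<alpha> \<beta>" if "\<alpha> \<in> arcs_of A" "\<beta> \<in> arcs_of A" for \<alpha> \<beta>
    using max subcat_almost_rigid_iff[OF A] that unfolding max_almost_rigid_def by blast
  have "\<exists>\<alpha>\<in>arcs_of A. crosses \<gamma> \<alpha>" if \<gamma>: "valid_arc \<gamma>" "\<gamma> \<notin> arcs_of A" for \<gamma>
  proof (rule ccontr)
    assume none: "\<not> (\<exists>\<alpha>\<in>arcs_of A. crosses \<gamma> \<alpha>)"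
    \<comment> \<open>An upper bound for the additive closure suffices, because almost rigidity
      passes to smaller classes.\<close>
    define B where "B = {X. C2 X \<and> (\<forall>\<delta>. valid_arc \<delta> \<longrightarrow> retract (arc_mod \<delta>) X \<longrightarrow>
      \<delta> \<in> arcs_of A \<or> gm_iso (arc_mod \<delta>) (arc_mod \<gamma>))}"
    note B = subcat_adjoin_arc[OF A \<gamma>(1), folded B_def]
    have "almost_rigid B"
    proof (rule almost_rigid_arcs[where X = "insert \<gamma> (arcs_of A)"])
      fix M assume M: "M \<in> B" "indec M"
      then have "C2 M" by (simp add: B_def)
      then obtain \<delta> where \<delta>: "valid_arc \<delta>" "gm_iso M (arc_mod \<delta>)" using indec_is_arc M(2) by blast
      then have "\<delta> \<in> arcs_of A \<or> gm_iso (arc_mod \<delta>) (arc_mod \<gamma>)"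
        using M(1) gm_iso_retract[OF gm_iso_sym] unfolding B_def by blast
      then show "\<exists>\<alpha>\<in>insert \<gamma> (arcs_of A). gm_iso M (arc_mod \<alpha>)"
        using \<delta>(2) gm_iso_trans by blast
    next
      have "\<not> crosses \<gamma> \<gamma>" by (cases \<gamma>) auto
      then show "\<not> crosses \<alpha> \<beta>" if "\<alpha> \<in> insert \<gamma> (arcs_of A)" "\<beta> \<in> insert \<gamma> (arcs_of A)" for \<alpha> \<beta>
        using that none nc crosses_sym by blast
    qed (use \<gamma>(1) arcs_of_valid in \<open>auto simp: B_def\<close>)
    moreover have "add_closure (insert (arc_mod \<gamma>) A) \<subseteq> B"
      using B unfolding add_closure_def by blast
    ultimately have "almost_rigid (add_closure (insert (arc_mod \<gamma>) A))"
      unfolding almost_rigid_def by blast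
    moreover have "arc_mod \<gamma> \<notin> A" using arc_mod_in_iff[OF A \<gamma>(1)] \<gamma>(2) by simp
    ultimately show False
      using max C2_arc[OF \<gamma>(1)] unfolding max_almost_rigid_def by blast
  qed
  then show "triangulation (arcs_of A)"
    unfolding triangulation_def using nc arcs_of_valid by blast
next
  note A = assms
  assume tri: "triangulation (arcs_of A)"
  have "almost_rigid A"
    using tri subcat_almost_rigid_iff[OF A] by (simp add: triangulation_def)
  moreover have "\<not> almost_rigid (add_closure (insert M A))" if M: "C2 M" "M \<notin> A" for M
  proof
    assume rigid: "almost_rigid (add_closure (insert M A))"
    \<comment> \<open>By \<open>arcs_generate\<close>, a module outside \<open>A\<close> has an arc
      summand whose arc is not in \<open>arcs_of A\<close>; maximality of the triangulation then
      provides an arc crossing it.\<close>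
    obtain \<gamma> where \<gamma>: "valid_arc \<gamma>" "retract (arc_mod \<gamma>) M" "\<gamma> \<notin> arcs_of A"
      using arcs_generate[OF A M(1)] M(2) by blast
    obtain \<alpha> where \<alpha>: "\<alpha> \<in> arcs_of A" "crosses \<gamma> \<alpha>"
      using tri \<gamma>(1,3) unfolding triangulation_def by blast
    note \<alpha>v = arcs_of_valid[OF \<alpha>(1)]
    \<comment> \<open>Every subcategory containing \<open>M\<close> and \<open>A\<close> contains
      both modules: this one as a summand of \<open>M\<close>, the next as an object of
      \<open>A\<close>.\<close>
    have "arc_mod \<gamma> \<in> add_closure (insert M A)"
      unfolding add_closure_def using retract_in_subcat[OF _ _ C2_arc[OF \<gamma>(1)] \<gamma>(2)] by blast
    moreover have "arc_mod \<alpha> \<in> add_closure (insert M A)"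
      unfolding add_closure_def using arc_mod_in_iff[OF A \<alpha>v] \<alpha>(1) by blast
    ultimately show False
      using almost_rigid_noncrossing[OF rigid _ _ \<gamma>(1) \<alpha>v] \<alpha>(2) by blast
  qed
  ultimately show "max_almost_rigid A" unfolding max_almost_rigid_def by blast
qed

end
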